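(* Let $\Bbbk$ be a commutative $\mathbb{Z}[\delta]$-algebra, $S$ a finite set, and $\mathcal{STL}$ the $S$-colored Temperley–Lieb 2-category over $\Bbbk$. (1) When $\ell(\underline x)\le 2$, the idempotent $JW(\underline x)$ exists and equals the identity map. (2) Suppose that $\underline x=\ldots rb$ (the last two colors being $r\neq b$) and that $JW(\underline y)$ exists for all initial subsequences $\underline y$ of $\underline x$ (including $\underline x$). (a) For a color $g\neq r,b$, $JW(\underline xg)$ exists and $$JW(\underline x g)=JW(\underline x)\otimes \mathbb{1}_{bg},$$ the horizontal concatenation of $JW(\underline x)$ with one vertical strand. (b) Let $k$ be the length of the tail of $\underline x$, let $\underline z=\ldots r$ be the initial subsequence of $\underline x$ missing only the final $b$, and let $\cap:\underline xr\to\underline z$ (resp. $\cup:\underline z\to\underline xr$) be the diagram consisting of vertical strands and a single cap $rbr\to r$ (resp. cup $r\to rbr$) at the far right. If $[k]$ is invertible in $\Bbbk$, then $JW(\underline xr)$ exists and $$JW(\underline x r)=JW(\underline x)\otimes \mathbb{1}_{br}+\frac{[k-1]}{[k]}\,\bigl(JW(\underline x)\otimes \mathbb{1}_{br}\bigr)\circ\cup\circ JW(\underline z)\circ\cap\circ\bigl(JW(\underline x)\otimes \mathbb{1}_{br}\bigr).$$ Moreover, the map $$-\frac{[k-1]}{[k]}\,\bigl(JW(\underline x)\otimes \mathbb{1}_{br}\bigr)\circ\cup\circ JW(\underline z)\circ\cap\circ\bigl(JW(\underline x)\otimes \mathbb{1}_{br}\bigr)$$ is an idempotent in $\mathrm{End}(\underline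 xr)$ orthogonal to $JW(\underline xr)$. If $[k]$ is not invertible in $\Bbbk$, then $JW(\underline xr)$ does not exist.
   Context: **The 2-category $\mathcal{STL}$ over $\Bbbk$.** Objects: elements of $S$ ("colors"). $1$-morphisms: nonempty sequences $\underline x=s_1\cdots s_m$ with $s_i\in S$, $s_i\neq s_{i+1}$, with source $s_m$, target $s_1$, length $\ell(\underline x)=m$, drawn as $m-1$ points on a line separating regions colored $s_1,\dots,s_m$; composition is gluing along the shared color, $(s_1\cdots s_m)(t_1\cdots t_k)=s_1\cdots s_mt_2\cdots t_k$ if $s_m=t_1$; $\otimes$ denotes the corresponding horizontal concatenation of $2$-morphisms. $2$-morphisms are generated over $\Bbbk$ by colored caps $brb\to b$ and cups $b\to brb$ ($b\ne r\in S$), modulo isotopy and the relation that any closed circle (for any coloring of inside and outside by distinct colors) equals $-\delta$. $\mathrm{Hom}(\underline x,\underline y)$ has as $\Bbbk$-basis the $S$-colored crossingless matchings in the strip (adjacent regions of different colors) with bottom boundary $\underline x$ and top boundary $\underline y$; "coefficient of the identity" refers to this basis. **Top idempotent.** $B(\underline x)\subset\mathrm{End}(\underline x)$ is the set of $f$ with $fc=0$ for every cup $c$ (diagram with target $\underline x$ consisting of a single cup and vertical strands). $JW(\underline x)$ *exists* if $B(\underline x)$ contains an element whose coefficient of the identity is invertible; then $JW(\underline x)$ is the unique element of $B(\underline x)$ whose coefficient of the identity is $1$ (it is idempotent and also killed by all caps on top). **Sequences.** Subsequences are consecutive. An initial (final) subsequence consists of the first (last) $j$ colors for some $1\le j\le\ell(\underline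 x)$. A subsequence is alternating if it alternates between two colors; the tail of $\underline x$ is its maximal alternating final subsequence. **Quantum numbers** in $\Bbbk$: $[0]=0$, $[1]=1$, $[2]$ is the image of $\delta$, $[2][m]=[m+1]+[m-1]$. *)

theory Defs
  imports "HOL-Library.Poly_Mapping" "HOL-Library.Disjoint_Sets" "HOL-Library.Sublist"
begin

section \<open>1-morphisms and colored crossingless matchings\<close>

definition one_mor :: "'c set \<Rightarrow> 'c list \<Rightarrow> bool" where
  "one_mor S x \<longleftrightarrow> x \<noteq> [] \<and> set x \<subseteq> S \<and> distinct_adj x"

text \<open>Boundary points of a strip, numbered from left to right. On a boundary line colored
  by a list of length \<open>m\<close> there are \<open>m - 1\<close> points; point \<open>i\<close> separates
  the regions with colors number \<open>i\<close> and \<open>i + 1\<close>.\<close>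

datatype point = Bot nat | Top nat

text \<open>Diagrams up to isotopy: the bottom and top colorings, and the arcs, each given by the
  set of its two end points.\<close>

datatype 'c diagram =
  Diagram (src: "'c list") (tgt: "'c list") (arcs: "point set set")

definition points :: "'c list \<Rightarrow> 'c list \<Rightarrow> point set" where
  "points x y = Bot ` {..<length x - 1} \<union> Top ` {..<length y - 1}"

text \<open>The position of a point when the boundary of the strip is traversed counterclockwise,
  starting with the rightmost top point.\<close>

fun pos :: "point \<Rightarrow> int" where
  "pos (Bot i) = int i"
| "pos (Top j) = - int j - 1"

definition noncrossing :: "point set set \<Rightarrow> bool" where
  "noncrossing A \<longleftrightarrow>
    \<not> (\<exists>p q p' q'. {p, p'} \<in> A \<and> {q, q'} \<in> A \<and> pos p < pos q \<and> pos q < pos p' \<and> pos p' < pos q')"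

text \<open>The colors immediately to the left and to the right of a boundary point.\<close>

fun lcol :: "'c list \<Rightarrow> 'c list \<Rightarrow> point \<Rightarrow> 'c" where
  "lcol x y (Bot i) = x ! i"
| "lcol x y (Top i) = y ! i"

fun rcol :: "'c list \<Rightarrow> 'c list \<Rightarrow> point \<Rightarrow> 'c" where
  "rcol x y (Bot i) = x ! Suc i"
| "rcol x y (Top i) = y ! Suc i"

fun same_side :: "point \<Rightarrow> point \<Rightarrow> bool" where
  "same_side (Bot _) (Bot _) = True"
| "same_side (Top _) (Top _) = True"
| "same_side _ _ = False"

text \<open>Every region of a matching without closed components meets the boundary of the strip, so a
  coloring of the regions amounts to boundary colors which agree along each side of each arc and
  along the left and right ends of the strip. The left side of an arc at one end point is its
  right side at the other end point if both lie on the same boundary line.\<close>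

definition color_compatible :: "'c list \<Rightarrow> 'c list \<Rightarrow> point set set \<Rightarrow> bool" where
  "color_compatible x y A \<longleftrightarrow> hd x = hd y \<and> last x = last y \<and>
    (\<forall>p q. {p, q} \<in> A \<and> p \<noteq> q \<longrightarrow>
      (if same_side p q then lcol x y p = rcol x y q \<and> rcol x y p = lcol x y q
       else lcol x y p = lcol x y q \<and> rcol x y p = rcol x y q))"

text \<open>The crossingless matchings with bottom \<open>x\<close> and top \<open>y\<close>. That adjacent
  regions have different colors is part of the condition on \<open>x\<close> and \<open>y\<close>.\<close>

definition diagrams :: "'c set \<Rightarrow> 'c list \<Rightarrow> 'c list \<Rightarrow> 'c diagram set" where
  "diagrams S x y = {D. src D = x \<and> tgt D = y \<and> one_mor S x \<and> one_mor S y \<and>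
     partition_on (points x y) (arcs D) \<and> (\<forall>a\<in>arcs D. card a = 2) \<and>
     noncrossing (arcs D) \<and> color_compatible x y (arcs D)}"

definition id_diag :: "'c list \<Rightarrow> 'c diagram" where
  "id_diag x = Diagram x x {{Bot i, Top i} | i. i < length x - 1}"

definition cap_diag :: "'c \<Rightarrow> 'c \<Rightarrow> 'c diagram" where
  "cap_diag b r = Diagram [b, r, b] [b] {{Bot 0, Bot 1}}"

definition cup_diag :: "'c \<Rightarrow> 'c \<Rightarrow> 'c diagram" where
  "cup_diag b r = Diagram [b] [b, r, b] {{Top 0, Top 1}}"

section \<open>Composition of diagrams\<close>

text \<open>Horizontal concatenation, glued along the common color of the last region of the left
  factor and the first region of the right factor.\<close>

fun shift :: "nat \<Rightarrow> nat \<Rightarrow> point \<Rightarrow> point" where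
  "shift m n (Bot i) = Bot (m + i)"
| "shift m n (Top j) = Top (n + j)"

definition hcomp_diag :: "'c diagram \<Rightarrow> 'c diagram \<Rightarrow> 'c diagram" where
  "hcomp_diag D E = Diagram (src D @ tl (src E)) (tgt D @ tl (tgt E))
     (arcs D \<union> (\<lambda>a. shift (length (src D) - 1) (length (tgt D) - 1) ` a) ` arcs E)"

text \<open>For vertical composition, \<open>D\<close> is stacked on top of \<open>E\<close>, the top points of
  \<open>E\<close> and the bottom points of \<open>D\<close> becoming the points of the middle line.\<close>

datatype node = BotN nat | MidN nat | TopN nat

fun upper :: "point \<Rightarrow> node" where
  "upper (Bot i) = MidN i"
| "upper (Top j) = TopN j"

fun lower :: "point \<Rightarrow> node" where
  "lower (Bot i) = BotN i"
| "lower (Top j) = MidN j"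

fun outer :: "point \<Rightarrow> node" where
  "outer (Bot i) = BotN i"
| "outer (Top j) = TopN j"

definition linked :: "'c diagram \<Rightarrow> 'c diagram \<Rightarrow> (node \<times> node) set" where
  "linked D E =
    ({(upper p, upper q) | p q. {p, q} \<in> arcs D} \<union> {(lower p, lower q) | p q. {p, q} \<in> arcs E})\<^sup>*"

definition vcomp_diag :: "'c diagram \<Rightarrow> 'c diagram \<Rightarrow> 'c diagram" where
  "vcomp_diag D E = Diagram (src E) (tgt D)
     {{p, q} | p q. p \<noteq> q \<and> (outer p, outer q) \<in> linked D E}"

text \<open>The number of closed circles: these are the components of the stacked diagram which
  contain points of the middle line only.\<close>

definition circles :: "'c diagram \<Rightarrow> 'c diagram \<Rightarrow> nat" where
  "circles D E =
    card {C. C \<subseteq> range MidN \<and> (\<exists>j < length (tgt E) - 1. C = linked D E `` {MidN j})}"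

section \<open>2-morphisms\<close>

text \<open>The coefficient of a diagram \<open>D\<close> in \<open>f\<close> is \<open>lookup f D\<close>. The
  \<open>\<int>[\<delta>]\<close>-algebra structure of the coefficient ring is given by the image of
  \<open>\<delta>\<close>, also denoted by \<open>\<delta>\<close> below.\<close>

type_synonym ('c, 'k) two_mor = "'c diagram \<Rightarrow>\<^sub>0 'k"

definition Hom :: "'c set \<Rightarrow> 'c list \<Rightarrow> 'c list \<Rightarrow> ('c, 'k::comm_ring_1) two_mor set" where
  "Hom S x y = {f. Poly_Mapping.keys f \<subseteq> diagrams S x y}"

definition of_diag :: "'c diagram \<Rightarrow> ('c, 'k::comm_ring_1) two_mor" where
  "of_diag D = Poly_Mapping.single D 1"

abbreviation id_mor :: "'c list \<Rightarrow> ('c, 'k::comm_ring_1) two_mor" where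
  "id_mor x \<equiv> of_diag (id_diag x)"

definition scale :: "'k \<Rightarrow> ('c, 'k::comm_ring_1) two_mor \<Rightarrow> ('c, 'k) two_mor" where
  "scale a f = Poly_Mapping.map ((*) a) f"

text \<open>Bilinear extensions of the two compositions of diagrams; products of diagrams which are
  not composable are taken to be zero.\<close>

definition vcomp :: "'k \<Rightarrow> ('c, 'k::comm_ring_1) two_mor \<Rightarrow> ('c, 'k) two_mor \<Rightarrow> ('c, 'k) two_mor" where
  "vcomp \<delta> f g = (\<Sum>D\<in>Poly_Mapping.keys f. \<Sum>E\<in>Poly_Mapping.keys g.
     if src D = tgt E
     then Poly_Mapping.single (vcomp_diag D E)
            ((- \<delta>) ^ circles D E * (Poly_Mapping.lookup f D * Poly_Mapping.lookup g E))
     else 0)"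

definition hcomp :: "('c, 'k::comm_ring_1) two_mor \<Rightarrow> ('c, 'k) two_mor \<Rightarrow> ('c, 'k) two_mor"
    (infixr \<open>\<otimes>\<close> 70) where
  "f \<otimes> g = (\<Sum>D\<in>Poly_Mapping.keys f. \<Sum>E\<in>Poly_Mapping.keys g.
     if last (src D) = hd (src E)
     then Poly_Mapping.single (hcomp_diag D E)
            (Poly_Mapping.lookup f D * Poly_Mapping.lookup g E)
     else 0)"

section \<open>The top idempotent\<close>

text \<open>The diagrams with target \<open>x\<close> consisting of a single cup and vertical strands.\<close>

definition cups :: "'c list \<Rightarrow> 'c diagram set" where
  "cups x = {hcomp_diag (hcomp_diag (id_diag (u @ [b])) (cup_diag b r)) (id_diag (b # v)) |
     u b r v. x = u @ [b, r, b] @ v}"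

definition B :: "'c set \<Rightarrow> 'k \<Rightarrow> 'c list \<Rightarrow> ('c, 'k::comm_ring_1) two_mor set" where
  "B S \<delta> x = {f \<in> Hom S x x. \<forall>c\<in>cups x. vcomp \<delta> f (of_diag c) = 0}"

definition JW_exists :: "'c set \<Rightarrow> 'k::comm_ring_1 \<Rightarrow> 'c list \<Rightarrow> bool" where
  "JW_exists S \<delta> x \<longleftrightarrow> (\<exists>f\<in>B S \<delta> x. Poly_Mapping.lookup f (id_diag x) dvd 1)"

definition JW :: "'c set \<Rightarrow> 'k \<Rightarrow> 'c list \<Rightarrow> ('c, 'k::comm_ring_1) two_mor" where
  "JW S \<delta> x = (THE f. f \<in> B S \<delta> x \<and> Poly_Mapping.lookup f (id_diag x) = 1)"

section \<open>Tails and quantum numbers\<close>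

definition alternating :: "'c list \<Rightarrow> bool" where
  "alternating y \<longleftrightarrow> (\<exists>a b. a \<noteq> b \<and> (\<forall>i<length y. y ! i = (if even i then a else b)))"

definition tail_length :: "'c list \<Rightarrow> nat" where
  "tail_length x = Max (length ` {y. y \<noteq> [] \<and> suffix y x \<and> alternating y})"

fun qnum :: "'k::comm_ring_1 \<Rightarrow> nat \<Rightarrow> 'k" where
  "qnum \<delta> 0 = 0"
| "qnum \<delta> (Suc 0) = 1"
| "qnum \<delta> (Suc (Suc m)) = \<delta> * qnum \<delta> (Suc m) - qnum \<delta> m"

text \<open>The inverse of an invertible element; unspecified otherwise.\<close>

definition unit_inv :: "'k::comm_ring_1 \<Rightarrow> 'k" where
  "unit_inv a = (THE b. a * b = 1)"

end

theory Submission
  imports Defs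
begin

text \<open>Every non-identity diagram whose target is at least as long as its source factors as a cup
  after another diagram. Hence an element \<open>f\<close> of \<open>B S \<delta> x\<close> absorbs any endomorphism \<open>g\<close> of \<open>x\<close> up to
  the identity coefficient of \<open>g\<close>; comparing \<open>f \<circ> flip g\<close> with its reflection gives uniqueness of
  \<open>JW\<close> and its invariance under reflection. Let \<open>P\<close> be \<open>JW(x)\<close> with one strand added. If
  \<open>cap \<circ> P \<circ> cup = l \<cdot> JW(z)\<close>, then \<open>P + c \<cdot> P \<circ> cup \<circ> JW(z) \<circ> cap \<circ> P\<close> is killed by all cups as soon as
  \<open>c l = - 1\<close>. Conversely, if \<open>JW(x r)\<close> exists, it equals \<open>P + h \<circ> cap \<circ> P\<close> for some \<open>h\<close>, and composing
  with the last cup and reading off the coefficient of that cup shows that \<open>l\<close> is invertible. The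
  value \<open>l = - [k] / [k - 1]\<close> comes from induction on the tail by the zigzag relation.\<close>

section \<open>Connectivity in unions of relations\<close>

text \<open>Diagrams are concrete matchings, composed by connectivity in the stacked picture, so
  even the category laws need work. Associativity, with the number of circles, is a count of
  components of relations and uses no planarity. Planarity and coloring of a composite are checked
  only for stacking one cup or one cap; all other composites follow by factoring into these. The
  formula for the trace scalar \<open>l\<close> divides by [k - 1], while the theorem only speaks of
  [k]. The gap is closed by the converse half of the recursion: existence of \<open>JW(x)\<close>
  makes the trace scalar of the preceding step a unit, and with it [k - 1], where k is the tail
  length of x. The next scalar is then
  \<open>- \<delta> + [k - 2] / [k - 1] = - [k] / [k - 1]\<close>: the first term is a closed
  circle, the second comes from two zigzags in the correction term. The coefficient
  \<open>[k - 1] / [k]\<close> of the theorem is the negative inverse of this scalar.\<close>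

lemma rtrancl_quotient:
  assumes fib: "\<And>a b. a \<in> N \<Longrightarrow> b \<in> N \<Longrightarrow> h a = h b \<Longrightarrow> (a, b) \<in> r\<^sup>*"
    and N: "Field r \<subseteq> N" "a \<in> N" "b \<in> N"
  shows "(h a, h b) \<in> (map_prod h h ` r)\<^sup>* \<longleftrightarrow> (a, b) \<in> r\<^sup>*"
proof
  \<comment> \<open>A path in the quotient is lifted edge by edge. The lift of the next edge need
    not start where the previous lift ended, but both points have the same image, so
    \<open>fib\<close> bridges the gap.\<close>
  have "\<exists>b\<in>N. y = h b \<and> (a, b) \<in> r\<^sup>*" if "(h a, y) \<in> (map_prod h h ` r)\<^sup>*" for y
    using that
  proof (induction rule: rtrancl_induct)
    case base
    then show ?case using N by auto
  next
    case (step y z)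
    then obtain b c d where b: "b \<in> N" "y = h b" "(a, b) \<in> r\<^sup>*"
      and cd: "(c, d) \<in> r" "y = h c" "z = h d" by auto
    have "c \<in> N" "d \<in> N" using cd N by (auto simp: Field_def)
    then show ?case using b cd fib[of b c]
      by (metis rtrancl.rtrancl_into_rtrancl rtrancl_trans)
  qed
  then show "(a, b) \<in> r\<^sup>*" if "(h a, h b) \<in> (map_prod h h ` r)\<^sup>*"
    using that fib N(3) by (metis rtrancl_trans)
  show "(h a, h b) \<in> (map_prod h h ` r)\<^sup>*" if "(a, b) \<in> r\<^sup>*"
    using that
  proof (induction rule: rtrancl_induct)
    case (step y z)
    have "(h y, h z) \<in> map_prod h h ` r" using step(2) by force
    with step(3) show ?case by (rule rtrancl_into_rtrancl)
  qed simp
qed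

lemma rtrancl_inj_image:
  assumes "inj f"
  shows "(f a, f b) \<in> (map_prod f f ` r)\<^sup>* \<longleftrightarrow> (a, b) \<in> r\<^sup>*"
  by (rule rtrancl_quotient[where N = UNIV]) (use assms in \<open>auto dest: injD\<close>)

lemma rtrancl_Image_inj:
  assumes "inj f"
  shows "(map_prod f f ` r)\<^sup>* `` {f a} = f ` (r\<^sup>* `` {a})"
proof -
  have "y \<in> range f" if "(f a, y) \<in> (map_prod f f ` r)\<^sup>*" for y
    using that by (induction rule: rtrancl_induct) auto
  then show ?thesis using rtrancl_inj_image[OF assms, of a _ r] by blast
qed

lemma rtrancl_not_Field: "(a, b) \<in> r\<^sup>* \<Longrightarrow> a \<notin> Field r \<or> b \<notin> Field r \<Longrightarrow> a = b"
  by (metis FieldI1 FieldI2 converse_rtranclE rtranclE)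

lemma rtrancl_Image_not_Field: "n \<notin> Field r \<Longrightarrow> r\<^sup>* `` {n} = {n}"
  using rtrancl_not_Field[of n _ r] by auto

lemma rtrancl_Image_Field: "r\<^sup>* `` {n} \<subseteq> insert n (Field r)"
  using rtrancl_not_Field[of n _ r] by auto

lemma rtrancl_Un_disjoint:
  assumes "Field A \<inter> Field F = {}"
  shows "(A \<union> F)\<^sup>* = A\<^sup>* \<union> F\<^sup>*"
proof
  have "(a, b) \<in> A\<^sup>* \<union> F\<^sup>*" if "(a, b) \<in> (A \<union> F)\<^sup>*" for a b
    using that
  proof (induction rule: rtrancl_induct)
    case (step y z)
    show ?case
    proof (cases "(y, z) \<in> A")
      case True
      then have "(a, y) \<in> A\<^sup>*" using step(3) assms rtrancl_not_Field[of a y F]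
        by (auto simp: Field_def)
      then show ?thesis using True by (auto intro: rtrancl_into_rtrancl)
    next
      case False
      then have "(a, y) \<in> F\<^sup>*" "(y, z) \<in> F" using step(2,3) assms rtrancl_not_Field[of a y A]
        by (auto simp: Field_def)
      then show ?thesis by (auto intro: rtrancl_into_rtrancl)
    qed
  qed simp
  then show "(A \<union> F)\<^sup>* \<subseteq> A\<^sup>* \<union> F\<^sup>*" by auto
  show "A\<^sup>* \<union> F\<^sup>* \<subseteq> (A \<union> F)\<^sup>*" by (simp add: rtrancl_mono)
qed

text \<open>What vertical composition does to the middle line \<open>X\<close>: only points outside
  remain, joined when a path connects them. It is reflexive outside \<open>X\<close>, whereas arcs
  join distinct points; hence the \<open>- Id\<close> when the two are compared.\<close>

definition contract :: "'a set \<Rightarrow> ('a \<times> 'a) set \<Rightarrow> ('a \<times> 'a) set" where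
  "contract X A = {(p, q). p \<notin> X \<and> q \<notin> X \<and> (p, q) \<in> A\<^sup>*}"

text \<open>\<open>F\<close> never touches \<open>X\<close>, so a path of
  \<open>A \<union> F\<close> between points outside \<open>X\<close> splits at its
  \<open>F\<close>-steps into stretches of \<open>A\<close> with both ends outside \<open>X\<close>,
  and each stretch is one step of \<open>contract X A\<close>.\<close>

lemma rtrancl_contract:
  assumes "Field F \<inter> X = {}" "p \<notin> X" "q \<notin> X"
  shows "(p, q) \<in> (contract X A \<union> F)\<^sup>* \<longleftrightarrow> (p, q) \<in> (A \<union> F)\<^sup>*"
proof
  \<comment> \<open>The invariant keeps the last stretch of \<open>A\<close>-steps pending, because
    the current point \<open>y\<close> may lie in \<open>X\<close>, where \<open>contract\<close>
    has no edge.\<close>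
  have ex: "\<exists>y'. y' \<notin> X \<and> (p, y') \<in> (contract X A \<union> F)\<^sup>* \<and> (y', y) \<in> A\<^sup>*"
    if "(p, y) \<in> (A \<union> F)\<^sup>*" for y
    using that
  proof (induction rule: rtrancl_induct)
    case base
    then show ?case using assms by auto
  next
    case (step y z)
    then obtain y' where y': "y' \<notin> X" "(p, y') \<in> (contract X A \<union> F)\<^sup>*" "(y', y) \<in> A\<^sup>*" by auto
    show ?case
    proof (cases "(y, z) \<in> A")
      case True
      then show ?thesis using y' by (meson rtrancl.rtrancl_into_rtrancl)
    next
      case False
      then have F: "(y, z) \<in> F" using step by auto
      then have "y \<notin> X" "z \<notin> X" using assms by (auto simp: Field_def)
      then have "(y', y) \<in> contract X A" using y' by (auto simp: contract_def)
      then have "(p, z) \<in> (contract X A \<union> F)\<^sup>*" using F y'(2)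
        by (meson UnCI rtrancl.rtrancl_into_rtrancl)
      then show ?thesis using \<open>z \<notin> X\<close> by auto
    qed
  qed
  show "(p, q) \<in> (contract X A \<union> F)\<^sup>*" if pq: "(p, q) \<in> (A \<union> F)\<^sup>*"
  proof -
    obtain y' where "y' \<notin> X" "(p, y') \<in> (contract X A \<union> F)\<^sup>*" "(y', q) \<in> A\<^sup>*"
      using ex[OF pq] by blast
    moreover from this assms have "(y', q) \<in> contract X A" by (auto simp: contract_def)
    ultimately show ?thesis by (meson UnCI rtrancl.rtrancl_into_rtrancl)
  qed
  have "contract X A \<union> F \<subseteq> (A \<union> F)\<^sup>*"
    using rtrancl_mono[of A "A \<union> F"] by (auto simp: contract_def)
  then show "(p, q) \<in> (A \<union> F)\<^sup>*" if "(p, q) \<in> (contract X A \<union> F)\<^sup>*"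
    using that by (metis rtrancl_subset_rtrancl subsetD)
qed

text \<open>The number of these components is the number of closed circles when \<open>r\<close> is the
  adjacency relation of stacked diagrams and \<open>N\<close> consists of the inner points.\<close>

definition inner_comps :: "('a \<times> 'a) set \<Rightarrow> 'a set \<Rightarrow> 'a set set" where
  "inner_comps r N = {C. C \<subseteq> N \<and> (\<exists>n\<in>N. C = r\<^sup>* `` {n})}"

lemma inner_comps_subset: "inner_comps r N \<subseteq> Pow N"
  by (auto simp: inner_comps_def)

lemma finite_inner_comps: "finite N \<Longrightarrow> finite (inner_comps r N)"
  by (meson finite_Pow_iff finite_subset inner_comps_subset)

lemma inner_comps_inj_image:
  assumes "inj f"
  shows "card (inner_comps (map_prod f f ` r) (f ` N)) = card (inner_comps r N)"
proof -
  have "inner_comps (map_prod f f ` r) (f ` N) = (`) f ` inner_comps r N"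
  proof (intro equalityI subsetI)
    fix C assume "C \<in> inner_comps (map_prod f f ` r) (f ` N)"
    then obtain n where "n \<in> N" "C \<subseteq> f ` N" "C = f ` (r\<^sup>* `` {n})"
      using rtrancl_Image_inj[OF assms, of r] by (auto simp: inner_comps_def)
    then show "C \<in> (`) f ` inner_comps r N"
      unfolding inner_comps_def using inj_image_subset_iff[OF assms] by blast
  next
    fix C assume "C \<in> (`) f ` inner_comps r N"
    then obtain n where "n \<in> N" "C \<subseteq> f ` N" "C = f ` (r\<^sup>* `` {n})"
      by (auto simp: inner_comps_def)
    then show "C \<in> inner_comps (map_prod f f ` r) (f ` N)"
      unfolding inner_comps_def using rtrancl_Image_inj[OF assms, of r] by blast
  qed
  moreover have "inj_on ((`) f) (inner_comps r N)"
    using assms by (meson inj_image_eq_iff inj_onI)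
  ultimately show ?thesis by (simp add: card_image)
qed

lemma inner_comps_disjoint:
  assumes d: "Field A \<inter> Field F = {}" "Field A \<inter> M = {}" "Field F \<inter> N = {}" "N \<inter> M = {}"
    and fin: "finite N" "finite M"
  shows "card (inner_comps (A \<union> F) (N \<union> M)) = card (inner_comps A N) + card (inner_comps F M)"
proof -
  have A: "(A \<union> F)\<^sup>* `` {n} = A\<^sup>* `` {n}" if "n \<in> N" for n
  proof -
    have "F\<^sup>* `` {n} = {n}" using that d by (intro rtrancl_Image_not_Field) auto
    then show ?thesis unfolding rtrancl_Un_disjoint[OF d(1)] Un_Image by auto
  qed
  have F: "(A \<union> F)\<^sup>* `` {n} = F\<^sup>* `` {n}" if "n \<in> M" for n
  proof -
    have "A\<^sup>* `` {n} = {n}" using that d by (intro rtrancl_Image_not_Field) auto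
    then show ?thesis unfolding rtrancl_Un_disjoint[OF d(1)] Un_Image by auto
  qed
  have A': "A\<^sup>* `` {n} \<inter> M = {}" if "n \<in> N" for n
    using rtrancl_Image_Field[of A n] that d by blast
  have F': "F\<^sup>* `` {n} \<inter> N = {}" if "n \<in> M" for n
    using rtrancl_Image_Field[of F n] that d by blast
  have "inner_comps (A \<union> F) (N \<union> M) = inner_comps A N \<union> inner_comps F M"
  proof (intro equalityI subsetI)
    fix C assume "C \<in> inner_comps (A \<union> F) (N \<union> M)"
    then obtain n where n: "C \<subseteq> N \<union> M" "n \<in> N \<union> M" "C = (A \<union> F)\<^sup>* `` {n}"
      by (auto simp: inner_comps_def)
    show "C \<in> inner_comps A N \<union> inner_comps F M"
    proof (cases "n \<in> N")
      case True
      then have "C = A\<^sup>* `` {n}" "C \<subseteq> N" using n A[of n] A'[of n] by auto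
      then show ?thesis using True by (auto simp: inner_comps_def)
    next
      case False
      then have "n \<in> M" using n by auto
      then have "C = F\<^sup>* `` {n}" "C \<subseteq> M" using n F[of n] F'[of n] by auto
      then show ?thesis using \<open>n \<in> M\<close> by (auto simp: inner_comps_def)
    qed
  next
    fix C assume "C \<in> inner_comps A N \<union> inner_comps F M"
    then show "C \<in> inner_comps (A \<union> F) (N \<union> M)"
    proof
      assume "C \<in> inner_comps A N"
      then obtain n where "n \<in> N" "C \<subseteq> N" "C = A\<^sup>* `` {n}" by (auto simp: inner_comps_def)
      then show ?thesis using A[of n] unfolding inner_comps_def by blast
    next
      assume "C \<in> inner_comps F M"
      then obtain n where "n \<in> M" "C \<subseteq> M" "C = F\<^sup>* `` {n}" by (auto simp: inner_comps_def)
      then show ?thesis using F[of n] unfolding inner_comps_def by blast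
    qed
  qed
  moreover have "inner_comps A N \<inter> inner_comps F M = {}"
    unfolding inner_comps_def using d(4) by auto
  ultimately show ?thesis using fin by (simp add: card_Un_disjoint finite_inner_comps)
qed

text \<open>A component inside \<open>X\<close> meets no \<open>F\<close>-step, so it is a component
  of \<open>A\<close> alone: a circle already closed by the first composition. Every other component
  meets \<open>N\<close>, and deleting its points of \<open>X\<close> gives a component of the
  contracted relation.\<close>

lemma inner_comps_contract:
  assumes F: "Field F \<inter> X = {}" and d: "X \<inter> N = {}" and fin: "finite X" "finite N"
    and sym: "sym A" "sym F"
  shows "card (inner_comps (A \<union> F) (X \<union> N)) =
    card (inner_comps A X) + card (inner_comps (contract X A \<union> F) N)"
proof -
  let ?R = "(A \<union> F)\<^sup>*" and ?Q = "(contract X A \<union> F)\<^sup>*"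
  \<comment> \<open>Symmetry makes reachability an equivalence, so a component is determined by any
    of its points; injectivity of deleting \<open>X\<close> rests on this.\<close>
  have symR: "sym ?R" using sym by (simp add: sym_Un sym_rtrancl)
  have eqR: "?R `` {a} = ?R `` {b}" if "(a, b) \<in> ?R" for a b
    using rtrancl_trans[OF that] rtrancl_trans[OF symD[OF symR that]] by blast
  have AR: "A\<^sup>* \<subseteq> ?R" by (simp add: rtrancl_mono)
  have FQ: "Field (contract X A \<union> F) \<inter> X = {}"
    using F by (auto simp: contract_def Field_def)
  have Q: "?Q `` {n} = ?R `` {n} - X" if "n \<notin> X" for n
    using that rtrancl_contract[OF F that] rtrancl_Image_Field[of "contract X A \<union> F" n] FQ
    by blast
  have A: "A\<^sup>* `` {n} = ?R `` {n}" if "n \<in> X" "A\<^sup>* `` {n} \<subseteq> X" for n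
  proof -
    have "(n, y) \<in> A\<^sup>*" if "(n, y) \<in> ?R" for y
      using that
    proof (induction rule: rtrancl_induct)
      case (step y z)
      then have "y \<in> X" using \<open>A\<^sup>* `` {n} \<subseteq> X\<close> by auto
      then have "(y, z) \<in> A" using step(2) F by (auto simp: Field_def)
      then show ?case using step(3) by (meson rtrancl.rtrancl_into_rtrancl)
    qed simp
    then show ?thesis using AR by blast
  qed
  let ?I1 = "{C \<in> inner_comps (A \<union> F) (X \<union> N). C \<subseteq> X}"
  let ?I2 = "{C \<in> inner_comps (A \<union> F) (X \<union> N). \<not> C \<subseteq> X}"
  have 1: "?I1 = inner_comps A X"
  proof (intro equalityI subsetI)
    fix C assume "C \<in> ?I1"
    then obtain n where n: "C \<subseteq> X" "C = ?R `` {n}" by (auto simp: inner_comps_def)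
    then have "n \<in> X" by auto
    moreover have "A\<^sup>* `` {n} \<subseteq> X" using n AR by blast
    ultimately show "C \<in> inner_comps A X" using n A[of n] by (auto simp: inner_comps_def)
  next
    fix C assume "C \<in> inner_comps A X"
    then obtain n where n: "C \<subseteq> X" "C = A\<^sup>* `` {n}" "n \<in> X" by (auto simp: inner_comps_def)
    then show "C \<in> ?I1" using A[of n] by (auto simp: inner_comps_def)
  qed
  have 2: "bij_betw (\<lambda>C. C - X) ?I2 (inner_comps (contract X A \<union> F) N)"
  proof (rule bij_betw_imageI)
    have *: "C = ?R `` {n}" if "C \<in> ?I2" "n \<in> C" for C n
      using that eqR by (auto simp: inner_comps_def)
    show "inj_on (\<lambda>C. C - X) ?I2"
    proof (intro inj_onI)
      fix C C' assume C: "C \<in> ?I2" "C' \<in> ?I2" "C - X = C' - X"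
      then obtain n where "n \<in> C" "n \<in> C'" by blast
      then show "C = C'" using *[OF C(1)] *[OF C(2)] by metis
    qed
    show "(\<lambda>C. C - X) ` ?I2 = inner_comps (contract X A \<union> F) N"
    proof (intro equalityI subsetI)
      fix C' assume "C' \<in> (\<lambda>C. C - X) ` ?I2"
      then obtain C where C: "C \<in> ?I2" "C' = C - X" by auto
      then obtain n where n: "n \<in> C" "n \<notin> X" by auto
      then have "C' = ?Q `` {n}" using *[OF C(1) n(1)] Q[OF n(2)] C by simp
      moreover have "C' \<subseteq> N" "n \<in> N" using C n by (auto simp: inner_comps_def)
      ultimately show "C' \<in> inner_comps (contract X A \<union> F) N" by (auto simp: inner_comps_def)
    next
      fix C' assume "C' \<in> inner_comps (contract X A \<union> F) N"
      then obtain n where n: "n \<in> N" "C' \<subseteq> N" "C' = ?Q `` {n}" by (auto simp: inner_comps_def)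
      then have nX: "n \<notin> X" using d by auto
      then have C': "C' = ?R `` {n} - X" using n Q by simp
      then have "?R `` {n} \<in> ?I2" using n nX by (auto simp: inner_comps_def)
      then show "C' \<in> (\<lambda>C. C - X) ` ?I2" using C' by blast
    qed
  qed
  have "inner_comps (A \<union> F) (X \<union> N) = ?I1 \<union> ?I2" "?I1 \<inter> ?I2 = {}" by auto
  moreover have "finite ?I1" "finite ?I2"
    using fin by (simp_all add: finite_inner_comps)
  then have "card (?I1 \<union> ?I2) = card ?I1 + card ?I2"
    by (rule card_Un_disjoint) auto
  ultimately have "card (inner_comps (A \<union> F) (X \<union> N)) = card ?I1 + card ?I2"
    by argo
  then show ?thesis using 1 bij_betw_same_card[OF 2] by simp
qed

section \<open>Associativity of vertical composition\<close>

lemma doubleton_in_image: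
  assumes "inj f"
  shows "{p, q} \<in> (`) f ` A \<longleftrightarrow> (\<exists>p' q'. p = f p' \<and> q = f q' \<and> {p', q'} \<in> A)"
proof
  assume "{p, q} \<in> (`) f ` A"
  then obtain a where a: "a \<in> A" "{p, q} = f ` a" by auto
  then obtain p' q' where p': "p' \<in> a" "q' \<in> a" "p = f p'" "q = f q'"
    by (metis imageE insertI1 insertI2)
  have "f ` a = f ` {p', q'}" using a p' by simp
  then have "a = {p', q'}" using assms inj_image_eq_iff by metis
  then show "\<exists>p' q'. p = f p' \<and> q = f q' \<and> {p', q'} \<in> A" using a p' by blast
next
  assume "\<exists>p' q'. p = f p' \<and> q = f q' \<and> {p', q'} \<in> A"
  then obtain p' q' where "p = f p'" "q = f q'" "{p', q'} \<in> A" by blast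
  then show "{p, q} \<in> (`) f ` A" by (intro image_eqI[of _ _ "{p', q'}"]) simp_all
qed

text \<open>Weaker than membership in \<open>diagrams\<close>: neither a matching nor planarity is
  demanded. Associativity, interchange and reflection depend only on end points staying within
  range.\<close>

definition wf_diag :: "'c diagram \<Rightarrow> bool" where
  "wf_diag D \<longleftrightarrow> src D \<noteq> [] \<and> tgt D \<noteq> [] \<and> \<Union> (arcs D) \<subseteq> points (src D) (tgt D)"

definition glue :: "'c diagram \<Rightarrow> 'c diagram \<Rightarrow> (node \<times> node) set" where
  "glue D E = {(upper p, upper q) | p q. {p, q} \<in> arcs D} \<union>
     {(lower p, lower q) | p q. {p, q} \<in> arcs E}"

lemma linked_glue: "linked D E = (glue D E)\<^sup>*"
  by (simp add: linked_def glue_def)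

lemma sym_glue: "sym (glue D E)"
proof (rule symI)
  fix a b assume "(a, b) \<in> glue D E"
  then show "(b, a) \<in> glue D E"
    unfolding glue_def by (elim UnE) (force simp: insert_commute)+
qed

lemma sym_linked: "sym (linked D E)"
  by (simp add: linked_glue sym_glue sym_rtrancl)

lemma src_vcomp [simp]: "src (vcomp_diag D E) = src E"
  and tgt_vcomp [simp]: "tgt (vcomp_diag D E) = tgt D"
  by (simp_all add: vcomp_diag_def)

lemma arcs_vcomp: "{p, q} \<in> arcs (vcomp_diag D E) \<longleftrightarrow> p \<noteq> q \<and> (outer p, outer q) \<in> linked D E"
  unfolding vcomp_diag_def using symD[OF sym_linked] by (auto simp: doubleton_eq_iff)

lemma wf_diag_arc:
  assumes "wf_diag D" "{p, q} \<in> arcs D"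
  shows "p \<in> points (src D) (tgt D)" "q \<in> points (src D) (tgt D)"
  using assms by (auto simp: wf_diag_def)

fun level :: "nat \<Rightarrow> nat \<Rightarrow> point \<Rightarrow> nat \<times> nat" where
  "level a b (Bot i) = (a, i)"
| "level a b (Top i) = (b, i)"

fun node_level :: "nat \<Rightarrow> nat \<Rightarrow> nat \<Rightarrow> node \<Rightarrow> nat \<times> nat" where
  "node_level a b c (BotN i) = (a, i)"
| "node_level a b c (MidN i) = (b, i)"
| "node_level a b c (TopN i) = (c, i)"

text \<open>The points of several stacked diagrams are numbered by pairs consisting of a level and the
  index of the point within that level.\<close>

definition adj :: "nat \<Rightarrow> nat \<Rightarrow> 'c diagram \<Rightarrow> ((nat \<times> nat) \<times> (nat \<times> nat)) set" where
  "adj a b D = {(level a b p, level a b q) | p q. {p, q} \<in> arcs D}"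

lemma sym_adj: "sym (adj a b D)"
  by (rule symI) (auto simp: adj_def, metis insert_commute)

lemma node_level_simps [simp]:
  "node_level a b c (upper p) = level b c p"
  "node_level a b c (lower p) = level a b p"
  "node_level a b c (outer p) = level a c p"
  by (cases p; simp)+

lemma inj_node_level: "distinct [a, b, c] \<Longrightarrow> inj (node_level a b c)"
  by (rule injI) (case_tac x; case_tac y; auto)

lemma node_level_glue:
  "map_prod (node_level a b c) (node_level a b c) ` glue D E = adj b c D \<union> adj a b E"
  unfolding glue_def adj_def image_Un
  by (intro arg_cong2[where f = "(\<union>)"]; force)

lemma linked_level:
  assumes "distinct [a, b, c]"
  shows "(outer p, outer q) \<in> linked D E \<longleftrightarrow>
    (level a c p, level a c q) \<in> (adj b c D \<union> adj a b E)\<^sup>*"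
  using rtrancl_inj_image[OF inj_node_level[OF assms], of "outer p" "outer q" "glue D E"]
  by (simp add: node_level_glue linked_glue)

lemma Field_adj:
  assumes "wf_diag D"
  shows "Field (adj a b D) \<subseteq> {a} \<times> {..<length (src D) - 1} \<union> {b} \<times> {..<length (tgt D) - 1}"
proof -
  have "level a b p \<in> {a} \<times> {..<length (src D) - 1} \<union> {b} \<times> {..<length (tgt D) - 1}"
    if "p \<in> points (src D) (tgt D)" for p
    using that by (cases p) (auto simp: points_def)
  then show ?thesis
    using wf_diag_arc[OF assms] unfolding adj_def Field_def by blast
qed

lemma Field_glue:
  assumes "wf_diag D" "wf_diag E" "src D = tgt E"
  shows "Field (glue D E) \<subseteq> BotN ` {..<length (src E) - 1} \<union> MidN ` {..<length (tgt E) - 1} \<union>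
    TopN ` {..<length (tgt D) - 1}"
proof -
  have "upper p \<in> MidN ` {..<length (tgt E) - 1} \<union> TopN ` {..<length (tgt D) - 1}"
    if "p \<in> points (src D) (tgt D)" for p
    using that assms(3) by (cases p) (auto simp: points_def)
  moreover have "lower p \<in> BotN ` {..<length (src E) - 1} \<union> MidN ` {..<length (tgt E) - 1}"
    if "p \<in> points (src E) (tgt E)" for p
    using that by (cases p) (auto simp: points_def)
  ultimately show ?thesis
    using wf_diag_arc[OF assms(1)] wf_diag_arc[OF assms(2)]
    unfolding glue_def Field_def by blast
qed

text \<open>\<open>circles\<close> allows all of \<open>range MidN\<close>; well-formedness confines
  each such component to the points that exist on the middle line, a finite set on which components
  can be counted.\<close>

lemma circles_glue:
  assumes "wf_diag D" "wf_diag E" "src D = tgt E"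
  shows "circles D E = card (inner_comps (glue D E) (MidN ` {..<length (tgt E) - 1}))"
proof -
  have "C \<subseteq> MidN ` {..<length (tgt E) - 1}"
    if "C \<subseteq> range MidN" "j < length (tgt E) - 1" "C = linked D E `` {MidN j}" for C j
  proof -
    have C: "C \<subseteq> insert (MidN j) (Field (glue D E))"
      using that rtrancl_Image_Field[of "glue D E" "MidN j"] by (simp add: linked_glue)
    show ?thesis
    proof
      fix x assume "x \<in> C"
      then have "x \<in> range MidN" "x = MidN j \<or> x \<in> Field (glue D E)" using that(1) C by auto
      then show "x \<in> MidN ` {..<length (tgt E) - 1}" using that(2) Field_glue[OF assms] by auto
    qed
  qed
  then have "{C. C \<subseteq> range MidN \<and> (\<exists>j<length (tgt E) - 1. C = linked D E `` {MidN j})} =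
      inner_comps (glue D E) (MidN ` {..<length (tgt E) - 1})"
    unfolding inner_comps_def linked_glue by (safe; blast)
  then show ?thesis by (simp add: circles_def)
qed

lemma circles_level:
  assumes "distinct [a, b, c]" "wf_diag D" "wf_diag E" "src D = tgt E"
  shows "circles D E = card (inner_comps (adj b c D \<union> adj a b E) ({b} \<times> {..<length (tgt E) - 1}))"
proof -
  have "node_level a b c ` MidN ` {..<n} = {b} \<times> {..<n}" for n
    by force
  then show ?thesis
    using inner_comps_inj_image[OF inj_node_level[OF assms(1)], of "glue D E" "MidN ` {..<length (tgt E) - 1}"]
    by (simp add: circles_glue[OF assms(2-)] node_level_glue)
qed

lemma rtrancl_Un_diff_Id: "((r - Id) \<union> F)\<^sup>* = (r \<union> F)\<^sup>*"
proof -
  have "((r - Id) \<union> F) - Id = (r \<union> F) - Id" by auto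
  then show ?thesis by (metis rtrancl_r_diff_Id)
qed

text \<open>With the lower diagram between levels \<open>a\<close> and \<open>b\<close> and the
  upper one between \<open>b\<close> and \<open>c\<close>, composing contracts level
  \<open>b\<close>. Every point outside \<open>?X\<close> that lies on an arc sits on level
  \<open>a\<close> or \<open>c\<close>, hence comes from a boundary point of the composite.\<close>

lemma adj_vcomp:
  assumes "distinct [a, b, c]" "wf_diag D" "wf_diag E" "src D = tgt E"
  shows "adj a c (vcomp_diag D E) =
    contract ({b} \<times> {..<length (tgt E) - 1}) (adj b c D \<union> adj a b E) - Id" (is "_ = contract ?X ?A - Id")
proof -
  have inj: "level a c p = level a c q \<Longrightarrow> p = q" for p q
    using assms(1) by (cases p; cases q) auto
  have ge: "level a c p \<notin> ?X" for p using assms(1) by (cases p) auto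
  have "\<exists>p' q'. p = level a c p' \<and> q = level a c q' \<and> p' \<noteq> q'"
    if pq: "p \<notin> ?X" "q \<notin> ?X" "(p, q) \<in> ?A\<^sup>*" "p \<noteq> q" for p q
  proof -
    have F: "Field ?A \<subseteq> ?X \<union> {a} \<times> UNIV \<union> {c} \<times> UNIV"
      using Field_adj[OF assms(2), of b c] Field_adj[OF assms(3), of a b] assms(4)
      by (auto simp: Field_Un)
    have "p \<in> Field ?A" "q \<in> Field ?A" using pq rtrancl_not_Field by metis+
    then have "p \<in> {a} \<times> UNIV \<union> {c} \<times> UNIV" "q \<in> {a} \<times> UNIV \<union> {c} \<times> UNIV"
      using pq F by blast+
    moreover have "\<exists>p'. p = level a c p'" if "p \<in> {a} \<times> UNIV \<union> {c} \<times> UNIV" for p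
      using that by (metis SigmaE UnE level.simps singletonD)
    ultimately obtain p' q' where "p = level a c p'" "q = level a c q'" by metis
    then show ?thesis using pq(4) by auto
  qed
  note * = this
  show ?thesis
  proof (intro set_eqI, clarify)
    fix s1 s2 t1 t2 :: nat
    let ?s = "(s1, s2)" and ?t = "(t1, t2)"
    have "(?s, ?t) \<in> adj a c (vcomp_diag D E) \<longleftrightarrow>
      (\<exists>p q. ?s = level a c p \<and> ?t = level a c q \<and> p \<noteq> q \<and> (level a c p, level a c q) \<in> ?A\<^sup>*)"
      unfolding adj_def[of a c] arcs_vcomp linked_level[OF assms(1)] by blast
    also have "\<dots> \<longleftrightarrow> ?s \<notin> ?X \<and> ?t \<notin> ?X \<and> (?s, ?t) \<in> ?A\<^sup>* \<and> ?s \<noteq> ?t"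
      using *[of ?s ?t] inj ge by metis
    also have "\<dots> \<longleftrightarrow> (?s, ?t) \<in> contract ?X ?A - Id" by (simp add: contract_def)
    finally show "(?s, ?t) \<in> adj a c (vcomp_diag D E) \<longleftrightarrow> (?s, ?t) \<in> contract ?X ?A - Id" .
  qed
qed

lemma wf_vcomp:
  assumes "wf_diag D" "wf_diag E" "src D = tgt E"
  shows "wf_diag (vcomp_diag D E)"
proof -
  have F: "outer p \<in> Field (glue D E) \<Longrightarrow> p \<in> points (src E) (tgt D)" for p
    using Field_glue[OF assms] by (cases p) (auto simp: points_def)
  have "p \<in> points (src E) (tgt D)" "q \<in> points (src E) (tgt D)"
    if "p \<noteq> q" "(outer p, outer q) \<in> linked D E" for p q
  proof -
    have "outer p \<noteq> outer q" using that by (cases p; cases q) auto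
    then have "outer p \<in> Field (glue D E)" "outer q \<in> Field (glue D E)"
      using that rtrancl_not_Field unfolding linked_glue by metis+
    then show "p \<in> points (src E) (tgt D)" "q \<in> points (src E) (tgt D)" using F by auto
  qed
  then show ?thesis using assms by (auto simp: wf_diag_def vcomp_diag_def)
qed

text \<open>\<open>F\<close> stands for the remaining diagram of a stack of three. Contracting the
  line between \<open>D\<close> and \<open>E\<close> keeps the connectivity of all points off level
  \<open>b\<close> and removes exactly \<open>circles D E\<close> inner components.\<close>

lemma three_layers:
  assumes abc: "distinct [a, b, c]" "wf_diag D" "wf_diag E" "src D = tgt E"
    and F: "Field F \<inter> {b} \<times> UNIV = {}" "sym F"
  shows "p \<notin> {b} \<times> UNIV \<Longrightarrow> q \<notin> {b} \<times> UNIV \<Longrightarrow>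
      (p, q) \<in> (adj a c (vcomp_diag D E) \<union> F)\<^sup>* \<longleftrightarrow> (p, q) \<in> (adj b c D \<union> adj a b E \<union> F)\<^sup>*"
    and "finite N \<Longrightarrow> N \<inter> {b} \<times> UNIV = {} \<Longrightarrow>
      card (inner_comps (adj b c D \<union> adj a b E \<union> F) ({b} \<times> {..<length (tgt E) - 1} \<union> N)) =
      circles D E + card (inner_comps (adj a c (vcomp_diag D E) \<union> F) N)"
proof -
  let ?X = "{b} \<times> {..<length (tgt E) - 1}" and ?A = "adj b c D \<union> adj a b E"
  have FX: "Field F \<inter> ?X = {}" using F by auto
  have eq: "(adj a c (vcomp_diag D E) \<union> F)\<^sup>* = (contract ?X ?A \<union> F)\<^sup>*"
    by (simp add: adj_vcomp[OF abc] rtrancl_Un_diff_Id)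
  show "(p, q) \<in> (adj a c (vcomp_diag D E) \<union> F)\<^sup>* \<longleftrightarrow> (p, q) \<in> (?A \<union> F)\<^sup>*"
    if "p \<notin> {b} \<times> UNIV" "q \<notin> {b} \<times> UNIV"
    unfolding eq using that FX by (intro rtrancl_contract) auto
  show "card (inner_comps (?A \<union> F) (?X \<union> N)) =
      circles D E + card (inner_comps (adj a c (vcomp_diag D E) \<union> F) N)"
    if "finite N" "N \<inter> {b} \<times> UNIV = {}"
  proof -
    have "?X \<inter> N = {}" using that by auto
    moreover have "sym ?A" by (simp add: sym_adj sym_Un)
    ultimately show ?thesis
      using inner_comps_contract[OF FX, of N ?A] that F(2)
      by (simp add: circles_level[OF abc] inner_comps_def eq)
  qed
qed

text \<open>Both bracketings are compared with the uncontracted stack, \<open>F\<close> between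
  levels 0 and 1, \<open>E\<close> between 1 and 2, \<open>D\<close> between 2 and 3: one contracts
  level 2 first, the other level 1. The equation of circle numbers makes the powers of
  \<open>- \<delta>\<close> agree.\<close>

lemma vcomp_diag_assoc:
  assumes wf: "wf_diag D" "wf_diag E" "wf_diag F" and eq: "src D = tgt E" "src E = tgt F"
  shows "vcomp_diag (vcomp_diag D E) F = vcomp_diag D (vcomp_diag E F)" (is ?arcs)
    and "circles D E + circles (vcomp_diag D E) F = circles E F + circles D (vcomp_diag E F)" (is ?circ)
proof -
  have d: "distinct [1::nat, 2, 3]" "distinct [0::nat, 1, 2]" "distinct [0::nat, 1, 3]"
    "distinct [0::nat, 2, 3]" by simp_all
  have F0: "Field (adj 0 1 F) \<inter> {2} \<times> UNIV = {}" using Field_adj[OF wf(3), of 0 1] by auto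
  have D0: "Field (adj 2 3 D) \<inter> {1} \<times> UNIV = {}" using Field_adj[OF wf(1), of 2 3] by auto
  have un: "adj 1 2 E \<union> adj 0 1 F \<union> adj 2 3 D = adj 2 3 D \<union> adj 1 2 E \<union> adj 0 1 F" by auto
  note L = three_layers[OF d(1) wf(1,2) eq(1) F0 sym_adj]
  note R = three_layers[OF d(2) wf(2,3) eq(2) D0 sym_adj, unfolded un]
  have lv: "level 0 3 p \<notin> {1} \<times> UNIV" "level 0 3 p \<notin> {2} \<times> UNIV" for p by (cases p; simp)+
  have "(outer p, outer q) \<in> linked (vcomp_diag D E) F \<longleftrightarrow>
      (outer p, outer q) \<in> linked D (vcomp_diag E F)" for p q
    unfolding linked_level[OF d(3), of p q "vcomp_diag D E"] linked_level[OF d(4), of p q D]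
      L(1)[OF lv(2) lv(2)] using R(1)[OF lv(1) lv(1)] by (simp add: Un_commute)
  then show ?arcs
    unfolding vcomp_diag_def[of "vcomp_diag D E" F] vcomp_diag_def[of D "vcomp_diag E F"] by simp
  have "circles D E + circles (vcomp_diag D E) F = card (inner_comps (adj 2 3 D \<union> adj 1 2 E \<union> adj 0 1 F)
    ({2} \<times> {..<length (tgt E) - 1} \<union> {1} \<times> {..<length (tgt F) - 1}))"
    using wf_vcomp[OF wf(1,2) eq(1)] wf eq
    by (subst L(2)) (auto simp: circles_level[OF d(3)])
  moreover have "circles E F + circles D (vcomp_diag E F) = card (inner_comps (adj 2 3 D \<union> adj 1 2 E \<union> adj 0 1 F)
    ({1} \<times> {..<length (tgt F) - 1} \<union> {2} \<times> {..<length (tgt E) - 1}))"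
    using wf_vcomp[OF wf(2,3) eq(2)] wf eq
    by (subst R(2)) (auto simp: circles_level[OF d(4)] Un_commute)
  ultimately show ?circ by (simp add: Un_commute)
qed

section \<open>Horizontal composition and reflection\<close>

lemma src_hcomp [simp]: "src (hcomp_diag D E) = src D @ tl (src E)"
  and tgt_hcomp [simp]: "tgt (hcomp_diag D E) = tgt D @ tl (tgt E)"
  by (simp_all add: hcomp_diag_def)

lemma image_doubletons:
  assumes "a \<in> (`) f ` A" "\<And>a. a \<in> A \<Longrightarrow> \<exists>p q. a = {p, q}"
  shows "\<exists>p q. a = {p, q}"
proof -
  obtain b where b: "b \<in> A" "a = f ` b" using assms(1) by blast
  obtain p q where "b = {p, q}" using assms(2)[OF b(1)] by blast
  then have "a = {f p, f q}" using b by simp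
  then show ?thesis by blast
qed

lemma inj_shift: "inj (shift m n)"
  by (rule injI) (case_tac x; case_tac y; simp)

lemma shift_shift: "shift m n (shift m' n' p) = shift (m + m') (n + n') p"
  by (cases p) auto

lemma shift_0 [simp]: "shift 0 0 p = p"
  by (cases p) auto

lemma shift_image_0 [simp]: "(`) (shift 0 0) ` A = A"
proof -
  have "shift 0 0 = id" by (rule ext) simp
  then show ?thesis by simp
qed

lemma arcs_hcomp: "{p, q} \<in> arcs (hcomp_diag D E) \<longleftrightarrow> {p, q} \<in> arcs D \<or>
    (\<exists>p' q'. p = shift (length (src D) - 1) (length (tgt D) - 1) p' \<and>
       q = shift (length (src D) - 1) (length (tgt D) - 1) q' \<and> {p', q'} \<in> arcs E)"
  unfolding hcomp_diag_def by (simp add: doubleton_in_image[OF inj_shift])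

lemma length_glued: "x \<noteq> [] \<Longrightarrow> y \<noteq> [] \<Longrightarrow> length (x @ tl y) - 1 = (length x - 1) + (length y - 1)"
  by (cases x; cases y) auto

lemma hcomp_diag_assoc:
  assumes "wf_diag D" "wf_diag E"
  shows "hcomp_diag (hcomp_diag D E) F = hcomp_diag D (hcomp_diag E F)"
proof -
  have ne: "src D \<noteq> []" "src E \<noteq> []" "tgt D \<noteq> []" "tgt E \<noteq> []"
    using assms by (auto simp: wf_diag_def)
  then show ?thesis
    unfolding hcomp_diag_def diagram.sel length_glued[OF ne(1,2)] length_glued[OF ne(3,4)]
    by (simp add: image_Un image_image shift_shift Un_assoc)
qed

lemma wf_id_diag: "x \<noteq> [] \<Longrightarrow> wf_diag (id_diag x)"
  by (auto simp: wf_diag_def id_diag_def points_def)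

lemma src_id [simp]: "src (id_diag x) = x"
  and tgt_id [simp]: "tgt (id_diag x) = x"
  by (simp_all add: id_diag_def)

lemma hcomp_id_right:
  assumes "wf_diag D"
  shows "hcomp_diag D (id_diag [c]) = D"
  by (cases D) (simp add: hcomp_diag_def id_diag_def)

lemma hcomp_id_id:
  assumes "x \<noteq> []" "y \<noteq> []"
  shows "hcomp_diag (id_diag x) (id_diag y) = id_diag (x @ tl y)"
proof -
  have e: "length (x @ tl y) - 1 = (length x - 1) + (length y - 1)"
    using length_glued[OF assms] .
  have "{{Bot i, Top i} |i. i < m} \<union> (`) (shift m m) ` {{Bot i, Top i} |i. i < n} =
      {{Bot i, Top i} |i. i < m + n}" for m n
  proof (intro equalityI subsetI)
    fix a assume "a \<in> {{Bot i, Top i} |i. i < m} \<union> (`) (shift m m) ` {{Bot i, Top i} |i. i < n}"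
    then show "a \<in> {{Bot i, Top i} |i. i < m + n}"
    proof
      assume "a \<in> (`) (shift m m) ` {{Bot i, Top i} |i. i < n}"
      then obtain i where "i < n" "a = {Bot (m + i), Top (m + i)}" by auto
      then show ?thesis by (intro CollectI exI[of _ "m + i"]) auto
    qed auto
  next
    fix a assume "a \<in> {{Bot i, Top i} |i. i < m + n}"
    then obtain i where i: "i < m + n" "a = {Bot i, Top i}" by auto
    show "a \<in> {{Bot i, Top i} |i. i < m} \<union> (`) (shift m m) ` {{Bot i, Top i} |i. i < n}"
    proof (cases "i < m")
      case False
      then have "a = shift m m ` {Bot (i - m), Top (i - m)}" "i - m < n" using i by auto
      then show ?thesis by blast
    qed (use i in auto)
  qed
  then show ?thesis unfolding hcomp_diag_def id_diag_def diagram.sel e by simp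
qed

lemma lessThan_add: "{..<m + n} = {..<m} \<union> (+) m ` {..<n}" for m n :: nat
proof -
  have "x \<in> (+) m ` {..<n}" if "x < m + n" "\<not> x < m" for x
    using that by (intro image_eqI[of _ _ "x - m"]) auto
  then show ?thesis by auto
qed

lemma points_shift:
  assumes "x \<noteq> []" "x' \<noteq> []" "y \<noteq> []" "y' \<noteq> []"
  shows "points (x @ tl x') (y @ tl y') =
    points x y \<union> shift (length x - 1) (length y - 1) ` points x' y'"
proof -
  have "shift m k ` (Bot ` A \<union> Top ` F) = Bot ` (+) m ` A \<union> Top ` (+) k ` F" for m k A F
    by (simp add: image_Un image_image)
  then show ?thesis
    unfolding points_def length_glued[OF assms(1,2)] length_glued[OF assms(3,4)] lessThan_add by auto
qed

lemma wf_hcomp: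
  assumes "wf_diag D" "wf_diag E"
  shows "wf_diag (hcomp_diag D E)"
proof -
  have "src D \<noteq> []" "src E \<noteq> []" "tgt D \<noteq> []" "tgt E \<noteq> []"
    using assms by (auto simp: wf_diag_def)
  then have "points (src D @ tl (src E)) (tgt D @ tl (tgt E)) =
    points (src D) (tgt D) \<union> shift (length (src D) - 1) (length (tgt D) - 1) ` points (src E) (tgt E)"
    by (rule points_shift)
  then show ?thesis
    using assms unfolding wf_diag_def src_hcomp tgt_hcomp
    by (simp add: hcomp_diag_def) blast
qed

fun shift_node :: "nat \<Rightarrow> nat \<Rightarrow> nat \<Rightarrow> node \<Rightarrow> node" where
  "shift_node a b c (BotN i) = BotN (a + i)"
| "shift_node a b c (MidN i) = MidN (b + i)"
| "shift_node a b c (TopN i) = TopN (c + i)"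

lemma inj_shift_node: "inj (shift_node a b c)"
  by (rule injI) (case_tac x; case_tac y; simp)

lemma shift_node_simps:
  "upper (shift b c p) = shift_node a b c (upper p)"
  "lower (shift a b p) = shift_node a b c (lower p)"
  "outer (shift a c p) = shift_node a b c (outer p)"
  by (cases p; simp)+

lemma disjoint_mono: "A \<subseteq> A' \<Longrightarrow> F \<subseteq> F' \<Longrightarrow> A' \<inter> F' = {} \<Longrightarrow> A \<inter> F = {}"
  by blast

text \<open>Stated for an arbitrary map \<open>w\<close> into the nodes, so that one proof serves
  both the upper and the lower diagram of a stack.\<close>

lemma arcs_hcomp_image:
  fixes w :: "point \<Rightarrow> node"
  assumes "\<And>p. w (shift (length (src D) - 1) (length (tgt D) - 1) p) = sh (w p)"
  shows "{(w p, w q) | p q. {p, q} \<in> arcs (hcomp_diag D D')} =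
    {(w p, w q) | p q. {p, q} \<in> arcs D} \<union> map_prod sh sh ` {(w p, w q) | p q. {p, q} \<in> arcs D'}"
    (is "?A = ?B \<union> ?C")
proof (intro equalityI subsetI)
  let ?s = "shift (length (src D) - 1) (length (tgt D) - 1)"
  fix z assume "z \<in> ?A"
  then obtain p q where z: "z = (w p, w q)" "{p, q} \<in> arcs (hcomp_diag D D')" by blast
  then consider "{p, q} \<in> arcs D" | p' q' where "p = ?s p'" "q = ?s q'" "{p', q'} \<in> arcs D'"
    unfolding arcs_hcomp by blast
  then show "z \<in> ?B \<union> ?C"
  proof cases
    case 2
    then have "z = map_prod sh sh (w p', w q')" using z(1) by (simp only: assms map_prod_simp)
    then show ?thesis using 2(3) by blast
  qed (use z in blast)
next
  let ?s = "shift (length (src D) - 1) (length (tgt D) - 1)"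
  fix z assume "z \<in> ?B \<union> ?C"
  then show "z \<in> ?A"
  proof
    assume "z \<in> ?C"
    then obtain p q where pq: "z = (sh (w p), sh (w q))" "{p, q} \<in> arcs D'" by auto
    then have "z = (w (?s p), w (?s q))" by (simp only: assms)
    then show ?thesis unfolding arcs_hcomp using pq(2) by blast
  next
    assume "z \<in> ?B"
    then show ?thesis unfolding arcs_hcomp by blast
  qed
qed

lemma glue_hcomp:
  assumes "src D = tgt E"
  shows "glue (hcomp_diag D D') (hcomp_diag E E') = glue D E \<union>
    (let sh = shift_node (length (src E) - 1) (length (tgt E) - 1) (length (tgt D) - 1)
     in map_prod sh sh ` glue D' E')"
proof -
  let ?sh = "shift_node (length (src E) - 1) (length (tgt E) - 1) (length (tgt D) - 1)"
  note U = arcs_hcomp_image[of upper D ?sh D', unfolded assms, OF shift_node_simps(1)]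
    and L = arcs_hcomp_image[of lower E ?sh E', OF shift_node_simps(2)]
  show ?thesis unfolding glue_def U L Let_def image_Un by blast
qed

text \<open>The nodes of the right-hand stack are those of \<open>glue D' E'\<close> shifted past
  all nodes of the left-hand one. The two adjacency relations therefore have disjoint fields, so no
  path changes sides and circles add up.\<close>

lemma interchange_diag:
  assumes wf: "wf_diag D" "wf_diag E" "wf_diag D'" "wf_diag E'"
    and eq: "src D = tgt E" "src D' = tgt E'"
  shows "vcomp_diag (hcomp_diag D D') (hcomp_diag E E') = hcomp_diag (vcomp_diag D E) (vcomp_diag D' E')" (is ?arcs)
    and "circles (hcomp_diag D D') (hcomp_diag E E') = circles D E + circles D' E'" (is ?circ)
proof -
  let ?a = "length (src E) - 1" and ?b = "length (tgt E) - 1" and ?c = "length (tgt D) - 1"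
  let ?sh = "shift_node ?a ?b ?c"
  let ?G = "glue D E" and ?G' = "map_prod ?sh ?sh ` glue D' E'"
  have G: "glue (hcomp_diag D D') (hcomp_diag E E') = ?G \<union> ?G'"
    using glue_hcomp[OF eq(1)] by (simp add: Let_def)
  have "Field ?G' = ?sh ` Field (glue D' E')"
    by (auto simp: Field_def)
  then have F': "Field ?G' \<subseteq> range ?sh" by auto
  have R: "range ?sh \<inter> (BotN ` {..<?a} \<union> MidN ` {..<?b} \<union> TopN ` {..<?c}) = {}"
  proof -
    have "?sh n \<notin> BotN ` {..<?a} \<union> MidN ` {..<?b} \<union> TopN ` {..<?c}" for n by (cases n) auto
    then show ?thesis by blast
  qed
  have F: "Field ?G \<subseteq> BotN ` {..<?a} \<union> MidN ` {..<?b} \<union> TopN ` {..<?c}"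
    using Field_glue[OF wf(1,2) eq(1)] .
  have d: "Field ?G \<inter> Field ?G' = {}" using F F' R by blast
  have ne: "src D \<noteq> []" "src D' \<noteq> []" "tgt D \<noteq> []" "tgt D' \<noteq> []" "src E \<noteq> []" "src E' \<noteq> []" "tgt E \<noteq> []" "tgt E' \<noteq> []"
    using wf by (auto simp: wf_diag_def)
  have lin: "(outer p, outer q) \<in> linked (hcomp_diag D D') (hcomp_diag E E') \<longleftrightarrow>
      (outer p, outer q) \<in> linked D E \<or> (outer p, outer q) \<in> ?G'\<^sup>*" for p q
    unfolding linked_glue G rtrancl_Un_disjoint[OF d] by simp
  have lin': "p \<noteq> q \<and> (outer p, outer q) \<in> ?G'\<^sup>* \<longleftrightarrow>
      (\<exists>p' q'. p = shift ?a ?c p' \<and> q = shift ?a ?c q' \<and> {p', q'} \<in> arcs (vcomp_diag D' E'))" for p q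
  proof
    assume pq: "p \<noteq> q \<and> (outer p, outer q) \<in> ?G'\<^sup>*"
    then have "outer p \<noteq> outer q" by (cases p; cases q) auto
    then have "outer p \<in> range ?sh" "outer q \<in> range ?sh"
      using pq F' rtrancl_not_Field[of "outer p" "outer q" ?G'] by blast+
    moreover have "\<exists>p'. p = shift ?a ?c p'" if p: "outer p \<in> range ?sh" for p
    proof -
      obtain n where "outer p = ?sh n" using p by blast
      then show ?thesis
        by (cases p; cases n) (auto intro: exI[of _ "Bot _"] exI[of _ "Top _"])
    qed
    ultimately obtain p' q' where p': "p = shift ?a ?c p'" "q = shift ?a ?c q'" by blast
    then have "(outer p', outer q') \<in> linked D' E'" "p' \<noteq> q'"
      using pq rtrancl_inj_image[OF inj_shift_node, of ?a ?b ?c "outer p'" "outer q'" "glue D' E'"]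
      by (auto simp: shift_node_simps(3)[of _ _ _ ?b] linked_glue)
    then show "\<exists>p' q'. p = shift ?a ?c p' \<and> q = shift ?a ?c q' \<and> {p', q'} \<in> arcs (vcomp_diag D' E')"
      using p' by (auto simp: arcs_vcomp)
  next
    assume "\<exists>p' q'. p = shift ?a ?c p' \<and> q = shift ?a ?c q' \<and> {p', q'} \<in> arcs (vcomp_diag D' E')"
    then obtain p' q' where "p = shift ?a ?c p'" "q = shift ?a ?c q'" "p' \<noteq> q'"
      "(outer p', outer q') \<in> linked D' E'" by (auto simp: arcs_vcomp)
    then show "p \<noteq> q \<and> (outer p, outer q) \<in> ?G'\<^sup>*"
      using rtrancl_inj_image[OF inj_shift_node, of ?a ?b ?c "outer p'" "outer q'" "glue D' E'"] injD[OF inj_shift]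
      by (auto simp: shift_node_simps(3)[of _ _ _ ?b] linked_glue)
  qed
  have arcs: "{p, q} \<in> arcs (vcomp_diag (hcomp_diag D D') (hcomp_diag E E')) \<longleftrightarrow>
      {p, q} \<in> arcs (hcomp_diag (vcomp_diag D E) (vcomp_diag D' E'))" for p q
    unfolding arcs_vcomp[of p q "hcomp_diag D D'"] arcs_hcomp[of p q "vcomp_diag D E"] lin
    using lin'[of p q] by (simp add: arcs_vcomp) blast
  have dbl: "\<exists>p q. s = {p, q}" if "s \<in> arcs (vcomp_diag F F')" for s :: "point set" and F F' :: "'a diagram"
    using that by (auto simp: vcomp_diag_def)
  have "arcs (vcomp_diag (hcomp_diag D D') (hcomp_diag E E')) =
      arcs (hcomp_diag (vcomp_diag D E) (vcomp_diag D' E'))"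
  proof (rule set_eqI)
    fix s
    have "\<exists>p q. s = {p, q}" if "s \<in> arcs (hcomp_diag (vcomp_diag D E) (vcomp_diag D' E'))"
    proof -
      have "s \<in> arcs (vcomp_diag D E) \<or> s \<in> (`) (shift ?a ?c) ` arcs (vcomp_diag D' E')"
        using that by (simp add: hcomp_diag_def)
      then show ?thesis by (elim disjE dbl image_doubletons)
    qed
    then show "s \<in> arcs (vcomp_diag (hcomp_diag D D') (hcomp_diag E E')) \<longleftrightarrow>
      s \<in> arcs (hcomp_diag (vcomp_diag D E) (vcomp_diag D' E'))"
      using arcs dbl by metis
  qed
  then show ?arcs by (intro diagram.expand) simp
  let ?N = "MidN ` {..<?b}" and ?M = "?sh ` MidN ` {..<length (tgt E') - 1}"
  have NM: "MidN ` {..<length (tgt (hcomp_diag E E')) - 1} = ?N \<union> ?M"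
  proof -
    show ?thesis unfolding tgt_hcomp length_glued[OF ne(7,8)] lessThan_add by (simp add: image_Un image_image)
  qed
  let ?L = "BotN ` {..<?a} \<union> MidN ` {..<?b} \<union> TopN ` {..<?c}"
  have M: "?M \<subseteq> range ?sh" and N: "?N \<subseteq> ?L" by auto
  have "Field ?G \<inter> ?M = {}" using disjoint_mono[OF F M] R by (simp add: Int_commute)
  moreover have "Field ?G' \<inter> ?N = {}" using disjoint_mono[OF F' N] R by simp
  moreover have "?N \<inter> ?M = {}" using disjoint_mono[OF N M] R by (simp add: Int_commute)
  ultimately have 1: "card (inner_comps (?G \<union> ?G') (?N \<union> ?M)) = card (inner_comps ?G ?N) + card (inner_comps ?G' ?M)"
    by (intro inner_comps_disjoint[OF d]) auto
  have "src (hcomp_diag D D') = tgt (hcomp_diag E E')" using eq by simp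
  then have 2: "circles (hcomp_diag D D') (hcomp_diag E E') = card (inner_comps (?G \<union> ?G') (?N \<union> ?M))"
    using circles_glue[of "hcomp_diag D D'" "hcomp_diag E E'", unfolded NM G] wf_hcomp wf by blast
  have 3: "circles D E = card (inner_comps ?G ?N)" "circles D' E' = card (inner_comps ?G' ?M)"
    using circles_glue[OF wf(1,2) eq(1)] circles_glue[OF wf(3,4) eq(2)]
    by (simp_all only: inner_comps_inj_image[OF inj_shift_node])
  show ?circ unfolding 1 2 3 ..
qed

section \<open>Reflection of diagrams in a horizontal line\<close>

fun flip_point :: "point \<Rightarrow> point" where
  "flip_point (Bot i) = Top i"
| "flip_point (Top i) = Bot i"

text \<open>Reflection exchanges cups and caps, reverses vertical composition and preserves
  horizontal order and circle numbers, so many statements about caps are read off from those about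
  cups.\<close>

definition flip_diag :: "'c diagram \<Rightarrow> 'c diagram" where
  "flip_diag D = Diagram (tgt D) (src D) ((`) flip_point ` arcs D)"

lemma flip_point_flip_point [simp]: "flip_point (flip_point p) = p"
  by (cases p) auto

lemma inj_flip_point: "inj flip_point"
  by (metis flip_point_flip_point injI)

lemma src_flip [simp]: "src (flip_diag D) = tgt D"
  and tgt_flip [simp]: "tgt (flip_diag D) = src D"
  by (simp_all add: flip_diag_def)

lemma flip_diag_flip_diag [simp]: "flip_diag (flip_diag D) = D"
  by (cases D) (simp add: flip_diag_def image_image)

lemma inj_flip_diag: "inj flip_diag"
  by (metis flip_diag_flip_diag injI)

lemma arcs_flip: "{p, q} \<in> arcs (flip_diag D) \<longleftrightarrow> {flip_point p, flip_point q} \<in> arcs D"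
  unfolding flip_diag_def diagram.sel doubleton_in_image[OF inj_flip_point]
  by (metis flip_point_flip_point)

lemma flip_points: "flip_point ` points x y = points y x"
  by (auto simp: points_def image_Un image_image)

lemma wf_flip [simp]: "wf_diag (flip_diag D) \<longleftrightarrow> wf_diag D"
proof -
  have *: "wf_diag (flip_diag D)" if "wf_diag D" for D :: "'a diagram"
    using that flip_points[of "src D" "tgt D"] by (auto simp: wf_diag_def flip_diag_def)
  show ?thesis using *[of D] *[of "flip_diag D"] by auto
qed

fun flip_node :: "node \<Rightarrow> node" where
  "flip_node (BotN i) = TopN i"
| "flip_node (MidN i) = MidN i"
| "flip_node (TopN i) = BotN i"

lemma inj_flip_node: "inj flip_node"
  by (rule injI) (case_tac x; case_tac y; simp)

lemma flip_node_simps [simp]: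
  "flip_node (upper p) = lower (flip_point p)"
  "flip_node (lower p) = upper (flip_point p)"
  "flip_node (outer p) = outer (flip_point p)"
  by (cases p; simp)+

lemma glue_flip: "glue (flip_diag E) (flip_diag D) = map_prod flip_node flip_node ` glue D E"
proof -
  have U: "{(upper p, upper q) | p q. {p, q} \<in> arcs (flip_diag E)} =
    map_prod flip_node flip_node ` {(lower p, lower q) | p q. {p, q} \<in> arcs E}" (is "?A = ?C")
  proof (intro equalityI subsetI)
    fix z assume "z \<in> ?A"
    then obtain p q where "z = (upper p, upper q)" "{flip_point p, flip_point q} \<in> arcs E"
      by (auto simp: arcs_flip)
    then show "z \<in> ?C" by (intro image_eqI[of _ _ "(lower (flip_point p), lower (flip_point q))"]) auto
  next
    fix z assume "z \<in> ?C"
    then obtain p q where "z = (upper (flip_point p), upper (flip_point q))" "{p, q} \<in> arcs E" by auto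
    then show "z \<in> ?A" by (intro CollectI exI[of _ "flip_point p"] exI[of _ "flip_point q"]) (auto simp: arcs_flip)
  qed
  have L: "{(lower p, lower q) | p q. {p, q} \<in> arcs (flip_diag D)} =
    map_prod flip_node flip_node ` {(upper p, upper q) | p q. {p, q} \<in> arcs D}" (is "?A = ?C")
  proof (intro equalityI subsetI)
    fix z assume "z \<in> ?A"
    then obtain p q where "z = (lower p, lower q)" "{flip_point p, flip_point q} \<in> arcs D"
      by (auto simp: arcs_flip)
    then show "z \<in> ?C" by (intro image_eqI[of _ _ "(upper (flip_point p), upper (flip_point q))"]) auto
  next
    fix z assume "z \<in> ?C"
    then obtain p q where "z = (lower (flip_point p), lower (flip_point q))" "{p, q} \<in> arcs D" by auto
    then show "z \<in> ?A" by (intro CollectI exI[of _ "flip_point p"] exI[of _ "flip_point q"]) (auto simp: arcs_flip)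
  qed
  show ?thesis unfolding glue_def U L image_Un by (rule Un_commute)
qed

lemma flip_vcomp_diag: "flip_diag (vcomp_diag D E) = vcomp_diag (flip_diag E) (flip_diag D)"
proof -
  have arcs: "{p, q} \<in> arcs (flip_diag (vcomp_diag D E)) \<longleftrightarrow>
      {p, q} \<in> arcs (vcomp_diag (flip_diag E) (flip_diag D))" for p q
    using rtrancl_inj_image[OF inj_flip_node, of "outer (flip_point p)" "outer (flip_point q)" "glue D E"]
      injD[OF inj_flip_point, of p q]
    by (auto simp: arcs_flip arcs_vcomp linked_glue glue_flip)
  have "arcs (flip_diag (vcomp_diag D E)) = arcs (vcomp_diag (flip_diag E) (flip_diag D))"
  proof (rule set_eqI)
    fix s
    have "\<exists>p q. s = {p, q}" if "s \<in> arcs (flip_diag (vcomp_diag D E))"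
      using that by (auto simp: flip_diag_def vcomp_diag_def)
    moreover have "\<exists>p q. s = {p, q}" if "s \<in> arcs (vcomp_diag (flip_diag E) (flip_diag D))"
      using that by (auto simp: vcomp_diag_def)
    ultimately show "s \<in> arcs (flip_diag (vcomp_diag D E)) \<longleftrightarrow>
      s \<in> arcs (vcomp_diag (flip_diag E) (flip_diag D))"
      using arcs by metis
  qed
  then show ?thesis by (intro diagram.expand) simp
qed

lemma circles_flip:
  assumes "wf_diag D" "wf_diag E" "src D = tgt E"
  shows "circles (flip_diag E) (flip_diag D) = circles D E"
proof -
  have "flip_node ` MidN ` A = MidN ` A" for A by (simp add: image_image)
  then show ?thesis
    using inner_comps_inj_image[OF inj_flip_node, of "glue D E" "MidN ` {..<length (tgt E) - 1}"] assms
    by (simp add: circles_glue glue_flip)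
qed

lemma flip_id [simp]: "flip_diag (id_diag x) = id_diag x"
proof -
  have "(`) flip_point ` {{Bot i, Top i} |i. P i} = {{Bot i, Top i} |i. P i}" for P
  proof -
    have "(`) flip_point ` {{Bot i, Top i} |i. P i} = (\<lambda>i. flip_point ` {Bot i, Top i}) ` {i. P i}"
      by blast
    also have "\<dots> = {{Bot i, Top i} |i. P i}" by auto
    finally show ?thesis .
  qed
  then show ?thesis by (simp add: flip_diag_def id_diag_def)
qed

lemma flip_hcomp: "flip_diag (hcomp_diag D E) = hcomp_diag (flip_diag D) (flip_diag E)"
proof -
  have "flip_point (shift m n p) = shift n m (flip_point p)" for m n p by (cases p) auto
  then show ?thesis by (simp add: flip_diag_def hcomp_diag_def image_Un image_image)
qed

lemma flip_cup_diag: "flip_diag (cup_diag b r) = cap_diag b r"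
  by (simp add: flip_diag_def cup_diag_def cap_diag_def)

section \<open>Crossingless matchings\<close>

text \<open>The matching condition in terms of partners of points, convenient because arcs occur as
  \<open>{p, q}\<close>; \<open>matching_iff\<close> identifies it with the partition into pairs in
  the definition of \<open>diagrams\<close>.\<close>

definition matching :: "'a set \<Rightarrow> 'a set set \<Rightarrow> bool" where
  "matching P A \<longleftrightarrow> (\<forall>a\<in>A. \<exists>p q. a = {p, q} \<and> p \<noteq> q \<and> p \<in> P \<and> q \<in> P) \<and>
    (\<forall>p\<in>P. \<exists>q. {p, q} \<in> A) \<and> (\<forall>p q q'. {p, q} \<in> A \<longrightarrow> {p, q'} \<in> A \<longrightarrow> q = q')"

lemma matching_iff: "matching P A \<longleftrightarrow> partition_on P A \<and> (\<forall>a\<in>A. card a = 2)"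
proof
  assume m: "matching P A"
  have "a = b" if ab: "a \<in> A" "b \<in> A" "s \<in> a" "s \<in> b" for a b s
  proof -
    have *: "\<exists>q. a = {s, q}" if "a \<in> A" "s \<in> a" for a
    proof -
      obtain p q where "a = {p, q}" using m \<open>a \<in> A\<close> unfolding matching_def by blast
      then show ?thesis using \<open>s \<in> a\<close> by (auto simp: insert_commute)
    qed
    obtain q q' where "a = {s, q}" "b = {s, q'}"
      using *[OF ab(1,3)] *[OF ab(2,4)] by (elim exE)
    then show ?thesis using m ab unfolding matching_def by metis
  qed
  then have "disjoint A" unfolding disjoint_def by blast
  moreover have c: "card a = 2 \<and> a \<subseteq> P" if a: "a \<in> A" for a
  proof -
    obtain p q where "a = {p, q}" "p \<noteq> q" "p \<in> P" "q \<in> P"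
      using m a unfolding matching_def by meson
    then show ?thesis by auto
  qed
  moreover have "p \<in> \<Union> A" if p: "p \<in> P" for p
  proof -
    obtain q where "{p, q} \<in> A" using m p unfolding matching_def by meson
    then show ?thesis by blast
  qed
  moreover have "{} \<notin> A" using c by fastforce
  ultimately show "partition_on P A \<and> (\<forall>a\<in>A. card a = 2)"
    unfolding partition_on_def by blast
next
  assume "partition_on P A \<and> (\<forall>a\<in>A. card a = 2)"
  then have P: "\<Union> A = P" and d: "disjoint A" and c: "\<And>a. a \<in> A \<Longrightarrow> card a = 2"
    by (auto simp: partition_on_def)
  have 1: "\<exists>p q. a = {p, q} \<and> p \<noteq> q \<and> p \<in> P \<and> q \<in> P" if a: "a \<in> A" for a
  proof -
    obtain p q where "a = {p, q}" "p \<noteq> q" using c[OF a] by (auto simp: card_2_iff)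
    moreover have "p \<in> P" "q \<in> P" using P a \<open>a = {p, q}\<close> by auto
    ultimately show ?thesis by blast
  qed
  have 2: "\<exists>q. {p, q} \<in> A" if p: "p \<in> P" for p
  proof -
    obtain a where a: "a \<in> A" "p \<in> a" using P p by auto
    then obtain p' q' where "a = {p', q'}" using 1 by blast
    then have "a = {p, if p = p' then q' else p'}" using a by auto
    then show ?thesis using a by metis
  qed
  have 3: "q = q'" if q: "{p, q} \<in> A" "{p, q'} \<in> A" for p q q'
  proof -
    have "{p, q} \<inter> {p, q'} \<noteq> {}" by simp
    then have "{p, q} = {p, q'}" using disjointD[OF d q] by (rule contrapos_np)
    then show ?thesis by (auto simp: doubleton_eq_iff)
  qed
  show "matching P A" unfolding matching_def using 1 2 3 by blast
qed

lemma matchingD: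
  assumes "matching P A"
  shows "{p, q} \<in> A \<Longrightarrow> p \<in> P" "{p, q} \<in> A \<Longrightarrow> q \<in> P" "{p, q} \<in> A \<Longrightarrow> p \<noteq> q"
    and "p \<in> P \<Longrightarrow> \<exists>q. {p, q} \<in> A"
    and "{p, q} \<in> A \<Longrightarrow> {p, q'} \<in> A \<Longrightarrow> q = q'"
    and "{q, p} \<in> A \<Longrightarrow> {q', p} \<in> A \<Longrightarrow> q = q'"
    and "a \<in> A \<Longrightarrow> \<exists>p q. a = {p, q}"
proof -
  have 1: "p \<in> P \<and> q \<in> P \<and> p \<noteq> q" if "{p, q} \<in> A" for p q
    using assms that unfolding matching_def by (metis doubleton_eq_iff)
  show "{p, q} \<in> A \<Longrightarrow> p \<in> P" "{p, q} \<in> A \<Longrightarrow> q \<in> P" "{p, q} \<in> A \<Longrightarrow> p \<noteq> q"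
    using 1 by blast+
  show "p \<in> P \<Longrightarrow> \<exists>q. {p, q} \<in> A" "{p, q} \<in> A \<Longrightarrow> {p, q'} \<in> A \<Longrightarrow> q = q'"
    "a \<in> A \<Longrightarrow> \<exists>p q. a = {p, q}"
    using assms unfolding matching_def by blast+
  then show "{q, p} \<in> A \<Longrightarrow> {q', p} \<in> A \<Longrightarrow> q = q'"
    using assms unfolding matching_def by (metis insert_commute)
qed

abbreviation colors_agree :: "'c list \<Rightarrow> 'c list \<Rightarrow> point \<Rightarrow> point \<Rightarrow> bool" where
  "colors_agree x y p q \<equiv>
    (if same_side p q then lcol x y p = rcol x y q \<and> rcol x y p = lcol x y q
     else lcol x y p = lcol x y q \<and> rcol x y p = rcol x y q)"

lemma diagrams_iff: "D \<in> diagrams S x y \<longleftrightarrow> src D = x \<and> tgt D = y \<and> one_mor S x \<and> one_mor S y \<and>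
     matching (points x y) (arcs D) \<and> noncrossing (arcs D) \<and> color_compatible x y (arcs D)"
  unfolding diagrams_def matching_iff by blast

lemma diagramsD:
  assumes "D \<in> diagrams S x y"
  shows "src D = x" "tgt D = y" "one_mor S x" "one_mor S y" "matching (points x y) (arcs D)"
    "noncrossing (arcs D)" "color_compatible x y (arcs D)" "x \<noteq> []" "y \<noteq> []"
  using assms by (simp_all add: diagrams_iff one_mor_def)

lemma diagrams_wf: "D \<in> diagrams S x y \<Longrightarrow> wf_diag D"
  by (auto simp: diagrams_def wf_diag_def one_mor_def partition_on_def)

lemma diagram_eqI:
  assumes "src D = src E" "tgt D = tgt E"
    and "\<And>a. a \<in> arcs D \<Longrightarrow> \<exists>p q. a = {p, q}" "\<And>a. a \<in> arcs E \<Longrightarrow> \<exists>p q. a = {p, q}"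
    and "\<And>p q. {p, q} \<in> arcs D \<longleftrightarrow> {p, q} \<in> arcs E"
  shows "D = E"
proof (rule diagram.expand)
  have "arcs D = arcs E" using assms(3-5) by (metis subsetI subset_antisym)
  then show "src D = src E \<and> tgt D = tgt E \<and> arcs D = arcs E" using assms by simp
qed

lemma vcomp_doubleton: "a \<in> arcs (vcomp_diag D E) \<Longrightarrow> \<exists>p q. a = {p, q}"
  by (auto simp: vcomp_diag_def)

lemma diagrams_doubleton: "D \<in> diagrams S x y \<Longrightarrow> a \<in> arcs D \<Longrightarrow> \<exists>p q. a = {p, q}"
  using matchingD(7) diagramsD(5) by metis

lemma arcs_id: "{p, q} \<in> arcs (id_diag x) \<longleftrightarrow>
    (\<exists>i<length x - 1. p = Bot i \<and> q = Top i \<or> p = Top i \<and> q = Bot i)"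
  by (auto simp: id_diag_def doubleton_eq_iff)

lemma points_simps [simp]: "Bot i \<in> points x y \<longleftrightarrow> i < length x - 1" "Top i \<in> points x y \<longleftrightarrow> i < length y - 1"
  by (auto simp: points_def)

lemma matchingI:
  assumes "\<And>a. a \<in> A \<Longrightarrow> \<exists>p q. a = {p, q}"
    and "\<And>p q. {p, q} \<in> A \<Longrightarrow> p \<noteq> q \<and> p \<in> P"
    and "\<And>p. p \<in> P \<Longrightarrow> \<exists>q. {p, q} \<in> A"
    and "\<And>p q q'. {p, q} \<in> A \<Longrightarrow> {p, q'} \<in> A \<Longrightarrow> q = q'"
  shows "matching P A"
proof -
  have "q \<in> P" if "{p, q} \<in> A" for p q
    using assms(2)[of q p] that by (simp add: insert_commute)
  then show ?thesis unfolding matching_def using assms by metis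
qed

lemma noncrossingD:
  "noncrossing A \<Longrightarrow> {p, p'} \<in> A \<Longrightarrow> {q, q'} \<in> A \<Longrightarrow> pos p < pos q \<Longrightarrow> pos q < pos p' \<Longrightarrow> pos p' < pos q' \<Longrightarrow> False"
  unfolding noncrossing_def by blast

lemma noncrossingI:
  assumes "\<And>p q p' q'. {p, p'} \<in> A \<Longrightarrow> {q, q'} \<in> A \<Longrightarrow> pos p < pos q \<Longrightarrow> pos q < pos p' \<Longrightarrow> pos p' < pos q' \<Longrightarrow> False"
  shows "noncrossing A"
  unfolding noncrossing_def using assms by blast

lemma id_diag_diagrams: "one_mor S x \<Longrightarrow> id_diag x \<in> diagrams S x x"
  unfolding diagrams_iff
proof (intro conjI)
  show "matching (points x x) (arcs (id_diag x))"
  proof (rule matchingI)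
    show "\<exists>p q. a = {p, q}" if "a \<in> arcs (id_diag x)" for a
      using that by (auto simp: id_diag_def)
    show "\<exists>q. {p, q} \<in> arcs (id_diag x)" if "p \<in> points x x" for p
      using that by (cases p) (auto simp: arcs_id)
  qed (auto simp: arcs_id)
  show "noncrossing (arcs (id_diag x))"
    by (rule noncrossingI) (auto simp: arcs_id)
  show "color_compatible x x (arcs (id_diag x))"
    by (auto simp: arcs_id color_compatible_def)
qed auto

text \<open>The common color is the last of \<open>x\<close> and the first of \<open>x'\<close>, so
  indices in the right factor are offset by \<open>length x - 1\<close>, the number of boundary
  points of the left factor.\<close>

lemma nth_glued:
  assumes "x \<noteq> []" "x' \<noteq> []" "last x = hd x'"
  shows "(x @ tl x') ! (length x - 1 + i) = x' ! i"
proof (cases i)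
  case 0
  then show ?thesis using assms by (simp add: nth_append last_conv_nth hd_conv_nth)
next
  case (Suc j)
  have "length x - 1 + i = length x + j" using assms Suc by (cases x) auto
  then show ?thesis unfolding \<open>length x - 1 + i = length x + j\<close>
    using assms Suc by (cases x') (auto simp: nth_append)
qed

lemma one_mor_glued:
  assumes "one_mor S x" "one_mor S x'" "last x = hd x'"
  shows "one_mor S (x @ tl x')"
  using assms by (cases x'; cases "tl x'") (auto simp: one_mor_def distinct_adj_append_iff)

lemma last_glued: "x \<noteq> [] \<Longrightarrow> x' \<noteq> [] \<Longrightarrow> last x = hd x' \<Longrightarrow> last (x @ tl x') = last x'"
  by (cases x'; cases "tl x'") auto

lemma col_glued:
  assumes "x \<noteq> []" "x' \<noteq> []" "last x = hd x'" "y \<noteq> []" "y' \<noteq> []" "last y = hd y'"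
  shows "p \<in> points x y \<Longrightarrow> lcol (x @ tl x') (y @ tl y') p = lcol x y p"
    "p \<in> points x y \<Longrightarrow> rcol (x @ tl x') (y @ tl y') p = rcol x y p"
    "lcol (x @ tl x') (y @ tl y') (shift (length x - 1) (length y - 1) p) = lcol x' y' p"
    "rcol (x @ tl x') (y @ tl y') (shift (length x - 1) (length y - 1) p) = rcol x' y' p"
proof -
  show "p \<in> points x y \<Longrightarrow> lcol (x @ tl x') (y @ tl y') p = lcol x y p"
    "p \<in> points x y \<Longrightarrow> rcol (x @ tl x') (y @ tl y') p = rcol x y p"
    by (cases p; auto simp: nth_append)+
  show "lcol (x @ tl x') (y @ tl y') (shift (length x - 1) (length y - 1) p) = lcol x' y' p"
    using nth_glued[OF assms(1-3)] nth_glued[OF assms(4-6)] by (cases p) simp_all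
  show "rcol (x @ tl x') (y @ tl y') (shift (length x - 1) (length y - 1) p) = rcol x' y' p"
    using nth_glued[OF assms(1-3), of "Suc i" for i] nth_glued[OF assms(4-6), of "Suc i" for i]
    by (cases p) (simp_all del: tl_append2)
qed

lemma same_side_shift [simp]: "same_side (shift m n p) (shift m n q) = same_side p q"
  by (cases p; cases q) auto

lemma pos_shift_less: "pos (shift m n p) < pos (shift m n q) \<longleftrightarrow> pos p < pos q"
  by (cases p; cases q) auto

lemma pos_points: "p \<in> points x y \<Longrightarrow> - int (length y - 1) \<le> pos p \<and> pos p < int (length x - 1)"
  by (cases p) auto

text \<open>The left factor occupies the positions from \<open>- n\<close> to \<open>m - 1\<close>.
  Shifted points of the right factor lie outside this interval, so arcs of different factors cannot
  cross.\<close>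

lemma pos_shift: "pos (shift m n p) < - int n \<or> int m \<le> pos (shift m n p)"
  by (cases p) auto

lemma hcomp_diagrams:
  assumes D: "D \<in> diagrams S x y" and E: "E \<in> diagrams S x' y'" and eq: "last x = hd x'"
  shows "hcomp_diag D E \<in> diagrams S (x @ tl x') (y @ tl y')"
  unfolding diagrams_iff
proof (intro conjI)
  note D' = diagramsD[OF D] and E' = diagramsD[OF E]
  let ?m = "length x - 1" and ?n = "length y - 1"
  \<comment> \<open>A diagram has the same first color on both lines and the same last color on both
    lines, so a match at the bottom forces one at the top.\<close>
  have eq': "last y = hd y'" using D'(7) E'(7) eq by (simp add: color_compatible_def)
  note ne = D'(8) E'(8) eq D'(9) E'(9) eq'
  show "src (hcomp_diag D E) = x @ tl x'" "tgt (hcomp_diag D E) = y @ tl y'"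
    using D' E' by auto
  show "one_mor S (x @ tl x')" "one_mor S (y @ tl y')"
    using one_mor_glued D' E' eq eq' by metis+
  have arcs: "{p, q} \<in> arcs (hcomp_diag D E) \<longleftrightarrow> {p, q} \<in> arcs D \<or>
    (\<exists>p' q'. p = shift ?m ?n p' \<and> q = shift ?m ?n q' \<and> {p', q'} \<in> arcs E)" for p q
    using arcs_hcomp[of p q D E] D'(1,2) by simp
  have pts: "points (x @ tl x') (y @ tl y') = points x y \<union> shift ?m ?n ` points x' y'"
    using points_shift[OF ne(1,2,4,5)] .
  have ns: "shift ?m ?n p \<notin> points x y" for p by (cases p) auto
  note mD = matchingD[OF D'(5)] and mE = matchingD[OF E'(5)]
  show "matching (points (x @ tl x') (y @ tl y')) (arcs (hcomp_diag D E))"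
  proof (rule matchingI)
    show "\<exists>p q. a = {p, q}" if "a \<in> arcs (hcomp_diag D E)" for a
    proof -
      have "a \<in> arcs D \<or> a \<in> (`) (shift ?m ?n) ` arcs E"
        using that D' by (simp add: hcomp_diag_def)
      then show ?thesis by (elim disjE mD(7) image_doubletons[OF _ mE(7)])
    qed
    show "p \<noteq> q \<and> p \<in> points (x @ tl x') (y @ tl y')" if "{p, q} \<in> arcs (hcomp_diag D E)" for p q
      using that mD(1,3) mE(1,3) injD[OF inj_shift] unfolding arcs pts by blast
    show "\<exists>q. {p, q} \<in> arcs (hcomp_diag D E)" if "p \<in> points (x @ tl x') (y @ tl y')" for p
      using that mD(4) mE(4) unfolding arcs pts by blast
    show "q = q'" if "{p, q} \<in> arcs (hcomp_diag D E)" "{p, q'} \<in> arcs (hcomp_diag D E)" for p q q'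
      using that mD(1,5) mE(5) ns injD[OF inj_shift] unfolding arcs by metis
  qed
  show "noncrossing (arcs (hcomp_diag D E))"
  proof (rule noncrossingI)
    fix p q p' q'
    assume a: "{p, p'} \<in> arcs (hcomp_diag D E)" "{q, q'} \<in> arcs (hcomp_diag D E)"
      and l: "pos p < pos q" "pos q < pos p'" "pos p' < pos q'"
    have b: "- int ?n \<le> pos p \<and> pos p < int ?m" if "p \<in> points x y" for p using pos_points[OF that] .
    have c: "pos (shift ?m ?n p) < - int ?n \<or> int ?m \<le> pos (shift ?m ?n p)" for p by (rule pos_shift)
    consider "{p, p'} \<in> arcs D" "{q, q'} \<in> arcs D"
      | s s' where "{p, p'} \<in> arcs D" "q = shift ?m ?n s" "q' = shift ?m ?n s'"
      | s s' where "{q, q'} \<in> arcs D" "p = shift ?m ?n s" "p' = shift ?m ?n s'"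
      | s s' t t' where "{s, s'} \<in> arcs E" "{t, t'} \<in> arcs E"
         "p = shift ?m ?n s" "p' = shift ?m ?n s'" "q = shift ?m ?n t" "q' = shift ?m ?n t'"
      using a unfolding arcs by blast
    then show False
    proof cases
      case 1
      then show ?thesis using noncrossingD[OF D'(6)] l by blast
    next
      case (2 s s')
      then show ?thesis using b[OF mD(1)] b[OF mD(2)] c[of s] l by fastforce
    next
      case (3 s s')
      then show ?thesis using b[OF mD(1)] b[OF mD(2)] c[of s'] l by fastforce
    next
      case 4
      then show ?thesis using noncrossingD[OF E'(6)] l by (simp add: pos_shift_less)
    qed
  qed
  have cD: "hd x = hd y" "last x = last y" using D'(7) by (auto simp: color_compatible_def)
  have cE: "hd x' = hd y'" "last x' = last y'" using E'(7) by (auto simp: color_compatible_def)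
  show "color_compatible (x @ tl x') (y @ tl y') (arcs (hcomp_diag D E))"
    unfolding color_compatible_def
  proof (intro conjI allI impI)
    show "hd (x @ tl x') = hd (y @ tl y')" using cD ne by simp
    show "last (x @ tl x') = last (y @ tl y')"
      using last_glued[OF ne(1-3)] last_glued[OF ne(4-6)] cE by simp
    fix p q assume "{p, q} \<in> arcs (hcomp_diag D E) \<and> p \<noteq> q"
    then consider "{p, q} \<in> arcs D" "p \<noteq> q"
      | p' q' where "p = shift ?m ?n p'" "q = shift ?m ?n q'" "{p', q'} \<in> arcs E" "p' \<noteq> q'"
      unfolding arcs by blast
    then show "colors_agree (x @ tl x') (y @ tl y') p q"
    proof cases
      case 1
      then show ?thesis
        using D'(7) mD(1,2)[OF 1(1)] col_glued(1,2)[OF ne] unfolding color_compatible_def by simp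
    next
      case (2 p' q')
      then show ?thesis
        using E'(7) unfolding 2(1,2) col_glued(3,4)[OF ne] same_side_shift color_compatible_def by blast
    qed
  qed
qed

lemma flip_diagrams:
  assumes D: "D \<in> diagrams S x y"
  shows "flip_diag D \<in> diagrams S y x"
  unfolding diagrams_iff
proof (intro conjI)
  note D' = diagramsD[OF D]
  note mD = matchingD[OF D'(5)]
  show "src (flip_diag D) = y" "tgt (flip_diag D) = x" "one_mor S y" "one_mor S x" using D' by auto
  have fp: "flip_point p \<in> points x y \<longleftrightarrow> p \<in> points y x" for p by (cases p) auto
  show "matching (points y x) (arcs (flip_diag D))"
  proof (rule matchingI)
    show "\<exists>p q. a = {p, q}" if "a \<in> arcs (flip_diag D)" for a
      using that mD(7) image_doubletons[of a _ "arcs D"] by (simp add: flip_diag_def)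
    show "p \<noteq> q \<and> p \<in> points y x" if "{p, q} \<in> arcs (flip_diag D)" for p q
      using that mD(1,3)[of "flip_point p" "flip_point q"] fp unfolding arcs_flip by auto
    show "\<exists>q. {p, q} \<in> arcs (flip_diag D)" if p: "p \<in> points y x" for p
      using mD(4)[of "flip_point p"] p fp[of p] unfolding arcs_flip by (metis flip_point_flip_point)
    show "q = q'" if "{p, q} \<in> arcs (flip_diag D)" "{p, q'} \<in> arcs (flip_diag D)" for p q q'
      using that mD(5) injD[OF inj_flip_point] unfolding arcs_flip by metis
  qed
  \<comment> \<open>Reflection reverses the boundary order, so a crossing pattern is read backwards:
    the two arcs change roles, and so do the ends of each.\<close>
  have pf: "pos (flip_point p) = - pos p - 1" for p by (cases p) auto
  show "noncrossing (arcs (flip_diag D))"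
  proof (rule noncrossingI)
    fix p q p' q'
    assume a: "{p, p'} \<in> arcs (flip_diag D)" "{q, q'} \<in> arcs (flip_diag D)"
      and l: "pos p < pos q" "pos q < pos p'" "pos p' < pos q'"
    then have "{flip_point q', flip_point q} \<in> arcs D" "{flip_point p', flip_point p} \<in> arcs D"
      by (simp_all add: arcs_flip insert_commute)
    then show False using noncrossingD[OF D'(6), of "flip_point q'" "flip_point q" "flip_point p'" "flip_point p"] l
      by (simp add: pf)
  qed
  have ss: "same_side (flip_point p) (flip_point q) = same_side p q" for p q by (cases p; cases q) auto
  have lr: "lcol x y (flip_point p) = lcol y x p" "rcol x y (flip_point p) = rcol y x p" for p
    by (cases p; simp)+
  show "color_compatible y x (arcs (flip_diag D))"
    unfolding color_compatible_def
  proof (intro conjI allI impI)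
    show "hd y = hd x" "last y = last x" using D'(7) by (auto simp: color_compatible_def)
    fix p q assume "{p, q} \<in> arcs (flip_diag D) \<and> p \<noteq> q"
    then have "{flip_point p, flip_point q} \<in> arcs D" "flip_point p \<noteq> flip_point q"
      using injD[OF inj_flip_point] by (auto simp: arcs_flip)
    then show "colors_agree y x p q"
      using D'(7) unfolding color_compatible_def by (metis ss lr)
  qed
qed

section \<open>Composition with cups and caps\<close>

fun map_top :: "(nat \<Rightarrow> nat) \<Rightarrow> point \<Rightarrow> point" where
  "map_top f (Bot i) = Bot i"
| "map_top f (Top i) = Top (f i)"

fun to_top :: "(nat \<Rightarrow> nat) \<Rightarrow> (nat \<Rightarrow> nat) \<Rightarrow> point \<Rightarrow> point" where
  "to_top f g (Bot i) = Top (f i)"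
| "to_top f g (Top i) = Top (g i)"

text \<open>\<open>f\<close> and \<open>g\<close> place the middle and the top points on one common
  line. A cup uses \<open>skip\<close> for the middle points, a cap uses it for the top points, and
  points placed on each other are the two ends of a through strand.\<close>

fun collapse :: "(nat \<Rightarrow> nat) \<Rightarrow> (nat \<Rightarrow> nat) \<Rightarrow> node \<Rightarrow> point" where
  "collapse f g (BotN i) = Bot i"
| "collapse f g (MidN i) = Top (f i)"
| "collapse f g (TopN i) = Top (g i)"

lemma collapse_simps [simp]:
  "collapse f g (upper p) = to_top f g p"
  "collapse f g (lower p) = map_top f p"
  "collapse f g (outer p) = map_top g p"
  by (cases p; simp)+

text \<open>Contracting the through strands of \<open>G\<close> identifies middle points with top points.\<close>

lemma linked_collapse:
  assumes wf: "wf_diag G" "wf_diag E" "src G = tgt E"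
    and inj: "inj f" "inj g"
    and thr: "\<And>i k. i < length (tgt E) - 1 \<Longrightarrow> f i = g k \<Longrightarrow> {Bot i, Top k} \<in> arcs G"
  shows "(outer p, outer q) \<in> linked G E \<longleftrightarrow> (map_top g p, map_top g q) \<in>
    ({(map_top f p, map_top f q) | p q. {p, q} \<in> arcs E} \<union>
     {(to_top f g p, to_top f g q) | p q. {p, q} \<in> arcs G})\<^sup>*"
proof -
  let ?h = "collapse f g"
  let ?N = "range BotN \<union> MidN ` {..<length (tgt E) - 1} \<union> range TopN"
  have edge: "(MidN i, TopN k) \<in> glue G E" if "{Bot i, Top k} \<in> arcs G" for i k
    unfolding glue_def using that by (intro UnI1 CollectI exI[of _ "Bot i"] exI[of _ "Top k"]) simp
  have "(a, b) \<in> (glue G E)\<^sup>*" if ab: "a \<in> ?N" "b \<in> ?N" "?h a = ?h b" for a b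
  proof (cases a; cases b)
    fix i k assume "a = MidN i" "b = TopN k"
    then show ?thesis using ab thr edge by fastforce
  next
    fix i k assume "a = TopN k" "b = MidN i"
    then have "(b, a) \<in> glue G E" using ab thr edge by fastforce
    then show ?thesis using symD[OF sym_glue] by blast
  qed (use ab in \<open>auto simp: inj_eq[OF inj(1)] inj_eq[OF inj(2)]\<close>)
  moreover have "Field (glue G E) \<subseteq> ?N" using Field_glue[OF wf] by blast
  moreover have "outer p \<in> ?N" for p by (cases p) auto
  ultimately have "(?h (outer p), ?h (outer q)) \<in> (map_prod ?h ?h ` glue G E)\<^sup>* \<longleftrightarrow>
      (outer p, outer q) \<in> (glue G E)\<^sup>*"
    by (intro rtrancl_quotient)
  moreover have "map_prod ?h ?h ` glue G E =
    {(map_top f p, map_top f q) | p q. {p, q} \<in> arcs E} \<union>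
     {(to_top f g p, to_top f g q) | p q. {p, q} \<in> arcs G}"
  proof -
    have "map_prod ?h ?h ` {(u p, u q) | p q. {p, q} \<in> A} = {(?h (u p), ?h (u q)) | p q. {p, q} \<in> A}"
      for u :: "point \<Rightarrow> node" and A
      by (auto simp: image_iff)
    then show ?thesis unfolding glue_def image_Un by (simp add: Un_commute)
  qed
  ultimately show ?thesis by (simp add: linked_glue)
qed

lemma circles_zero:
  assumes "\<And>i. i < length (tgt E) - 1 \<Longrightarrow> \<exists>p. (MidN i, outer p) \<in> linked D E"
  shows "circles D E = 0"
proof -
  have "{C. C \<subseteq> range MidN \<and> (\<exists>j<length (tgt E) - 1. C = linked D E `` {MidN j})} = {}"
  proof (rule ccontr)
    assume "{C. C \<subseteq> range MidN \<and> (\<exists>j<length (tgt E) - 1. C = linked D E `` {MidN j})} \<noteq> {}"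
    then obtain j where j: "linked D E `` {MidN j} \<subseteq> range MidN" "j < length (tgt E) - 1" by blast
    then obtain p where "outer p \<in> linked D E `` {MidN j}" using assms by blast
    then have "outer p \<in> range MidN" using j by blast
    then show False by (cases p) auto
  qed
  then show ?thesis by (simp add: circles_def)
qed

lemma linked_upper: "{p, q} \<in> arcs D \<Longrightarrow> (upper p, upper q) \<in> linked D E"
  and linked_lower: "{p, q} \<in> arcs E \<Longrightarrow> (lower p, lower q) \<in> linked D E"
  unfolding linked_glue glue_def by blast+

text \<open>A point has only one partner, so a second step along an arc returns to the start and the
  closure adds nothing but \<open>Id\<close>.\<close>

lemma rtrancl_matching:
  assumes "matching P A"
  shows "{(p, q). {p, q} \<in> A}\<^sup>* = {(p, q). {p, q} \<in> A} \<union> Id"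
proof (intro equalityI subsetI)
  fix z assume "z \<in> {(p, q). {p, q} \<in> A}\<^sup>*"
  then obtain p q where z: "z = (p, q)" "(p, q) \<in> {(p, q). {p, q} \<in> A}\<^sup>*" by (cases z) blast
  from z(2) have "{p, q} \<in> A \<or> p = q"
  proof (induction rule: rtrancl_induct)
    case (step y z)
    then show ?case using matchingD(5)[OF assms, of y p z] by (auto simp: insert_commute)
  qed simp
  then show "z \<in> {(p, q). {p, q} \<in> A} \<union> Id" using z by auto
qed auto

text \<open>Collapsing turns each through strand into a loop; such extra loops are absorbed by the
  closure.\<close>

lemma rtrancl_sandwich: "R \<subseteq> K \<Longrightarrow> K \<subseteq> R \<union> Id \<Longrightarrow> K\<^sup>* = R\<^sup>*"
  by (metis rtrancl_mono rtrancl_reflcl subset_antisym)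

lemma map_top_id [simp]: "map_top (\<lambda>i. i) p = p"
  by (cases p) auto

lemma id_vcomp:
  assumes E: "E \<in> diagrams S x y"
  shows "vcomp_diag (id_diag y) E = E" "circles (id_diag y) E = 0"
proof -
  note E' = diagramsD[OF E]
  have wf: "wf_diag (id_diag y)" "wf_diag E" "src (id_diag y) = tgt E"
    using E' diagrams_wf[OF E] by (auto intro: wf_id_diag)
  have thr: "{Bot i, Top i} \<in> arcs (id_diag y)" if "i < length y - 1" for i
    using that by (auto simp: arcs_id)
  show "circles (id_diag y) E = 0"
  proof (rule circles_zero)
    show "\<exists>p. (MidN i, outer p) \<in> linked (id_diag y) E" if "i < length (tgt E) - 1" for i
      using that linked_upper[OF thr] E' by (intro exI[of _ "Top i"]) auto
  qed
  let ?K = "{(map_top (\<lambda>i. i) p, map_top (\<lambda>i. i) q) | p q. {p, q} \<in> arcs E} \<union>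
     {(to_top (\<lambda>i. i) (\<lambda>i. i) p, to_top (\<lambda>i. i) (\<lambda>i. i) q) | p q. {p, q} \<in> arcs (id_diag y)}"
  have L: "(outer p, outer q) \<in> linked (id_diag y) E \<longleftrightarrow> (p, q) \<in> ?K\<^sup>*" for p q
    using linked_collapse[OF wf, of "\<lambda>i. i" "\<lambda>i. i" p q] thr E' by simp
  have "?K\<^sup>* = {(p, q). {p, q} \<in> arcs E}\<^sup>*"
    by (rule rtrancl_sandwich) (auto simp: arcs_id)
  then have L': "(outer p, outer q) \<in> linked (id_diag y) E \<longleftrightarrow> {p, q} \<in> arcs E \<or> p = q" for p q
    unfolding L using rtrancl_matching[OF E'(5)] by simp
  show "vcomp_diag (id_diag y) E = E"
  proof (rule diagram_eqI)
    show "{p, q} \<in> arcs (vcomp_diag (id_diag y) E) \<longleftrightarrow> {p, q} \<in> arcs E" for p q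
      unfolding arcs_vcomp L' using matchingD(3)[OF E'(5)] by blast
  qed (use E' in \<open>auto intro: vcomp_doubleton diagrams_doubleton[OF E]\<close>)
qed

lemma vcomp_id:
  assumes E: "E \<in> diagrams S x y"
  shows "vcomp_diag E (id_diag x) = E" "circles E (id_diag x) = 0"
proof -
  have wf: "wf_diag E" "wf_diag (id_diag x)" "src E = tgt (id_diag x)"
    using diagrams_wf[OF E] diagramsD[OF E] by (auto intro: wf_id_diag)
  note f = id_vcomp[OF flip_diagrams[OF E]]
  show "vcomp_diag E (id_diag x) = E"
    using f(1) by (metis flip_diag_flip_diag flip_id flip_vcomp_diag)
  show "circles E (id_diag x) = 0" using circles_flip[OF wf] f(2) by simp
qed

text \<open>Renumbering of the old points when the two ends \<open>j\<close> and
  \<open>Suc j\<close> of a cup are inserted among them.\<close>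

definition skip :: "nat \<Rightarrow> nat \<Rightarrow> nat" where
  "skip j i = (if i < j then i else i + 2)"

lemma inj_skip: "inj (skip j)"
  by (rule injI) (auto simp: skip_def split: if_splits)

lemma skip_range: "k \<noteq> j \<Longrightarrow> k \<noteq> Suc j \<Longrightarrow> \<exists>i. k = skip j i"
  by (cases "k < j"; rule exI[of _ "if k < j then k else k - 2"]) (auto simp: skip_def)

lemma skip_neq [simp]: "skip j i \<noteq> j" "skip j i \<noteq> Suc j" "j \<noteq> skip j i" "Suc j \<noteq> skip j i"
  by (auto simp: skip_def)

definition cup_at :: "'c list \<Rightarrow> 'c \<Rightarrow> 'c \<Rightarrow> 'c list \<Rightarrow> 'c diagram" where
  "cup_at u b r v = hcomp_diag (hcomp_diag (id_diag (u @ [b])) (cup_diag b r)) (id_diag (b # v))"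

definition cap_at :: "'c list \<Rightarrow> 'c \<Rightarrow> 'c \<Rightarrow> 'c list \<Rightarrow> 'c diagram" where
  "cap_at u b r v = hcomp_diag (hcomp_diag (id_diag (u @ [b])) (cap_diag b r)) (id_diag (b # v))"

lemma flip_cup_at [simp]: "flip_diag (cup_at u b r v) = cap_at u b r v"
  by (simp add: cup_at_def cap_at_def flip_hcomp flip_cup_diag)

lemma flip_cap_at [simp]: "flip_diag (cap_at u b r v) = cup_at u b r v"
  by (metis flip_cup_at flip_diag_flip_diag)

lemma src_cup_at [simp]: "src (cup_at u b r v) = u @ b # v"
  and tgt_cup_at [simp]: "tgt (cup_at u b r v) = u @ b # r # b # v"
  by (simp_all add: cup_at_def cup_diag_def)

lemma src_cap_at [simp]: "src (cap_at u b r v) = u @ b # r # b # v"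
  and tgt_cap_at [simp]: "tgt (cap_at u b r v) = u @ b # v"
  by (simp_all add: cap_at_def cap_diag_def)

lemma cup_diag_diagrams:
  assumes "b \<in> S" "r \<in> S" "b \<noteq> r"
  shows "cup_diag b r \<in> diagrams S [b] [b, r, b]"
  unfolding diagrams_iff
proof (intro conjI)
  have arcs: "{p, q} \<in> arcs (cup_diag b r) \<longleftrightarrow> p = Top 0 \<and> q = Top 1 \<or> p = Top 1 \<and> q = Top 0" for p q
    by (auto simp: cup_diag_def doubleton_eq_iff)
  show "matching (points [b] [b, r, b]) (arcs (cup_diag b r))"
  proof (rule matchingI)
    show "\<exists>q. {p, q} \<in> arcs (cup_diag b r)" if "p \<in> points [b] [b, r, b]" for p
      using that unfolding arcs by (cases p) (auto simp: less_2_cases_iff numeral_2_eq_2 less_Suc_eq)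
  qed (auto simp: arcs cup_diag_def doubleton_eq_iff)
  show "noncrossing (arcs (cup_diag b r))" by (rule noncrossingI) (auto simp: arcs)
  show "color_compatible [b] [b, r, b] (arcs (cup_diag b r))"
    by (auto simp: color_compatible_def arcs)
qed (use assms in \<open>auto simp: cup_diag_def one_mor_def\<close>)

lemma cup_at_diagrams:
  assumes "one_mor S (u @ b # r # b # v)"
  shows "cup_at u b r v \<in> diagrams S (u @ b # v) (u @ b # r # b # v)"
proof -
  have one: "one_mor S (u @ [b])" "one_mor S (b # v)" "b \<in> S" "r \<in> S" "b \<noteq> r"
    using assms by (auto simp: one_mor_def distinct_adj_append_iff distinct_adj_Cons)
  have "hcomp_diag (id_diag (u @ [b])) (cup_diag b r) \<in> diagrams S (u @ [b]) (u @ [b, r, b])"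
    using hcomp_diagrams[OF id_diag_diagrams[OF one(1)] cup_diag_diagrams[OF one(3,4,5)]] by simp
  from hcomp_diagrams[OF this id_diag_diagrams[OF one(2)]] show ?thesis
    by (simp add: cup_at_def)
qed

lemma cap_at_diagrams:
  assumes "one_mor S (u @ b # r # b # v)"
  shows "cap_at u b r v \<in> diagrams S (u @ b # r # b # v) (u @ b # v)"
  using flip_diagrams[OF cup_at_diagrams[OF assms]] by simp

text \<open>The bottom line \<open>u @ b # v\<close> carries \<open>length u + length v\<close>
  points, one for each through strand. Later computations with cups and, by reflection, with caps
  start from this closed form.\<close>

lemma arcs_cup_at: "{p, q} \<in> arcs (cup_at u b r v) \<longleftrightarrow>
   {p, q} = {Top (length u), Top (Suc (length u))} \<or>
   (\<exists>i<length u + length v. {p, q} = {Bot i, Top (skip (length u) i)})" (is "?L \<longleftrightarrow> ?R")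
proof
  let ?j = "length u"
  assume ?L
  then have "{p, q} \<in> arcs (hcomp_diag (id_diag (u @ [b])) (cup_diag b r)) \<or>
     (\<exists>p' q'. p = shift ?j (?j + 2) p' \<and> q = shift ?j (?j + 2) q' \<and> {p', q'} \<in> arcs (id_diag (b # v)))"
    unfolding cup_at_def arcs_hcomp[of p q "hcomp_diag (id_diag (u @ [b])) (cup_diag b r)"]
    by (simp add: cup_diag_def)
  then consider i where "i < length u" "{p, q} = {Bot i, Top i}"
    | "{p, q} = {Top ?j, Top (Suc ?j)}"
    | i where "i < length v" "{p, q} = {Bot (?j + i), Top (?j + 2 + i)}"
    unfolding arcs_hcomp arcs_id by (auto simp: cup_diag_def doubleton_eq_iff)
  then show ?R
  proof cases
    case (1 i)
    then show ?thesis by (intro disjI2 exI[of _ i]) (auto simp: skip_def)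
  next
    case (3 i)
    then show ?thesis by (intro disjI2 exI[of _ "?j + i"]) (auto simp: skip_def add.commute)
  qed simp
next
  let ?j = "length u"
  assume ?R
  then consider i where "i < length u" "{p, q} = {Bot i, Top i}"
    | "{p, q} = {Top ?j, Top (Suc ?j)}"
    | i where "i < length v" "{p, q} = {Bot (?j + i), Top (?j + 2 + i)}"
  proof (elim disjE exE conjE)
    fix i assume i: "i < length u + length v" "{p, q} = {Bot i, Top (skip ?j i)}"
    show thesis
    proof (cases "i < ?j")
      case False
      then have "{p, q} = {Bot (?j + (i - ?j)), Top (?j + 2 + (i - ?j))}" "i - ?j < length v"
        using i by (auto simp: skip_def)
      then show thesis using that(3) by blast
    qed (use i that(1) in \<open>simp add: skip_def\<close>)
  qed
  then show ?L
  proof cases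
    case (1 i)
    then have "{p, q} \<in> arcs (id_diag (u @ [b]))" by (auto simp: arcs_id doubleton_eq_iff)
    then show ?thesis unfolding cup_at_def arcs_hcomp by blast
  next
    case 2
    then have "{p, q} \<in> arcs (hcomp_diag (id_diag (u @ [b])) (cup_diag b r))"
      by (auto simp: hcomp_diag_def cup_diag_def doubleton_eq_iff insert_commute)
    then show ?thesis unfolding cup_at_def by (subst arcs_hcomp) blast
  next
    case (3 i)
    then have "\<exists>p' q'. p = shift ?j (?j + 2) p' \<and> q = shift ?j (?j + 2) q' \<and> {p', q'} \<in> arcs (id_diag (b # v))"
      unfolding arcs_id doubleton_eq_iff
      by (elim disjE conjE) (rule exI[of _ "Bot i"] exI[of _ "Top i"], rule exI[of _ "Bot i"] exI[of _ "Top i"], simp)+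
    then show ?thesis unfolding cup_at_def by (subst arcs_hcomp) (simp add: cup_diag_def)
  qed
qed

abbreviation skip_point :: "nat \<Rightarrow> point \<Rightarrow> point" where
  "skip_point j \<equiv> map_top (skip j)"

lemma inj_map_top: "inj f \<Longrightarrow> inj (map_top f)"
  by (rule injI) (case_tac x; case_tac y; auto dest: injD)

lemma skip_point_eq [simp]: "skip_point j p = skip_point j q \<longleftrightarrow> p = q"
  using inj_eq[OF inj_map_top[OF inj_skip]] .

lemma skip_point_neq [simp]: "skip_point j p \<noteq> Top j" "skip_point j p \<noteq> Top (Suc j)"
  "Top j \<noteq> skip_point j p" "Top (Suc j) \<noteq> skip_point j p"
  by (cases p; simp)+

lemma skip_point_range: "p \<noteq> Top j \<Longrightarrow> p \<noteq> Top (Suc j) \<Longrightarrow> \<exists>q. p = skip_point j q"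
  using skip_range by (cases p) (metis map_top.simps)+

lemma skip_point_points:
  "skip_point (length u) p \<in> points x (u @ b # r # b # v) \<longleftrightarrow> p \<in> points x (u @ b # v)"
  by (cases p) (auto simp: skip_def)

lemma pos_skip_point [simp]: "pos (skip_point j p) < pos (skip_point j q) \<longleftrightarrow> pos p < pos q"
  by (cases p; cases q) (auto simp: skip_def)

text \<open>The colors \<open>r\<close> and \<open>b\<close> are inserted behind a \<open>b\<close>,
  so a point next to the new cup sees the same \<open>b\<close> as before.\<close>

lemma col_skip_point:
  assumes "p \<in> points x (u @ b # v)"
  shows "lcol x (u @ b # r # b # v) (skip_point (length u) p) = lcol x (u @ b # v) p"
    "rcol x (u @ b # r # b # v) (skip_point (length u) p) = rcol x (u @ b # v) p"
proof -
  have "(u @ b # r # b # v) ! skip (length u) i = (u @ b # v) ! i" for i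
  proof (cases "i < length u")
    case False
    then obtain k where "i = length u + k" using le_Suc_ex not_less by blast
    then show ?thesis by (cases k) (simp_all add: skip_def nth_append)
  qed (simp add: skip_def nth_append)
  moreover have "(u @ b # r # b # v) ! Suc (skip (length u) i) = (u @ b # v) ! Suc i" for i
  proof (cases "i < length u")
    case True
    then show ?thesis by (cases "Suc i < length u") (simp_all add: skip_def nth_append)
  next
    case False
    then obtain k where "i = length u + k" using le_Suc_ex not_less by blast
    then show ?thesis by (simp add: skip_def nth_append)
  qed
  ultimately show "lcol x (u @ b # r # b # v) (skip_point (length u) p) = lcol x (u @ b # v) p"
    "rcol x (u @ b # r # b # v) (skip_point (length u) p) = rcol x (u @ b # v) p"
    by (cases p; simp)+
qed

lemma same_side_skip_point [simp]: "same_side (skip_point j p) (skip_point j q) = same_side p q"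
  by (cases p; cases q) auto

lemma one_mor_snip: "one_mor S (u @ b # r # b # v) \<Longrightarrow> one_mor S (u @ b # v)"
  by (auto simp: one_mor_def distinct_adj_append_iff distinct_adj_Cons)

section \<open>Stacking a single cup on top of a diagram\<close>

definition add_cup :: "nat \<Rightarrow> point set set \<Rightarrow> point set set" where
  "add_cup j A = insert {Top j, Top (Suc j)} ((`) (skip_point j) ` A)"

lemma mem_add_cup: "{p, q} \<in> add_cup j A \<longleftrightarrow> p = Top j \<and> q = Top (Suc j) \<or> p = Top (Suc j) \<and> q = Top j \<or>
   (\<exists>p' q'. p = skip_point j p' \<and> q = skip_point j q' \<and> {p', q'} \<in> A)"
  unfolding add_cup_def insert_iff doubleton_in_image[OF inj_map_top[OF inj_skip]]
  by (auto simp: doubleton_eq_iff)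

lemma matching_add_cup:
  assumes m: "matching (points x (u @ b # v)) A"
  shows "matching (points x (u @ b # r # b # v)) (add_cup (length u) A)"
proof (rule matchingI)
  let ?j = "length u"
  note mD = matchingD[OF m]
  show "\<exists>p q. a = {p, q}" if "a \<in> add_cup ?j A" for a
    using that unfolding add_cup_def insert_iff
    by (elim disjE) (blast, rule image_doubletons, assumption, rule mD(7))
  show "p \<noteq> q \<and> p \<in> points x (u @ b # r # b # v)" if "{p, q} \<in> add_cup ?j A" for p q
    using that mD(1,3) unfolding mem_add_cup by (auto simp: skip_point_points)
  show "\<exists>q. {p, q} \<in> add_cup ?j A" if p: "p \<in> points x (u @ b # r # b # v)" for p
  proof (cases "p = Top ?j \<or> p = Top (Suc ?j)")
    case True
    then show ?thesis unfolding mem_add_cup by blast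
  next
    case False
    then obtain p' where p': "p = skip_point ?j p'" using skip_point_range by blast
    then have "p' \<in> points x (u @ b # v)" using p p' by (simp only: skip_point_points)
    from mD(4)[OF this] obtain q' where "{p', q'} \<in> A" ..
    then show ?thesis unfolding mem_add_cup using p' by blast
  qed
  show "q = q'" if "{p, q} \<in> add_cup ?j A" "{p, q'} \<in> add_cup ?j A" for p q q'
    using that mD(5) unfolding mem_add_cup by (auto simp del: map_top.simps)
qed

text \<open>The through strands of the cup place the middle point \<open>i\<close> at the top point
  \<open>skip (length u) i\<close>. After collapsing them only the arcs of \<open>E\<close> and the
  new arc remain, up to loops. Every middle point reaches the top, so no circle arises.\<close>

lemma cup_at_vcomp:
  assumes E: "E \<in> diagrams S x (u @ b # v)"
  shows "arcs (vcomp_diag (cup_at u b r v) E) = add_cup (length u) (arcs E)"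
    and "circles (cup_at u b r v) E = 0"
proof -
  let ?C = "cup_at u b r v" and ?j = "length u"
  note E' = diagramsD[OF E]
  have wf: "wf_diag ?C" "wf_diag E" "src ?C = tgt E"
    using E' diagrams_wf[OF E]
    by (auto simp: cup_at_def cup_diag_def intro!: wf_hcomp wf_id_diag) (auto simp: wf_diag_def points_def)
  have thr: "{Bot i, Top (skip ?j i)} \<in> arcs ?C" if "i < length (tgt E) - 1" for i
    using that E' unfolding arcs_cup_at by auto
  have thr': "{Bot i, Top k} \<in> arcs ?C" if "i < length (tgt E) - 1" "skip ?j i = k" for i k
    using thr[OF that(1)] that(2) by simp
  show "circles ?C E = 0"
  proof (rule circles_zero)
    show "\<exists>p. (MidN i, outer p) \<in> linked ?C E" if i: "i < length (tgt E) - 1" for i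
      using linked_upper[OF thr[OF i]] by (intro exI[of _ "Top (skip ?j i)"]) auto
  qed
  note m = matching_add_cup[OF E'(5), of r]
  let ?K = "{(skip_point ?j p, skip_point ?j q) | p q. {p, q} \<in> arcs E} \<union>
     {(to_top (skip ?j) (\<lambda>i. i) p, to_top (skip ?j) (\<lambda>i. i) q) | p q. {p, q} \<in> arcs ?C}"
  have L: "(outer p, outer q) \<in> linked ?C E \<longleftrightarrow> (p, q) \<in> ?K\<^sup>*" for p q
    using linked_collapse[OF wf inj_skip inj_on_id2 thr', where p = p and q = q] by simp
  have "?K\<^sup>* = {(p, q). {p, q} \<in> add_cup ?j (arcs E)}\<^sup>*"
  proof (rule rtrancl_sandwich)
    have "{Top ?j, Top (Suc ?j)} \<in> arcs ?C" "{Top (Suc ?j), Top ?j} \<in> arcs ?C"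
      unfolding arcs_cup_at by auto
    then have "(Top ?j, Top (Suc ?j)) \<in> ?K" "(Top (Suc ?j), Top ?j) \<in> ?K" by force+
    then show "{(p, q). {p, q} \<in> add_cup ?j (arcs E)} \<subseteq> ?K"
      unfolding mem_add_cup by blast
    show "?K \<subseteq> {(p, q). {p, q} \<in> add_cup ?j (arcs E)} \<union> Id"
      unfolding mem_add_cup arcs_cup_at by (auto simp: doubleton_eq_iff)
  qed
  then have L': "(outer p, outer q) \<in> linked ?C E \<longleftrightarrow> {p, q} \<in> add_cup ?j (arcs E) \<or> p = q" for p q
    unfolding L using rtrancl_matching[OF m] by simp
  have "vcomp_diag ?C E = Diagram x (u @ b # r # b # v) (add_cup ?j (arcs E))"
  proof (rule diagram_eqI)
    show "{p, q} \<in> arcs (vcomp_diag ?C E) \<longleftrightarrow> {p, q} \<in> arcs (Diagram x (u @ b # r # b # v) (add_cup ?j (arcs E)))" for p q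
      unfolding arcs_vcomp L' using matchingD(3)[OF m] by auto
    show "\<exists>p q. a = {p, q}" if "a \<in> arcs (Diagram x (u @ b # r # b # v) (add_cup ?j (arcs E)))" for a
      using that matchingD(7)[OF m] by simp
  qed (use E' in \<open>auto intro: vcomp_doubleton\<close>)
  then show "arcs (vcomp_diag ?C E) = add_cup ?j (arcs E)" by simp
qed

text \<open>The ends of the new cup are neighbors in the boundary order, so no end point of another
  arc can lie between them.\<close>

lemma pos_top_adjacent: "pos p < pos (Top j) \<longleftrightarrow> pos p < pos (Top (Suc j)) \<or> p = Top (Suc j)"
  by (cases p) auto

lemma cup_at_vcomp_diagrams:
  assumes E: "E \<in> diagrams S x (u @ b # v)" and one: "one_mor S (u @ b # r # b # v)"
  shows "vcomp_diag (cup_at u b r v) E \<in> diagrams S x (u @ b # r # b # v)"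
  unfolding diagrams_iff cup_at_vcomp(1)[OF E]
proof (intro conjI)
  let ?j = "length u"
  note E' = diagramsD[OF E]
  show "src (vcomp_diag (cup_at u b r v) E) = x" "tgt (vcomp_diag (cup_at u b r v) E) = u @ b # r # b # v"
    "one_mor S x" "one_mor S (u @ b # r # b # v)" using E' one by auto
  show "matching (points x (u @ b # r # b # v)) (add_cup ?j (arcs E))"
    using matching_add_cup[OF E'(5)] .
  show "noncrossing (add_cup ?j (arcs E))"
  proof (rule noncrossingI)
    fix p q p' q'
    assume a: "{p, p'} \<in> add_cup ?j (arcs E)" "{q, q'} \<in> add_cup ?j (arcs E)"
      and l: "pos p < pos q" "pos q < pos p'" "pos p' < pos q'"
    have no: False if "{p, p'} = {Top ?j, Top (Suc ?j)}" "pos p < pos q" "pos q < pos p'" for p p' q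
      using that pos_top_adjacent[of q ?j] by (auto simp: doubleton_eq_iff)
    have "{p, p'} \<noteq> {Top ?j, Top (Suc ?j)}" "{q, q'} \<noteq> {Top ?j, Top (Suc ?j)}"
      using no[OF _ l(1,2)] no[OF _ l(2,3)] by blast+
    then have "\<exists>s s' t t'. p = skip_point ?j s \<and> p' = skip_point ?j s' \<and> {s, s'} \<in> arcs E \<and>
       q = skip_point ?j t \<and> q' = skip_point ?j t' \<and> {t, t'} \<in> arcs E"
      using a unfolding mem_add_cup doubleton_eq_iff by auto
    then show False using noncrossingD[OF E'(6)] l by (metis pos_skip_point)
  qed
  show "color_compatible x (u @ b # r # b # v) (add_cup ?j (arcs E))"
    unfolding color_compatible_def
  proof (intro conjI allI impI)
    show "hd x = hd (u @ b # r # b # v)" "last x = last (u @ b # r # b # v)"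
      using E'(7) by (cases u; auto simp: color_compatible_def)+
    fix p q assume "{p, q} \<in> add_cup ?j (arcs E) \<and> p \<noteq> q"
    then consider "p = Top ?j" "q = Top (Suc ?j)" | "p = Top (Suc ?j)" "q = Top ?j"
      | p' q' where "p = skip_point ?j p'" "q = skip_point ?j q'" "{p', q'} \<in> arcs E"
      unfolding mem_add_cup by blast
    then show "colors_agree x (u @ b # r # b # v) p q"
    proof cases
      case (3 p' q')
      have "p' \<in> points x (u @ b # v)" "q' \<in> points x (u @ b # v)" "p' \<noteq> q'"
        using matchingD(1-3)[OF E'(5) 3(3)] by auto
      then show ?thesis
        using E'(7) 3(3) unfolding 3(1,2) color_compatible_def by (simp add: col_skip_point)
    qed (simp_all add: nth_append)
  qed
qed

section \<open>Stacking a single cap on top of a diagram\<close>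

definition joined :: "nat \<Rightarrow> point set set \<Rightarrow> point \<Rightarrow> point \<Rightarrow> bool" where
  "joined j A s t \<longleftrightarrow> {s, t} \<in> A \<or> {s, Top j} \<in> A \<and> {t, Top (Suc j)} \<in> A \<or>
     {s, Top (Suc j)} \<in> A \<and> {t, Top j} \<in> A"

text \<open>Partners are unique, so a path without backtracking between two points other than the
  ends of the cap is either one arc of \<open>A\<close> or uses the cap once, in one of two
  directions. These are the three cases of \<open>joined\<close>.\<close>

lemma rtrancl_joined:
  assumes m: "matching P A" and s: "s \<noteq> Top j" "s \<noteq> Top (Suc j)" and t: "t \<noteq> Top j" "t \<noteq> Top (Suc j)" and st: "s \<noteq> t"
  shows "(s, t) \<in> ({(p, q). {p, q} \<in> A} \<union> {(Top j, Top (Suc j)), (Top (Suc j), Top j)})\<^sup>* \<longleftrightarrow> joined j A s t"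
    (is "_ \<in> ?R\<^sup>* \<longleftrightarrow> _")
proof
  assume "joined j A s t"
  then consider "(s, t) \<in> ?R" | "(s, Top j) \<in> ?R" "(Top (Suc j), t) \<in> ?R"
    | "(s, Top (Suc j)) \<in> ?R" "(Top j, t) \<in> ?R"
    unfolding joined_def by (auto simp: insert_commute)
  then show "(s, t) \<in> ?R\<^sup>*"
  proof cases
    case 2
    moreover have "(Top j, Top (Suc j)) \<in> ?R" by simp
    ultimately show ?thesis by (meson rtrancl.rtrancl_into_rtrancl rtrancl.rtrancl_refl)
  next
    case 3
    moreover have "(Top (Suc j), Top j) \<in> ?R" by simp
    ultimately show ?thesis by (meson rtrancl.rtrancl_into_rtrancl rtrancl.rtrancl_refl)
  qed blast
next
  \<comment> \<open>\<open>K\<close> consists of the ends of the cap and their partners; it is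
    closed under arcs, so a path that enters it stays there.\<close>
  define K where "K = {s. s = Top j \<or> s = Top (Suc j) \<or> {s, Top j} \<in> A \<or> {s, Top (Suc j)} \<in> A}"
  note mD = matchingD[OF m]
  have K: "w \<in> K" if y: "y \<in> K" "{y, w} \<in> A" for y w
  proof -
    consider "y = Top j" | "y = Top (Suc j)" | "{y, Top j} \<in> A" | "{y, Top (Suc j)} \<in> A"
      using y(1) unfolding K_def by blast
    then show ?thesis
    proof cases
      case 3
      then have "w = Top j" using mD(5) y(2) by blast
      then show ?thesis by (simp add: K_def)
    next
      case 4
      then have "w = Top (Suc j)" using mD(5) y(2) by blast
      then show ?thesis by (simp add: K_def)
    qed (use y(2) in \<open>simp_all add: K_def insert_commute\<close>)
  qed
  assume "(s, t) \<in> ?R\<^sup>*"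
  then have "s = t \<or> {s, t} \<in> A \<or> s \<in> K \<and> t \<in> K"
  proof (induction rule: rtrancl_induct)
    case (step y z)
    show ?case
    proof (cases "{y, z} \<in> A")
      case True
      then show ?thesis using step(3) K mD(6)[of y s] mD(5)[of y s z] by (auto simp: insert_commute)
    next
      case False
      then have "y \<in> K" "z \<in> K" using step(2) by (auto simp: K_def)
      moreover have "s \<in> K" if "{s, y} \<in> A" using K[OF \<open>y \<in> K\<close>] that by (simp add: insert_commute)
      ultimately show ?thesis using step(3) by blast
    qed
  qed simp
  then show "joined j A s t"
    using st s t mD(6) unfolding joined_def K_def by blast
qed

text \<open>Here the top points of \<open>E\<close> keep their numbers and those of the composite
  are renumbered by \<open>skip\<close>. In contrast to cups, no absence of circles can be claimed:
  the cap may close one.\<close>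

lemma cap_at_linked:
  assumes E: "E \<in> diagrams S x (u @ b # r # b # v)"
  shows "{p, q} \<in> arcs (vcomp_diag (cap_at u b r v) E) \<longleftrightarrow>
    p \<noteq> q \<and> joined (length u) (arcs E) (skip_point (length u) p) (skip_point (length u) q)"
proof -
  let ?C = "cap_at u b r v" and ?j = "length u"
  note E' = diagramsD[OF E]
  have wf: "wf_diag ?C" "wf_diag E" "src ?C = tgt E"
    using E' diagrams_wf[OF E] diagrams_wf[OF cap_at_diagrams] by auto
  have arcs: "{p, q} \<in> arcs ?C \<longleftrightarrow> {p, q} = {Bot ?j, Bot (Suc ?j)} \<or>
     (\<exists>i<length u + length v. {p, q} = {Top i, Bot (skip ?j i)})" for p q
  proof -
    have "{p, q} \<in> arcs ?C \<longleftrightarrow> {flip_point p, flip_point q} \<in> arcs (cup_at u b r v)"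
      by (metis arcs_flip flip_cup_at)
    also have "\<dots> \<longleftrightarrow> {p, q} = {Bot ?j, Bot (Suc ?j)} \<or>
      (\<exists>i<length u + length v. {p, q} = {Top i, Bot (skip ?j i)})"
      unfolding arcs_cup_at doubleton_eq_iff by (cases p; cases q) auto
    finally show ?thesis .
  qed
  have thr: "{Bot i, Top k} \<in> arcs ?C" if "i < length (tgt E) - 1" "i = skip ?j k" for i k
  proof -
    have "k < length u + length v" using that E' by (auto simp: skip_def split: if_splits)
    then show ?thesis unfolding arcs using that(2) by (auto simp: insert_commute)
  qed
  let ?K = "{(map_top (\<lambda>i. i) p, map_top (\<lambda>i. i) q) | p q. {p, q} \<in> arcs E} \<union>
     {(to_top (\<lambda>i. i) (skip ?j) p, to_top (\<lambda>i. i) (skip ?j) q) | p q. {p, q} \<in> arcs ?C}"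
  let ?R = "{(p, q). {p, q} \<in> arcs E} \<union> {(Top ?j, Top (Suc ?j)), (Top (Suc ?j), Top ?j)}"
  have L: "(outer p, outer q) \<in> linked ?C E \<longleftrightarrow> (skip_point ?j p, skip_point ?j q) \<in> ?K\<^sup>*" for p q
    using linked_collapse[OF wf _ inj_skip, of "\<lambda>i. i" ?j p q] thr by simp
  have "?K\<^sup>* = ?R\<^sup>*"
  proof (rule rtrancl_sandwich)
    have "{Bot ?j, Bot (Suc ?j)} \<in> arcs ?C" "{Bot (Suc ?j), Bot ?j} \<in> arcs ?C"
      unfolding arcs by auto
    then have "(Top ?j, Top (Suc ?j)) \<in> ?K" "(Top (Suc ?j), Top ?j) \<in> ?K" by force+
    then show "?R \<subseteq> ?K" by auto
    show "?K \<subseteq> ?R \<union> Id"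
      unfolding arcs by (auto simp: doubleton_eq_iff)
  qed
  then show ?thesis
    unfolding arcs_vcomp L using rtrancl_joined[OF E'(5), of "skip_point ?j p" ?j "skip_point ?j q"] by auto
qed

lemma pos_eq: "pos p = pos q \<longleftrightarrow> p = q"
  by (cases p; cases q) auto

text \<open>Two disjoint arcs do not cross iff each of them has both or no end points between those of
  the other. This form is stable under joining arcs.\<close>

lemma noncrossing_side:
  assumes "noncrossing A" "{p, p'} \<in> A" "{q, q'} \<in> A" "p \<noteq> q" "p \<noteq> q'" "p' \<noteq> q" "p' \<noteq> q'"
  shows "((pos p < pos q) \<noteq> (pos p' < pos q)) = ((pos p < pos q') \<noteq> (pos p' < pos q'))"
proof -
  have *: "((a < b) \<noteq> (a' < b)) = ((a < b') \<noteq> (a' < b'))"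
    if "a \<noteq> b" "a \<noteq> b'" "a' \<noteq> b" "a' \<noteq> b'"
      "\<not> (a < b \<and> b < a' \<and> a' < b')" "\<not> (a' < b \<and> b < a \<and> a < b')"
      "\<not> (a < b' \<and> b' < a' \<and> a' < b)" "\<not> (a' < b' \<and> b' < a \<and> a < b)"
      "\<not> (b < a \<and> a < b' \<and> b' < a')" "\<not> (b' < a \<and> a < b \<and> b < a')"
      "\<not> (b < a' \<and> a' < b' \<and> b' < a)" "\<not> (b' < a' \<and> a' < b \<and> b < a)" for a a' b b' :: int
    using that by (smt (verit))
  have c: "{p', p} \<in> A" "{q', q} \<in> A" using assms(2,3) by (simp_all add: insert_commute)
  note n = noncrossingD[OF assms(1)]
  show ?thesis
    by (rule *) (use n[OF assms(2,3)] n[OF assms(2) c(2)] n[OF c(1) assms(3)] n[OF c]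
      n[OF assms(3,2)] n[OF assms(3) c(1)] n[OF c(2) assms(2)] n[OF c(2,1)] assms(4-7) in \<open>auto simp: pos_eq\<close>)
qed

lemma joined_unique:
  assumes "matching P A" "joined j A s t" "joined j A s t'"
    and "t \<noteq> Top j" "t \<noteq> Top (Suc j)" "t' \<noteq> Top j" "t' \<noteq> Top (Suc j)"
  shows "t = t'"
proof -
  note mD = matchingD[OF assms(1)]
  have u: "s1 = s2" if "{s, s1} \<in> A" "{s, s2} \<in> A" for s s1 s2 using mD(5) that .
  have u': "s1 = s2" if "{s1, s} \<in> A" "{s2, s} \<in> A" for s s1 s2 using mD(6) that .
  have "Top j \<noteq> Top (Suc j)" by simp
  then show ?thesis
    using assms(2-) u[of s] u'[of _ "Top j"] u'[of _ "Top (Suc j)"] unfolding joined_def by metis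
qed

text \<open>Merging two arcs along the cap is where planarity could fail. The separation test of
  \<open>noncrossing_side\<close> gives the same answer at both ends of an arc and, by adjacency, at
  both ends of the cap, hence also at both ends of a merged arc.\<close>

lemma cap_at_vcomp_diagrams:
  assumes E: "E \<in> diagrams S x (u @ b # r # b # v)"
  shows "vcomp_diag (cap_at u b r v) E \<in> diagrams S x (u @ b # v)" (is "?D \<in> _")
  unfolding diagrams_iff
proof (intro conjI)
  let ?j = "length u" and ?A = "arcs E"
  let ?a = "Top ?j" and ?a' = "Top (Suc ?j)"
  note E' = diagramsD[OF E] and arcs = cap_at_linked[OF E]
  note mD = matchingD[OF E'(5)]
  have sym: "{s, t} \<in> ?A \<Longrightarrow> {t, s} \<in> ?A" for s t by (simp add: insert_commute)
  show "src ?D = x" "tgt ?D = u @ b # v" "one_mor S x" "one_mor S (u @ b # v)"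
    using E' one_mor_snip by auto
  have a: "?a \<in> points x (u @ b # r # b # v)" "?a' \<in> points x (u @ b # r # b # v)" by auto
  show "matching (points x (u @ b # v)) (arcs ?D)"
  proof (rule matchingI)
    show "\<exists>p q. a = {p, q}" if "a \<in> arcs ?D" for a using that by (rule vcomp_doubleton)
    show "p \<noteq> q \<and> p \<in> points x (u @ b # v)" if "{p, q} \<in> arcs ?D" for p q
      using that mD(1)[of "skip_point ?j p"] unfolding arcs joined_def skip_point_points by metis
    show "q = q'" if "{p, q} \<in> arcs ?D" "{p, q'} \<in> arcs ?D" for p q q'
      using joined_unique[OF E'(5), of ?j "skip_point ?j p" "skip_point ?j q" "skip_point ?j q'"] that
      unfolding arcs by simp
    show "\<exists>q. {p, q} \<in> arcs ?D" if p: "p \<in> points x (u @ b # v)" for p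
    proof -
      let ?s = "skip_point ?j p"
      have ps: "?s \<in> points x (u @ b # r # b # v)" using p unfolding skip_point_points .
      obtain s where s: "{?s, s} \<in> ?A" using mD(4)[OF ps] ..
      obtain t where t: "{?a, t} \<in> ?A" using mD(4)[OF a(1)] ..
      obtain t' where t': "{?a', t'} \<in> ?A" using mD(4)[OF a(2)] ..
      consider "s = ?a" | "s = ?a'" | "s \<noteq> ?a" "s \<noteq> ?a'" by blast
      then show ?thesis
      proof cases
        case 1
        have "t' \<noteq> ?a'" using mD(3)[OF t'] by simp
        moreover have "t' \<noteq> ?a" using mD(6)[of ?s ?a ?a'] s t' 1 by auto
        ultimately obtain q where q: "t' = skip_point ?j q" using skip_point_range by blast
        have "p \<noteq> q" using s t' 1 q mD(5)[of ?s ?a ?a'] sym[of ?a' t'] by auto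
        moreover have "joined ?j ?A ?s (skip_point ?j q)"
          using s t' 1 q sym[of ?a' t'] unfolding joined_def by simp
        ultimately show ?thesis unfolding arcs by blast
      next
        case 2
        have "t \<noteq> ?a" using mD(3)[OF t] by simp
        moreover have "t \<noteq> ?a'" using mD(6)[of ?s ?a' ?a] s t 2 by auto
        ultimately obtain q where q: "t = skip_point ?j q" using skip_point_range by blast
        have "p \<noteq> q" using s t 2 q mD(5)[of ?s ?a' ?a] sym[of ?a t] by auto
        moreover have "joined ?j ?A ?s (skip_point ?j q)"
          using s t 2 q sym[of ?a t] unfolding joined_def by simp
        ultimately show ?thesis unfolding arcs by blast
      next
        case 3
        then obtain q where q: "s = skip_point ?j q" using skip_point_range by blast
        then have "p \<noteq> q" using mD(3)[OF s] by auto
        then show ?thesis using s q unfolding arcs joined_def by blast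
      qed
    qed
  qed
  have adj: "pos (skip_point ?j p) < pos ?a \<longleftrightarrow> pos (skip_point ?j p) < pos ?a'"
    "pos ?a < pos (skip_point ?j p) \<longleftrightarrow> pos ?a' < pos (skip_point ?j p)" for p
    by (cases p; auto simp: skip_def)+
  note side = noncrossing_side[OF E'(6)]
  show "noncrossing (arcs ?D)"
  proof (rule noncrossingI)
    fix p q p' q'
    let ?p = "skip_point ?j p" and ?q = "skip_point ?j q" and ?p' = "skip_point ?j p'" and ?q' = "skip_point ?j q'"
    assume J: "{p, p'} \<in> arcs ?D" "{q, q'} \<in> arcs ?D"
      and l: "pos p < pos q" "pos q < pos p'" "pos p' < pos q'"
    have ne: "?p \<noteq> ?q" "?p \<noteq> ?q'" "?p' \<noteq> ?q" "?p' \<noteq> ?q'" using l by auto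
    have L: "pos ?p < pos ?q" "pos ?q < pos ?p'" "pos ?p' < pos ?q'" using l by simp_all
    have one: "((pos P < pos Q) \<noteq> (pos P' < pos Q)) = ((pos P < pos Q') \<noteq> (pos P' < pos Q'))"
      if "{P, P'} \<in> ?A" "{Q, c} \<in> ?A" "{Q', c'} \<in> ?A" "P = skip_point ?j s" "P' = skip_point ?j s'"
        "P \<noteq> Q" "P \<noteq> Q'" "P' \<noteq> Q" "P' \<noteq> Q'" "c = ?a \<and> c' = ?a' \<or> c = ?a' \<and> c' = ?a"
      for P P' Q Q' c c' s s'
    proof -
      have "((pos P < pos Q) \<noteq> (pos P' < pos Q)) = ((pos P < pos c) \<noteq> (pos P' < pos c))"
        using that by (intro side) auto
      moreover have "((pos P < pos Q') \<noteq> (pos P' < pos Q')) = ((pos P < pos c') \<noteq> (pos P' < pos c'))"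
        using that by (intro side) auto
      ultimately show ?thesis using that(4,5,10) adj by auto
    qed
    \<comment> \<open>Excludes that both arcs pass through the cap: its two ends have only two
      partners in all.\<close>
    have eq: False if "{P, c} \<in> ?A" "{Q, c} \<in> ?A" "P \<noteq> Q" for P Q c
      using mD(6) that by blast
    have AA: "{s, t} \<in> ?A \<or> (\<exists>c c'. {s, c} \<in> ?A \<and> {t, c'} \<in> ?A \<and> (c = ?a \<and> c' = ?a' \<or> c = ?a' \<and> c' = ?a))"
      if "joined ?j ?A s t" for s t
      using that unfolding joined_def by blast
    have "joined ?j ?A ?p ?p'" "joined ?j ?A ?q ?q'" using J unfolding arcs by auto
    from AA[OF this(1)] AA[OF this(2)]
    consider "{?p, ?p'} \<in> ?A" "{?q, ?q'} \<in> ?A"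
      | c c' where "{?p, ?p'} \<in> ?A" "{?q, c} \<in> ?A" "{?q', c'} \<in> ?A" "c = ?a \<and> c' = ?a' \<or> c = ?a' \<and> c' = ?a"
      | c c' where "{?q, ?q'} \<in> ?A" "{?p, c} \<in> ?A" "{?p', c'} \<in> ?A" "c = ?a \<and> c' = ?a' \<or> c = ?a' \<and> c' = ?a"
      | c c' d d' where "{?p, c} \<in> ?A" "{?p', c'} \<in> ?A" "c = ?a \<and> c' = ?a' \<or> c = ?a' \<and> c' = ?a"
        "{?q, d} \<in> ?A" "{?q', d'} \<in> ?A" "d = ?a \<and> d' = ?a' \<or> d = ?a' \<and> d' = ?a"
      by blast
    then show False
    proof cases
      case 1
      then show ?thesis using noncrossingD[OF E'(6)] L by blast
    next
      case 2
      then show ?thesis using one[OF 2(1,2,3) refl refl ne] L by auto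
    next
      case 3
      then show ?thesis using one[OF 3(1,2,3) refl refl] ne L by (metis less_asym less_trans)
    next
      case 4
      then show ?thesis using eq ne by metis
    qed
  qed
  have col: "lcol x (u @ b # r # b # v) ?a = b" "rcol x (u @ b # r # b # v) ?a = r"
    "lcol x (u @ b # r # b # v) ?a' = r" "rcol x (u @ b # r # b # v) ?a' = b"
    by (simp_all add: nth_append)
  show "color_compatible x (u @ b # v) (arcs ?D)"
    unfolding color_compatible_def
  proof (intro conjI allI impI)
    show "hd x = hd (u @ b # v)" "last x = last (u @ b # v)"
      using E'(7) by (cases u; auto simp: color_compatible_def)+
    fix p q assume pq: "{p, q} \<in> arcs ?D \<and> p \<noteq> q"
    let ?p = "skip_point ?j p" and ?q = "skip_point ?j q"
    have J: "joined ?j ?A ?p ?q" using pq unfolding arcs by blast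
    then have pts: "p \<in> points x (u @ b # v)" "q \<in> points x (u @ b # v)"
      using mD(1)[of ?p] mD(1,2)[of ?q] mD(2)[of ?p ?q] unfolding joined_def skip_point_points by metis+
    note c = col_skip_point[OF pts(1), of r] col_skip_point[OF pts(2), of r]
    have E7: "colors_agree x (u @ b # r # b # v) s t" if "{s, t} \<in> ?A" for s t
      using E'(7) mD(3)[OF that] that unfolding color_compatible_def by blast
    \<comment> \<open>Along the cap \<open>b\<close> stays on the outer side and \<open>r\<close> on
      the inner side, so the colors on the two sides of a merged arc are carried across.\<close>
    have via: "colors_agree x (u @ b # r # b # v) ?p ?q"
      using J unfolding joined_def
    proof (elim disjE conjE)
      assume "{?p, ?q} \<in> ?A" then show ?thesis by (rule E7)
    next
      assume "{?p, ?a} \<in> ?A" "{?q, ?a'} \<in> ?A"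
      from E7[OF this(1)] E7[OF this(2)] show ?thesis unfolding col by (cases p; cases q) simp_all
    next
      assume "{?p, ?a'} \<in> ?A" "{?q, ?a} \<in> ?A"
      from E7[OF this(1)] E7[OF this(2)] show ?thesis unfolding col by (cases p; cases q) simp_all
    qed
    then show "colors_agree x (u @ b # v) p q"
      unfolding c same_side_skip_point .
  qed
qed

text \<open>Capping closes the arc into a circle, which \<open>vcomp_diag\<close> forgets, and the
  cup puts the arc back. The capped diagram thus serves as the cofactor in the
  factorization.\<close>

lemma cup_cap_vcomp:
  assumes D: "D \<in> diagrams S x (u @ b # r # b # v)"
    and a: "{Top (length u), Top (Suc (length u))} \<in> arcs D"
  shows "vcomp_diag (cup_at u b r v) (vcomp_diag (cap_at u b r v) D) = D"
proof (rule diagram_eqI)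
  let ?j = "length u"
  note D' = diagramsD[OF D] and C = cap_at_vcomp_diagrams[OF D]
  note mD = matchingD[OF D'(5)]
  have a': "{Top (Suc ?j), Top ?j} \<in> arcs D" using a by (simp add: insert_commute)
  have j: "joined ?j (arcs D) (skip_point ?j p) (skip_point ?j q) \<longleftrightarrow> {skip_point ?j p, skip_point ?j q} \<in> arcs D" for p q
    using mD(6)[OF a] mD(6)[OF a'] unfolding joined_def by (metis skip_point_neq)
  fix p q
  have arcs: "{p, q} \<in> arcs (vcomp_diag (cup_at u b r v) (vcomp_diag (cap_at u b r v) D)) \<longleftrightarrow>
     p = Top ?j \<and> q = Top (Suc ?j) \<or> p = Top (Suc ?j) \<and> q = Top ?j \<or>
     (\<exists>p' q'. p = skip_point ?j p' \<and> q = skip_point ?j q' \<and> p' \<noteq> q' \<and> {skip_point ?j p', skip_point ?j q'} \<in> arcs D)"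
    unfolding cup_at_vcomp(1)[OF C] mem_add_cup cap_at_linked[OF D] j ..
  show "{p, q} \<in> arcs (vcomp_diag (cup_at u b r v) (vcomp_diag (cap_at u b r v) D)) \<longleftrightarrow> {p, q} \<in> arcs D"
  proof
    assume "{p, q} \<in> arcs (vcomp_diag (cup_at u b r v) (vcomp_diag (cap_at u b r v) D))"
    then show "{p, q} \<in> arcs D" unfolding arcs using a a' by blast
  next
    assume pq: "{p, q} \<in> arcs D"
    have "p \<noteq> q" using mD(3)[OF pq] .
    have "p = Top ?j \<longleftrightarrow> q = Top (Suc ?j)" "p = Top (Suc ?j) \<longleftrightarrow> q = Top ?j"
      using pq a a' mD(5,6) by metis+
    then consider "p = Top ?j" "q = Top (Suc ?j)" | "p = Top (Suc ?j)" "q = Top ?j"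
      | p' q' where "p = skip_point ?j p'" "q = skip_point ?j q'"
      using skip_point_range by metis
    then show "{p, q} \<in> arcs (vcomp_diag (cup_at u b r v) (vcomp_diag (cap_at u b r v) D))"
      unfolding arcs using pq \<open>p \<noteq> q\<close> by cases auto
  qed
qed (use diagramsD[OF D] in \<open>auto intro: vcomp_doubleton diagrams_doubleton[OF D]\<close>)

section \<open>Factorization of diagrams\<close>

text \<open>Noncrossing traps the partner of \<open>Top (Suc i)\<close> strictly between the two
  ends, which gives a shorter top arc unless the ends are already adjacent.\<close>

lemma innermost_top_arc:
  assumes D: "D \<in> diagrams S x y" and a: "{Top i, Top k} \<in> arcs D" "i < k"
  shows "\<exists>j. {Top j, Top (Suc j)} \<in> arcs D"
  using a
proof (induction "k - i" arbitrary: i k rule: less_induct)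
  case less
  note D' = diagramsD[OF D]
  note mD = matchingD[OF D'(5)]
  show ?case
  proof (cases "k = Suc i")
    case True
    then show ?thesis using less by blast
  next
    case False
    then have k: "Suc i < k" using less by simp
    have "k < length y - 1" using mD(2)[OF less(2)] by simp
    then have "Top (Suc i) \<in> points x y" using k by simp
    from mD(4)[OF this] obtain p where p: "{Top (Suc i), p} \<in> arcs D" ..
    have pk: "p \<noteq> Top k"
    proof
      assume "p = Top k"
      then have "Top (Suc i) = Top i" using mD(6)[OF p, of "Top i"] less(2) by simp
      then show False by simp
    qed
    have pi: "p \<noteq> Top i"
    proof
      assume "p = Top i"
      then have "{Top i, Top (Suc i)} \<in> arcs D" using p by (simp add: insert_commute)
      then have "Top (Suc i) = Top k" using mD(5)[OF _ less(2)] by blast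
      then show False using False by simp
    qed
    have "((pos (Top i) < pos (Top (Suc i))) \<noteq> (pos (Top k) < pos (Top (Suc i)))) =
        ((pos (Top i) < pos p) \<noteq> (pos (Top k) < pos p))"
      using k pk pi by (intro noncrossing_side[OF D'(6) less(2) p]) auto
    then obtain m where m: "p = Top m" "i < m" "m < k" using k pk pi by (cases p) (auto simp: linorder_neq_iff)
    moreover have "p \<noteq> Top (Suc i)" using mD(3)[OF p] by auto
    ultimately have "Suc i < m" by (cases "m = Suc i") auto
    then show ?thesis using less(1)[of m "Suc i"] p m by auto
  qed
qed

text \<open>Each top point \<open>i\<close> runs to some bottom point \<open>f i\<close>, and
  planarity makes \<open>f\<close> strictly increasing. There are at most as many bottom points as
  top points, so \<open>f\<close> is the identity and no bottom point is left over.\<close>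

lemma no_top_arc_imp_id:
  assumes D: "D \<in> diagrams S x y" and len: "length x \<le> length y"
    and no: "\<And>i k. {Top i, Top k} \<notin> arcs D"
  shows "x = y \<and> D = id_diag x"
proof -
  let ?m = "length y - 1" and ?n = "length x - 1"
  note D' = diagramsD[OF D]
  note mD = matchingD[OF D'(5)]
  have "\<exists>i'. {Top i, Bot i'} \<in> arcs D" if i: "i < ?m" for i
  proof -
    have "Top i \<in> points x y" using i by simp
    from mD(4)[OF this] obtain q where "{Top i, q} \<in> arcs D" ..
    then show ?thesis using no by (cases q) auto
  qed
  then obtain f where f: "\<And>i. i < ?m \<Longrightarrow> {Top i, Bot (f i)} \<in> arcs D" by metis
  have fn: "f i < ?n" if "i < ?m" for i using mD(2)[OF f[OF that]] by simp
  have mono: "f i < f k" if ik: "i < k" "k < ?m" for i k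
  proof (rule ccontr)
    assume "\<not> f i < f k"
    moreover have "f i \<noteq> f k"
    proof
      assume "f i = f k"
      then have "Top i = Top k" using mD(6)[OF f[of i], of "Top k"] f[of k] ik by auto
      then show False using ik by simp
    qed
    ultimately show False
      using noncrossingD[OF D'(6) f[of k] f[of i]] ik by auto
  qed
  have lo: "i \<le> f i" if "i < ?m" for i
    using that
  proof (induction i)
    case (Suc i)
    then show ?case using mono[of i "Suc i"] by auto
  qed simp
  \<comment> \<open>The bound \<open>i \<le> f i\<close> counted from the right: there must be room
    for the images of the \<open>i\<close> top points further right.\<close>
  have hi: "f (?m - 1 - i) + i < ?n" if "i < ?m" for i
    using that
  proof (induction i)
    case 0
    then show ?case using fn[of "?m - 1"] by simp
  next
    case (Suc i)
    then have "f (?m - 1 - Suc i) < f (?m - 1 - i)" by (intro mono) auto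
    then show ?case using Suc by auto
  qed
  have eq: "f i = i" if i: "i < ?m" for i
  proof -
    have "?m - 1 - (?m - 1 - i) = i" using i by simp
    then have "f i + (?m - 1 - i) < ?n" using hi[of "?m - 1 - i"] i by simp
    then show ?thesis using lo[OF i] i len by linarith
  qed
  have mn: "?n = ?m"
  proof (cases "?m = 0")
    case False
    then have "?m - 1 < ?m" by simp
    from fn[OF this] eq[OF this] this show ?thesis using len by linarith
  qed (use len in auto)
  then have L: "length x = length y" using D'(8,9) by (cases x; cases y) auto
  have arc: "{Top i, Bot i} \<in> arcs D" if "i < ?m" for i using f[OF that] eq[OF that] by simp
  \<comment> \<open>The strands carry the color to the right of every point; only the first color
    has to come from \<open>hd x = hd y\<close>.\<close>
  have "x ! i = y ! i" if i: "i < length x" for i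
  proof (cases i)
    case 0
    then show ?thesis using D'(7-9) by (simp add: color_compatible_def hd_conv_nth)
  next
    case (Suc k)
    then have "k < ?m" using i L by simp
    from arc[OF this] have "rcol x y (Top k) = rcol x y (Bot k)"
      using D'(7) unfolding color_compatible_def by fastforce
    then show ?thesis using Suc by simp
  qed
  then have xy: "x = y" using L by (intro nth_equalityI) auto
  have "D = id_diag x"
  proof (rule diagram_eqI)
    fix p q
    have arc': "{Bot i, Top i} \<in> arcs D" if "i < ?m" for i using arc[OF that] by (simp add: insert_commute)
    show "{p, q} \<in> arcs D \<longleftrightarrow> {p, q} \<in> arcs (id_diag x)"
    proof
      assume "{p, q} \<in> arcs (id_diag x)"
      then show "{p, q} \<in> arcs D" using arc arc' mn unfolding arcs_id by auto
    next
      assume pq: "{p, q} \<in> arcs D"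
      then have "p \<in> points x y" by (rule mD(1))
      then show "{p, q} \<in> arcs (id_diag x)"
        using mD(5)[OF pq, of "flip_point p"] arc arc' mn unfolding arcs_id by (cases p) auto
    qed
  qed (use D' xy in \<open>auto intro: diagrams_doubleton[OF D] simp: id_diag_def\<close>)
  then show ?thesis using xy by simp
qed

lemma cup_factor:
  assumes D: "D \<in> diagrams S x y" and len: "length x \<le> length y" and ne: "D \<noteq> id_diag x"
  obtains u b r v D' where "y = u @ b # r # b # v" "D' \<in> diagrams S x (u @ b # v)"
    "D = vcomp_diag (cup_at u b r v) D'"
proof -
  note D' = diagramsD[OF D]
  note mD = matchingD[OF D'(5)]
  obtain i k where ik: "{Top i, Top k} \<in> arcs D" using no_top_arc_imp_id[OF D len] ne by blast
  then have "i \<noteq> k" using mD(3) by auto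
  then obtain j where j: "{Top j, Top (Suc j)} \<in> arcs D"
    using innermost_top_arc[OF D, of i k] innermost_top_arc[OF D, of k i] ik
    by (metis insert_commute linorder_neqE_nat)
  have l: "j + 2 < length y" using mD(2)[OF j] by simp
  \<comment> \<open>Both ends of the arc are on the top line, so the color left of one end is the
    color right of the other; this is the pattern \<open>b r b\<close> of a cup.\<close>
  have "y ! j = y ! (j + 2)"
    using D'(7) j unfolding color_compatible_def by fastforce
  then have y: "y = take j y @ y ! j # y ! Suc j # y ! j # drop (j + 3) y"
    using l Cons_nth_drop_Suc[of j y] Cons_nth_drop_Suc[of "Suc j" y] Cons_nth_drop_Suc[of "j + 2" y]
      append_take_drop_id[of j y] by (simp add: eval_nat_numeral)
  then obtain u b r v where uv: "y = u @ b # r # b # v" "length u = j"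
    using l by (metis length_take min.absorb2 less_imp_le_nat less_trans add_lessD1)
  show thesis
    using that[OF uv(1) cap_at_vcomp_diagrams] cup_cap_vcomp[of D S x u b r v] D j uv by simp
qed

lemma cap_factor:
  assumes D: "D \<in> diagrams S x y" and len: "length y \<le> length x" and ne: "D \<noteq> id_diag y"
  obtains u b r v D' where "x = u @ b # r # b # v" "D' \<in> diagrams S (u @ b # v) y"
    "D = vcomp_diag D' (cap_at u b r v)"
proof -
  have "flip_diag D \<noteq> id_diag y" using ne by (metis flip_diag_flip_diag flip_id)
  then obtain u b r v E where E: "x = u @ b # r # b # v" "E \<in> diagrams S y (u @ b # v)"
    "flip_diag D = vcomp_diag (cup_at u b r v) E"
    using cup_factor[OF flip_diagrams[OF D] len] by metis
  then have "D = vcomp_diag (flip_diag E) (cap_at u b r v)"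
    by (metis flip_diag_flip_diag flip_vcomp_diag flip_cup_at)
  then show thesis using that E flip_diagrams[OF E(2)] by blast
qed

text \<open>Planarity and coloring of a composite are not checked directly. A cup is split off the
  top of \<open>D\<close> if \<open>w\<close> is at least as long as \<open>y\<close>, otherwise a
  cap off its bottom. A cup shortens \<open>w\<close>, and a cap, moved onto \<open>E\<close>,
  shortens \<open>y\<close>; the process stops when \<open>D\<close> is an identity.\<close>

lemma vcomp_diagrams:
  assumes "D \<in> diagrams S y w" "E \<in> diagrams S x y"
  shows "vcomp_diag D E \<in> diagrams S x w"
  using assms
proof (induction "length y + length w" arbitrary: x y w D E rule: less_induct)
  case less
  note D = less.prems(1) and E = less.prems(2)
  note wf = diagrams_wf[OF D] diagrams_wf[OF E]
  have st: "src D = y" "tgt E = y" using diagramsD[OF D] diagramsD[OF E] by auto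
  show ?case
  proof (cases "length y \<le> length w")
    case True
    show ?thesis
    proof (cases "D = id_diag y")
      case True
      then show ?thesis using id_vcomp(1)[OF E] E diagramsD[OF D] by simp
    next
      case False
      from cup_factor[OF D True False] obtain u b r v D'
        where w: "w = u @ b # r # b # v" and D': "D' \<in> diagrams S y (u @ b # v)"
          and eq: "D = vcomp_diag (cup_at u b r v) D'" by metis
      have one: "one_mor S (u @ b # r # b # v)" using diagramsD(4)[OF D] w by simp
      have IH: "vcomp_diag D' E \<in> diagrams S x (u @ b # v)" using less.hyps[OF _ D' E] w by simp
      have "vcomp_diag D E = vcomp_diag (cup_at u b r v) (vcomp_diag D' E)"
        unfolding eq using diagrams_wf[OF cup_at_diagrams[OF one]] diagrams_wf[OF D'] wf(2)
          diagramsD(1,2)[OF D'] st by (intro vcomp_diag_assoc) auto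
      then show ?thesis using cup_at_vcomp_diagrams[OF IH one] w by simp
    qed
  next
    case False
    then have len: "length w \<le> length y" by simp
    have "D \<noteq> id_diag w" using False diagramsD(1)[OF D] by auto
    from cap_factor[OF D len this] obtain u b r v D'
      where y: "y = u @ b # r # b # v" and D': "D' \<in> diagrams S (u @ b # v) w"
        and eq: "D = vcomp_diag D' (cap_at u b r v)" by metis
    have one: "one_mor S (u @ b # r # b # v)" using diagramsD(3)[OF D] y by simp
    have C: "vcomp_diag (cap_at u b r v) E \<in> diagrams S x (u @ b # v)"
      using cap_at_vcomp_diagrams E y by simp
    have IH: "vcomp_diag D' (vcomp_diag (cap_at u b r v) E) \<in> diagrams S x w"
      using less.hyps[OF _ D' C] y by simp
    have "vcomp_diag D E = vcomp_diag D' (vcomp_diag (cap_at u b r v) E)"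
      unfolding eq using diagrams_wf[OF cap_at_diagrams[OF one]] diagrams_wf[OF D'] wf(2)
        diagramsD(1,2)[OF D'] st y by (intro vcomp_diag_assoc) auto
    then show ?thesis using IH by simp
  qed
qed

section \<open>The zigzag and circle relations\<close>

lemma zigzag:
  assumes "one_mor S [b, r]"
  shows "vcomp_diag (cap_at [b] r b []) (cup_at [] b r [r]) = id_diag [b, r]"
    and "circles (cap_at [b] r b []) (cup_at [] b r [r]) = 0"
proof -
  let ?A = "cap_at [b] r b []" and ?U = "cup_at [] b r [r]"
  let ?L = "linked ?A ?U"
  have one: "one_mor S ([] @ b # r # b # [r])" "one_mor S ([b] @ r # b # r # [])"
    using assms by (auto simp: one_mor_def)
  note C = cup_at_diagrams[OF one(1)]
  have C': "?U \<in> diagrams S [b, r] ([b] @ r # b # r # [])" using C by simp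
  \<comment> \<open>The middle line has three points: the cup joins 0 and 1, the cap joins 1 and 2,
    and a single strand runs from \<open>Bot 0\<close> through 2, 1, 0 to
    \<open>Top 0\<close>.\<close>
  have arcs: "{p, q} \<in> arcs ?U \<longleftrightarrow> {p, q} = {Top 0, Top 1} \<or> {p, q} = {Bot 0, Top 2}" for p q
    unfolding arcs_cup_at by (simp add: skip_def numeral_2_eq_2)
  show "vcomp_diag ?A ?U = id_diag [b, r]"
  proof (rule diagram_eqI)
    fix p q
    show "{p, q} \<in> arcs (vcomp_diag ?A ?U) \<longleftrightarrow> {p, q} \<in> arcs (id_diag [b, r])"
      unfolding cap_at_linked[OF C'] joined_def arcs arcs_id doubleton_eq_iff
      by (cases p; cases q) (auto simp: skip_def split: if_splits)
  qed (auto intro: vcomp_doubleton simp: id_diag_def)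
  have "{Bot 0, Top 0} \<in> arcs ?A" "{Bot 1, Bot 2} \<in> arcs ?A"
  proof -
    have "{flip_point (Bot 0), flip_point (Top 0)} \<in> arcs (cup_at [b] r b [])"
      "{flip_point (Bot 1), flip_point (Bot 2)} \<in> arcs (cup_at [b] r b [])"
      unfolding arcs_cup_at by (auto simp: skip_def numeral_2_eq_2 insert_commute)
    then show "{Bot 0, Top 0} \<in> arcs ?A" "{Bot 1, Bot 2} \<in> arcs ?A"
      using arcs_flip[of _ _ "cup_at [b] r b []"] by auto
  qed
  note up = this[THEN linked_upper, of "?U"]
  have lo: "(MidN 1, MidN 0) \<in> ?L"
    using linked_lower[of "Top 1" "Top 0" "?U"] arcs by auto
  have tr: "trans (?L)"
    by (simp add: linked_glue trans_rtrancl)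
  have 0: "(MidN 0, outer (Top 0)) \<in> ?L" using up(1) by simp
  have 1: "(MidN 1, outer (Top 0)) \<in> ?L"
    using transD[OF tr lo 0] .
  have "(MidN 2, MidN 1) \<in> ?L"
    using symD[OF sym_linked up(2)] by simp
  then have 2: "(MidN 2, outer (Top 0)) \<in> ?L"
    using transD[OF tr _ 1] by blast
  show "circles ?A ?U = 0"
  proof (rule circles_zero)
    fix i assume "i < length (tgt ?U) - 1"
    then have "i = 0 \<or> i = 1 \<or> i = 2" by auto
    then show "\<exists>p. (MidN i, outer p) \<in> ?L"
      using 0 1 2 by blast
  qed
qed

text \<open>The two middle points are joined to each other by the cup and by the cap and reach no
  outer point; what remains is the matching without arcs.\<close>

lemma circle:
  assumes "one_mor S [b, r]"
  shows "vcomp_diag (cap_diag b r) (cup_diag b r) = id_diag [b]"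
    and "circles (cap_diag b r) (cup_diag b r) = 1"
proof -
  let ?A = "cap_diag b r" and ?U = "cup_diag b r"
  let ?L = "linked ?A ?U"
  have up: "{p, q} \<in> arcs ?A \<longleftrightarrow> p = Bot 0 \<and> q = Bot 1 \<or> p = Bot 1 \<and> q = Bot 0"
    and lo: "{p, q} \<in> arcs ?U \<longleftrightarrow> p = Top 0 \<and> q = Top 1 \<or> p = Top 1 \<and> q = Top 0" for p q
    by (auto simp: cap_diag_def cup_diag_def doubleton_eq_iff)
  have glue: "glue ?A ?U = {(MidN 0, MidN 1), (MidN 1, MidN 0)}"
  proof
    have "(upper (Bot 0), upper (Bot 1)) \<in> glue ?A ?U"
      "(upper (Bot 1), upper (Bot 0)) \<in> glue ?A ?U"
      unfolding glue_def using up by blast+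
    then show "{(MidN 0, MidN 1), (MidN 1, MidN 0)} \<subseteq> glue ?A ?U" by simp
  qed (auto simp: glue_def up lo)
  have L: "(glue ?A ?U)\<^sup>* = {(MidN 0, MidN 1), (MidN 1, MidN 0)} \<union> Id"
    (is "?R\<^sup>* = _")
  proof (intro equalityI subsetI)
    fix z assume "z \<in> ?R\<^sup>*"
    then obtain s t where z: "z = (s, t)" "(s, t) \<in> ?R\<^sup>*" by (cases z) blast
    from z(2) have "(s, t) \<in> {(MidN 0, MidN 1), (MidN 1, MidN 0)} \<union> Id"
      by (induction rule: rtrancl_induct) (auto simp: glue)
    then show "z \<in> {(MidN 0, MidN 1), (MidN 1, MidN 0)} \<union> Id" using z by simp
  qed (auto simp: glue)
  have no: "\<not> (p \<noteq> q \<and> (outer p, outer q) \<in> ?L)" for p q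
    unfolding linked_glue L by (cases p; cases q) auto
  show "vcomp_diag ?A ?U = id_diag [b]"
  proof (rule diagram_eqI)
    show "{p, q} \<in> arcs (vcomp_diag ?A ?U) \<longleftrightarrow> {p, q} \<in> arcs (id_diag [b])" for p q
      unfolding arcs_vcomp arcs_id using no by simp
  qed (auto intro: vcomp_doubleton simp: id_diag_def cap_diag_def cup_diag_def)
  have "{C. C \<subseteq> range MidN \<and> (\<exists>j < length (tgt ?U) - 1. C = ?L `` {MidN j})} =
    {{MidN 0, MidN 1}}"
  proof -
    have *: "?L `` {MidN j} = {MidN 0, MidN 1}" if "j < 2" for j
      using that unfolding linked_glue L by (auto simp: less_2_cases_iff)
    moreover have "length (tgt ?U) - 1 = 2" by (simp add: cup_diag_def)
    moreover have "\<exists>j<2::nat. {MidN 0, MidN 1} = ?L `` {MidN j}"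
      by (rule exI[of _ 0]) (simp add: *)
    ultimately show ?thesis by auto
  qed
  then show "circles ?A ?U = 1" by (simp add: circles_def)
qed

section \<open>Linear extension\<close>

abbreviation coeff :: "('c, 'k::comm_ring_1) two_mor \<Rightarrow> 'c diagram \<Rightarrow> 'k" where
  "coeff \<equiv> Poly_Mapping.lookup"

lemma lookup_scale [simp]: "coeff (scale a f) D = a * coeff f D"
  by (simp add: scale_def Poly_Mapping.map.rep_eq when_def)

lemma scale_add: "scale a (f + g) = scale a f + scale a g"
  by (rule poly_mapping_eqI) (simp add: lookup_add algebra_simps)

lemma scale_zero [simp]: "scale a 0 = 0" "scale 0 f = 0"
  by (rule poly_mapping_eqI, simp)+

lemma scale_scale [simp]: "scale a (scale b f) = scale (a * b) f"
  by (rule poly_mapping_eqI) (simp add: mult.assoc)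

lemma scale_one [simp]: "scale 1 f = f"
  by (rule poly_mapping_eqI) simp

lemma scale_add_left: "scale (a + b) f = scale a f + scale b f"
  by (rule poly_mapping_eqI) (simp add: lookup_add algebra_simps)

lemma scale_minus_left: "scale (- a) f = - scale a f"
  by (rule poly_mapping_eqI) simp

lemma single_eq_scale: "Poly_Mapping.single D a = scale a (of_diag D)"
  by (rule poly_mapping_eqI) (simp add: of_diag_def lookup_single when_def)

lemma lookup_of_diag: "coeff (of_diag D) E = (if D = E then 1 else 0)"
  by (simp add: of_diag_def lookup_single when_def)

lemma keys_of_diag [simp]: "Poly_Mapping.keys (of_diag D :: ('c, 'k::comm_ring_1) two_mor) = {D}"
  by (simp add: of_diag_def)

lemma keys_scale: "Poly_Mapping.keys (scale a f) \<subseteq> Poly_Mapping.keys f"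
  by (auto simp: in_keys_iff)

definition span :: "'c diagram set \<Rightarrow> ('c, 'k::comm_ring_1) two_mor set" where
  "span X = {f. Poly_Mapping.keys f \<subseteq> X}"

lemma Hom_span: "Hom S x y = span (diagrams S x y)"
  by (simp add: Hom_def span_def)

lemma span_zero [simp]: "0 \<in> span X"
  and span_add: "f \<in> span X \<Longrightarrow> g \<in> span X \<Longrightarrow> f + g \<in> span X"
  and span_scale: "f \<in> span X \<Longrightarrow> scale a f \<in> span X"
  and span_of_diag: "D \<in> X \<Longrightarrow> of_diag D \<in> span X"
  and span_mono: "X \<subseteq> Y \<Longrightarrow> span X \<subseteq> span Y"
  using Poly_Mapping.keys_add[of f g] keys_scale[of a f] by (auto simp: span_def)

lemma sum_keys: "f = (\<Sum>D\<in>Poly_Mapping.keys f. scale (coeff f D) (of_diag D))"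
proof (rule poly_mapping_eqI)
  fix D
  have "coeff (\<Sum>D\<in>Poly_Mapping.keys f. scale (coeff f D) (of_diag D)) D =
    (\<Sum>E\<in>Poly_Mapping.keys f. if D = E then coeff f E else 0)"
    unfolding lookup_sum by (rule sum.cong) (auto simp: lookup_of_diag)
  then show "coeff f D = coeff (\<Sum>D\<in>Poly_Mapping.keys f. scale (coeff f D) (of_diag D)) D"
    by (simp add: in_keys_iff)
qed

text \<open>Reduces identities that are linear in \<open>f\<close> to multiples of single diagrams;
  the laws for 2-morphisms are transferred from diagrams in this way.\<close>

lemma span_induct [consumes 1, case_names zero add diag]:
  assumes f: "f \<in> span X" and zero: "P 0"
    and add: "\<And>f g. f \<in> span X \<Longrightarrow> g \<in> span X \<Longrightarrow> P f \<Longrightarrow> P g \<Longrightarrow> P (f + g)"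
    and diag: "\<And>a D. D \<in> X \<Longrightarrow> P (scale a (of_diag D))"
  shows "P f"
proof -
  have "(\<Sum>D\<in>K. scale (coeff f D) (of_diag D)) \<in> span X \<and>
      P (\<Sum>D\<in>K. scale (coeff f D) (of_diag D))" if "finite K" "K \<subseteq> X" for K
    using that
  proof (induction K rule: finite_induct)
    case (insert D K)
    then show ?case by (auto intro!: add span_add span_scale span_of_diag diag)
  qed (simp add: zero)
  from this[of "Poly_Mapping.keys f"] f sum_keys[of f] show ?thesis by (auto simp: span_def)
qed

text \<open>Common form of the two compositions: \<open>c\<close> is composability, \<open>h\<close>
  the composite diagram and \<open>w\<close> its coefficient, a power of \<open>- \<delta>\<close>
  or 1. Bilinearity is then proved once for both.\<close>

definition bilinear_ext :: "('c diagram \<Rightarrow> 'c diagram \<Rightarrow> bool) \<Rightarrow> ('c diagram \<Rightarrow> 'c diagram \<Rightarrow> 'c diagram) \<Rightarrow>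
    ('c diagram \<Rightarrow> 'c diagram \<Rightarrow> 'k) \<Rightarrow> ('c, 'k::comm_ring_1) two_mor \<Rightarrow> ('c, 'k) two_mor \<Rightarrow> ('c, 'k) two_mor" where
  "bilinear_ext c h w f g = (\<Sum>D\<in>Poly_Mapping.keys f. \<Sum>E\<in>Poly_Mapping.keys g.
     if c D E then Poly_Mapping.single (h D E) (w D E * (coeff f D * coeff g E)) else 0)"

text \<open>Terms may cancel in \<open>f + f'\<close>, so its keys need not be the union of the
  keys. Summing over a larger common index set makes the sums comparable; the extra terms
  vanish.\<close>

lemma bilinear_ext_superset:
  assumes "finite X" "finite Y" "Poly_Mapping.keys f \<subseteq> X" "Poly_Mapping.keys g \<subseteq> Y"
  shows "bilinear_ext c h w f g = (\<Sum>D\<in>X. \<Sum>E\<in>Y.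
     if c D E then Poly_Mapping.single (h D E) (w D E * (coeff f D * coeff g E)) else 0)"
proof -
  have "bilinear_ext c h w f g = (\<Sum>D\<in>Poly_Mapping.keys f. \<Sum>E\<in>Y.
     if c D E then Poly_Mapping.single (h D E) (w D E * (coeff f D * coeff g E)) else 0)"
    unfolding bilinear_ext_def using assms
    by (intro sum.cong sum.mono_neutral_left) (auto simp: in_keys_iff)
  also have "\<dots> = (\<Sum>D\<in>X. \<Sum>E\<in>Y.
     if c D E then Poly_Mapping.single (h D E) (w D E * (coeff f D * coeff g E)) else 0)"
    using assms by (intro sum.mono_neutral_left) (auto simp: in_keys_iff intro!: sum.neutral)
  finally show ?thesis .
qed

lemma bilinear_ext_add_left: "bilinear_ext c h w (f + f') g = bilinear_ext c h w f g + bilinear_ext c h w f' g"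
proof -
  let ?X = "Poly_Mapping.keys f \<union> Poly_Mapping.keys f'"
  have k: "Poly_Mapping.keys (f + f') \<subseteq> ?X" by (rule Poly_Mapping.keys_add)
  show ?thesis
    unfolding bilinear_ext_superset[of ?X "Poly_Mapping.keys g" "f + f'" g, OF _ _ k, simplified]
      bilinear_ext_superset[of ?X "Poly_Mapping.keys g" f g, simplified]
      bilinear_ext_superset[of ?X "Poly_Mapping.keys g" f' g, simplified] sum.distrib[symmetric]
    by (intro sum.cong refl) (simp add: lookup_add algebra_simps single_add)
qed

lemma bilinear_ext_add_right: "bilinear_ext c h w f (g + g') = bilinear_ext c h w f g + bilinear_ext c h w f g'"
proof -
  let ?Y = "Poly_Mapping.keys g \<union> Poly_Mapping.keys g'"
  have k: "Poly_Mapping.keys (g + g') \<subseteq> ?Y" by (rule Poly_Mapping.keys_add)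
  show ?thesis
    unfolding bilinear_ext_superset[of "Poly_Mapping.keys f" ?Y f "g + g'", OF _ _ _ k, simplified]
      bilinear_ext_superset[of "Poly_Mapping.keys f" ?Y f g, simplified]
      bilinear_ext_superset[of "Poly_Mapping.keys f" ?Y f g', simplified] sum.distrib[symmetric]
    by (intro sum.cong refl) (simp add: lookup_add algebra_simps single_add)
qed

lemma scale_sum: "scale a (sum F K) = (\<Sum>k\<in>K. scale a (F k))"
  by (induction K rule: infinite_finite_induct) (simp_all add: scale_add)

lemma bilinear_ext_scale_left: "bilinear_ext c h w (scale a f) g = scale a (bilinear_ext c h w f g)"
  unfolding bilinear_ext_superset[of "Poly_Mapping.keys f" "Poly_Mapping.keys g" "scale a f" g, OF _ _ keys_scale, simplified]
    bilinear_ext_def[of c h w f g] scale_sum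
  by (intro sum.cong refl) (simp add: single_eq_scale ac_simps)

lemma bilinear_ext_scale_right: "bilinear_ext c h w f (scale a g) = scale a (bilinear_ext c h w f g)"
  unfolding bilinear_ext_superset[of "Poly_Mapping.keys f" "Poly_Mapping.keys g" f "scale a g", OF _ _ _ keys_scale, simplified]
    bilinear_ext_def[of c h w f g] scale_sum
  by (intro sum.cong refl) (simp add: single_eq_scale ac_simps)

lemma bilinear_ext_zero: "bilinear_ext c h w 0 g = 0" "bilinear_ext c h w f 0 = 0"
  by (simp_all add: bilinear_ext_def)

lemma bilinear_ext_of_diag: "bilinear_ext c h w (of_diag D) (of_diag E) =
    (if c D E then scale (w D E) (of_diag (h D E)) else 0)"
  by (simp add: bilinear_ext_def lookup_of_diag single_eq_scale)

lemma vcomp_bilinear_ext: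
  "vcomp \<delta> = bilinear_ext (\<lambda>D E. src D = tgt E) vcomp_diag (\<lambda>D E. (- \<delta>) ^ circles D E)"
  by (intro ext) (simp only: vcomp_def bilinear_ext_def)

lemma hcomp_bilinear_ext:
  "(\<otimes>) = bilinear_ext (\<lambda>D E. last (src D) = hd (src E)) hcomp_diag (\<lambda>D E. 1)"
  by (intro ext) (simp only: hcomp_def bilinear_ext_def mult_1_left)

lemma vcomp_linear:
  "vcomp \<delta> (f + f') g = vcomp \<delta> f g + vcomp \<delta> f' g"
  "vcomp \<delta> f (g + g') = vcomp \<delta> f g + vcomp \<delta> f g'"
  "vcomp \<delta> (scale a f) g = scale a (vcomp \<delta> f g)"
  "vcomp \<delta> f (scale a g) = scale a (vcomp \<delta> f g)"
  "vcomp \<delta> 0 g = 0" "vcomp \<delta> f 0 = 0"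
  unfolding vcomp_bilinear_ext
  by (rule bilinear_ext_add_left bilinear_ext_add_right bilinear_ext_scale_left bilinear_ext_scale_right bilinear_ext_zero)+

lemma hcomp_linear:
  "(f + f') \<otimes> g = f \<otimes> g + f' \<otimes> g" "f \<otimes> (g + g') = f \<otimes> g + f \<otimes> g'"
  "scale a f \<otimes> g = scale a (f \<otimes> g)" "f \<otimes> scale a g = scale a (f \<otimes> g)"
  "0 \<otimes> g = 0" "f \<otimes> 0 = 0"
  unfolding hcomp_bilinear_ext
  by (rule bilinear_ext_add_left bilinear_ext_add_right bilinear_ext_scale_left bilinear_ext_scale_right bilinear_ext_zero)+

lemma vcomp_of_diag: "src D = tgt E \<Longrightarrow>
    vcomp \<delta> (of_diag D) (of_diag E) = scale ((- \<delta>) ^ circles D E) (of_diag (vcomp_diag D E))"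
  by (simp add: vcomp_bilinear_ext bilinear_ext_of_diag)

lemma vcomp_of_diag_0: "src D \<noteq> tgt E \<Longrightarrow> vcomp \<delta> (of_diag D) (of_diag E) = 0"
  by (simp add: vcomp_bilinear_ext bilinear_ext_of_diag)

lemma hcomp_of_diag: "last (src D) = hd (src E) \<Longrightarrow> of_diag D \<otimes> of_diag E = of_diag (hcomp_diag D E)"
  by (simp add: hcomp_bilinear_ext bilinear_ext_of_diag)

lemma hcomp_of_diag_0: "last (src D) \<noteq> hd (src E) \<Longrightarrow> of_diag D \<otimes> of_diag E = 0"
  by (simp add: hcomp_bilinear_ext bilinear_ext_of_diag)

abbreviation wf_two_mor :: "('c, 'k::comm_ring_1) two_mor \<Rightarrow> bool" where
  "wf_two_mor f \<equiv> f \<in> span {D. wf_diag D}"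

lemma Hom_wf: "f \<in> Hom S x y \<Longrightarrow> wf_two_mor f"
  using span_mono[of "diagrams S x y" "{D. wf_diag D}"] diagrams_wf by (auto simp: Hom_span)

lemma bilinear_ext_span:
  assumes "f \<in> span X" "g \<in> span Y" "\<And>D E. D \<in> X \<Longrightarrow> E \<in> Y \<Longrightarrow> c D E \<Longrightarrow> h D E \<in> Z"
  shows "bilinear_ext c h w f g \<in> span Z"
  using assms(1)
proof (induction f rule: span_induct)
  case (diag a D)
  show ?case using assms(2)
  proof (induction g rule: span_induct)
    case (diag b E)
    then show ?case using \<open>D \<in> X\<close> assms(3)
      by (simp add: bilinear_ext_scale_left bilinear_ext_scale_right bilinear_ext_of_diag span_scale span_of_diag)
  qed (simp_all add: bilinear_ext_zero bilinear_ext_add_right span_add)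
qed (simp_all add: bilinear_ext_zero bilinear_ext_add_left span_add)

lemma wf_two_mor_vcomp: "wf_two_mor f \<Longrightarrow> wf_two_mor g \<Longrightarrow> wf_two_mor (vcomp \<delta> f g)"
  unfolding vcomp_bilinear_ext by (rule bilinear_ext_span) (auto intro: wf_vcomp)

lemma Hom_vcomp: "f \<in> Hom S y w \<Longrightarrow> g \<in> Hom S x y \<Longrightarrow> vcomp \<delta> f g \<in> Hom S x w"
  unfolding Hom_span vcomp_bilinear_ext by (rule bilinear_ext_span) (auto intro: vcomp_diagrams)

lemma Hom_hcomp: "f \<in> Hom S x y \<Longrightarrow> g \<in> Hom S x' y' \<Longrightarrow> last x = hd x' \<Longrightarrow>
    f \<otimes> g \<in> Hom S (x @ tl x') (y @ tl y')"
  unfolding Hom_span hcomp_bilinear_ext by (rule bilinear_ext_span) (auto intro: hcomp_diagrams)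

lemma vcomp_assoc:
  assumes "wf_two_mor f" "wf_two_mor g" "wf_two_mor h"
  shows "vcomp \<delta> (vcomp \<delta> f g) h = vcomp \<delta> f (vcomp \<delta> g h)"
  using assms(1)
proof (induction f rule: span_induct)
  case (diag a D)
  show ?case using assms(2)
  proof (induction g rule: span_induct)
    case (diag b E)
    show ?case using assms(3)
    proof (induction h rule: span_induct)
      case (diag d F)
      have wf: "wf_diag D" "wf_diag E" "wf_diag F"
        using \<open>D \<in> _\<close> \<open>E \<in> _\<close> \<open>F \<in> _\<close> by auto
      have "vcomp \<delta> (vcomp \<delta> (of_diag D) (of_diag E)) (of_diag F) =
          vcomp \<delta> (of_diag D) (vcomp \<delta> (of_diag E) (of_diag F))"
      proof (cases "src D = tgt E \<and> src E = tgt F")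
        case True
        then show ?thesis
          using vcomp_diag_assoc[OF wf, THEN sym]
          by (simp add: vcomp_of_diag vcomp_linear power_add[symmetric])
      next
        case False
        then show ?thesis
          by (cases "src D = tgt E"; cases "src E = tgt F")
            (simp_all add: vcomp_of_diag vcomp_of_diag_0 vcomp_linear)
      qed
      then show ?case by (simp add: vcomp_linear mult.assoc)
    qed (simp_all add: vcomp_linear)
  qed (simp_all add: vcomp_linear)
qed (simp_all add: vcomp_linear)

lemma id_vcomp_mor:
  assumes "f \<in> Hom S x y"
  shows "vcomp \<delta> (id_mor y) f = f"
  using assms unfolding Hom_span
proof (induction f rule: span_induct)
  case (diag a D)
  then show ?case using id_vcomp[OF diag] diagramsD(2)[OF diag] by (simp add: vcomp_linear vcomp_of_diag)
qed (simp_all add: vcomp_linear)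

lemma vcomp_id_mor:
  assumes "f \<in> Hom S x y"
  shows "vcomp \<delta> f (id_mor x) = f"
  using assms unfolding Hom_span
proof (induction f rule: span_induct)
  case (diag a D)
  then show ?case using vcomp_id[OF diag] diagramsD(1)[OF diag] by (simp add: vcomp_linear vcomp_of_diag)
qed (simp_all add: vcomp_linear)

lemma hcomp_assoc:
  assumes "wf_two_mor f" "wf_two_mor g" "wf_two_mor h"
  shows "(f \<otimes> g) \<otimes> h = f \<otimes> (g \<otimes> h)"
  using assms(1)
proof (induction f rule: span_induct)
  case (diag a D)
  show ?case using assms(2)
  proof (induction g rule: span_induct)
    case (diag b E)
    show ?case using assms(3)
    proof (induction h rule: span_induct)
      case (diag d F)
      have wf: "wf_diag D" "wf_diag E" "wf_diag F"
        using \<open>D \<in> _\<close> \<open>E \<in> _\<close> \<open>F \<in> _\<close> by auto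
      then have ne: "src D \<noteq> []" "src E \<noteq> []" "src F \<noteq> []" by (auto simp: wf_diag_def)
      have "(of_diag D \<otimes> of_diag E) \<otimes> of_diag F = (of_diag D \<otimes> (of_diag E \<otimes> of_diag F) :: ('a, 'b) two_mor)"
        using hcomp_diag_assoc[OF wf(1,2)] last_glued[OF ne(1,2)] ne
        by (cases "last (src D) = hd (src E)"; cases "last (src E) = hd (src F)")
          (simp_all add: hcomp_of_diag hcomp_of_diag_0 hcomp_linear)
      then show ?case by (simp add: hcomp_linear mult.assoc)
    qed (simp_all add: hcomp_linear)
  qed (simp_all add: hcomp_linear)
qed (simp_all add: hcomp_linear)

lemma interchange:
  assumes f: "f \<in> Hom S y w" and f': "f' \<in> Hom S x y" and g: "g \<in> Hom S y' w'" and g': "g' \<in> Hom S x' y'"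
    and eq: "last y = hd y'"
  shows "vcomp \<delta> (f \<otimes> g) (f' \<otimes> g') = vcomp \<delta> f f' \<otimes> vcomp \<delta> g g'"
  using f unfolding Hom_span
proof (induction f rule: span_induct)
  case (diag a D)
  show ?case using g unfolding Hom_span
  proof (induction g rule: span_induct)
    case (diag b D')
    show ?case using f' unfolding Hom_span
    proof (induction f' rule: span_induct)
      case (diag d E)
      show ?case using g' unfolding Hom_span
      proof (induction g' rule: span_induct)
        case (diag e E')
        note m = \<open>D \<in> _\<close> \<open>D' \<in> _\<close> \<open>E \<in> _\<close> \<open>E' \<in> _\<close>
        note wf = m[THEN diagrams_wf]
        note D = diagramsD[OF m(1)] and D' = diagramsD[OF m(2)] and E = diagramsD[OF m(3)] and E' = diagramsD[OF m(4)]
        have eq': "last x = hd x'" using E(7) E'(7) eq by (simp add: color_compatible_def)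
        have "vcomp \<delta> (of_diag D \<otimes> of_diag D') (of_diag E \<otimes> of_diag E') =
            vcomp \<delta> (of_diag D) (of_diag E) \<otimes> vcomp \<delta> (of_diag D') (of_diag E')"
          using interchange_diag[OF wf(1,3,2,4)] D(1) D'(1) E(1,2) E'(1,2) eq eq'
          by (simp add: vcomp_of_diag hcomp_of_diag hcomp_linear power_add mult.commute)
        then show ?case by (simp add: vcomp_linear hcomp_linear ac_simps)
      qed (simp_all add: vcomp_linear hcomp_linear scale_add)
    qed (simp_all add: vcomp_linear hcomp_linear scale_add)
  qed (simp_all add: vcomp_linear hcomp_linear scale_add)
qed (simp_all add: vcomp_linear hcomp_linear scale_add)

section \<open>Reflection of 2-morphisms\<close>

definition flip :: "('c, 'k::comm_ring_1) two_mor \<Rightarrow> ('c, 'k) two_mor" where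
  "flip f = Poly_Mapping.map_key flip_diag f"

lemma lookup_flip [simp]: "coeff (flip f) D = coeff f (flip_diag D)"
  by (simp add: flip_def Poly_Mapping.map_key.rep_eq inj_flip_diag)

lemma flip_add [simp]: "flip (f + g) = flip f + flip g"
  and flip_scale [simp]: "flip (scale a f) = scale a (flip f)"
  and flip_zero [simp]: "flip 0 = 0"
  and flip_flip [simp]: "flip (flip f) = f"
  by (rule poly_mapping_eqI, simp add: lookup_add)+

lemma flip_of_diag [simp]: "flip (of_diag D) = of_diag (flip_diag D)"
  by (rule poly_mapping_eqI) (auto simp: lookup_of_diag)

lemma flip_Hom:
  assumes "f \<in> Hom S x y"
  shows "flip f \<in> Hom S y x"
  using assms unfolding Hom_span
  by (induction f rule: span_induct) (simp_all add: span_add span_scale span_of_diag flip_diagrams)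

lemma flip_vcomp:
  assumes "wf_two_mor f" "wf_two_mor g"
  shows "flip (vcomp \<delta> f g) = vcomp \<delta> (flip g) (flip f)"
  using assms(1)
proof (induction f rule: span_induct)
  case (diag a D)
  show ?case using assms(2)
  proof (induction g rule: span_induct)
    case (diag b E)
    have wf: "wf_diag D" "wf_diag E" using \<open>D \<in> _\<close> \<open>E \<in> _\<close> by auto
    have "flip (vcomp \<delta> (of_diag D) (of_diag E)) = vcomp \<delta> (flip (of_diag E)) (flip (of_diag D))"
      using circles_flip[OF wf]
      by (cases "src D = tgt E") (simp_all add: vcomp_of_diag vcomp_of_diag_0 flip_vcomp_diag)
    then show ?case by (simp add: vcomp_linear mult.commute)
  qed (simp_all add: vcomp_linear scale_add)
qed (simp_all add: vcomp_linear)

section \<open>Top idempotents\<close>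

lemma cups_iff: "c \<in> cups x \<longleftrightarrow> (\<exists>u b r v. x = u @ b # r # b # v \<and> c = cup_at u b r v)"
  by (auto simp: cups_def cup_at_def)

lemma B_iff: "f \<in> B S \<delta> x \<longleftrightarrow> f \<in> Hom S x x \<and>
    (\<forall>u b r v. x = u @ b # r # b # v \<longrightarrow> vcomp \<delta> f (of_diag (cup_at u b r v)) = 0)"
  unfolding B_def Ball_def cups_iff by blast

lemma Hom_of_diag: "D \<in> diagrams S x y \<Longrightarrow> of_diag D \<in> Hom S x y"
  unfolding Hom_span by (rule span_of_diag)

lemma Hom_id: "one_mor S x \<Longrightarrow> id_mor x \<in> Hom S x x"
  by (intro Hom_of_diag id_diag_diagrams)

lemma Hom_zero: "0 \<in> Hom S x y"
  and Hom_add: "f \<in> Hom S x y \<Longrightarrow> g \<in> Hom S x y \<Longrightarrow> f + g \<in> Hom S x y"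
  and Hom_scale: "f \<in> Hom S x y \<Longrightarrow> scale a f \<in> Hom S x y"
  unfolding Hom_span by (auto intro: span_add span_scale)

text \<open>Stacking a cup creates no circle, so the factorization of diagrams holds with
  coefficient 1 for every \<open>\<delta>\<close>.\<close>

lemma cup_factor_mor:
  assumes D: "D \<in> diagrams S x y" and len: "length x \<le> length y" and ne: "D \<noteq> id_diag x"
  obtains u b r v D' where "y = u @ b # r # b # v" "D' \<in> diagrams S x (u @ b # v)"
    "of_diag D = vcomp \<delta> (of_diag (cup_at u b r v)) (of_diag D')"
proof -
  obtain u b r v D' where *: "y = u @ b # r # b # v" "D' \<in> diagrams S x (u @ b # v)"
    "D = vcomp_diag (cup_at u b r v) D'"
    using cup_factor[OF D len ne] by metis
  have "of_diag D = vcomp \<delta> (of_diag (cup_at u b r v)) (of_diag D')"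
    using diagramsD(2)[OF *(2)] cup_at_vcomp(2)[OF *(2)] *(3) by (simp add: vcomp_of_diag)
  then show thesis using that * by blast
qed

lemma cap_factor_mor:
  assumes D: "D \<in> diagrams S x y" and len: "length y \<le> length x" and ne: "D \<noteq> id_diag y"
  obtains u b r v D' where "x = u @ b # r # b # v" "D' \<in> diagrams S (u @ b # v) y"
    "of_diag D = vcomp \<delta> (of_diag D') (of_diag (cap_at u b r v))"
proof -
  have "flip_diag D \<noteq> id_diag y" using ne by (metis flip_diag_flip_diag flip_id)
  from cup_factor_mor[OF flip_diagrams[OF D] len this, where \<delta> = \<delta>]
  obtain u b r v E where E: "x = u @ b # r # b # v" "E \<in> diagrams S y (u @ b # v)"
    "of_diag (flip_diag D) = vcomp \<delta> (of_diag (cup_at u b r v)) (of_diag E)" .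
  have one: "one_mor S (u @ b # r # b # v)" using diagramsD(3)[OF D] E(1) by simp
  have "of_diag D = flip (vcomp \<delta> (of_diag (cup_at u b r v)) (of_diag E))"
    using E(3) by (metis flip_of_diag flip_flip)
  also have "\<dots> = vcomp \<delta> (of_diag (flip_diag E)) (of_diag (cap_at u b r v))"
    using flip_vcomp[OF Hom_wf[OF Hom_of_diag[OF cup_at_diagrams[OF one]]] Hom_wf[OF Hom_of_diag[OF E(2)]], of \<delta>]
    by simp
  finally show thesis using that E flip_diagrams[OF E(2)] by blast
qed

lemma B_vcomp:
  assumes f: "f \<in> B S \<delta> x" and g: "g \<in> Hom S x x"
  shows "vcomp \<delta> f g = scale (coeff g (id_diag x)) f"
  using g unfolding Hom_span
proof (induction g rule: span_induct)
  case (diag a D)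
  have fH: "f \<in> Hom S x x" using f by (simp add: B_iff)
  show ?case
  proof (cases "D = id_diag x")
    case True
    then show ?thesis by (simp add: vcomp_linear vcomp_id_mor[OF fH] lookup_of_diag)
  next
    case False
    from cup_factor_mor[OF diag order_refl False, where \<delta> = \<delta>]
    obtain u b r v D' where x: "x = u @ b # r # b # v" and D': "D' \<in> diagrams S x (u @ b # v)"
      and D: "of_diag D = vcomp \<delta> (of_diag (cup_at u b r v)) (of_diag D')" .
    have one: "one_mor S (u @ b # r # b # v)" using diagramsD(3)[OF diag] x by simp
    have "vcomp \<delta> f (of_diag D) = vcomp \<delta> (vcomp \<delta> f (of_diag (cup_at u b r v))) (of_diag D')"
      unfolding D
      by (rule vcomp_assoc[symmetric]) (intro Hom_wf[OF fH] Hom_wf[OF Hom_of_diag[OF D']]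
        Hom_wf[OF Hom_of_diag[OF cup_at_diagrams[OF one]]])+
    also have "vcomp \<delta> f (of_diag (cup_at u b r v)) = 0" using f x by (simp add: B_iff)
    finally show ?thesis using False by (simp add: vcomp_linear lookup_of_diag)
  qed
qed (simp_all add: vcomp_linear lookup_add scale_add_left)

lemma B_eq:
  assumes f: "f \<in> B S \<delta> x" "coeff f (id_diag x) = 1"
    and g: "g \<in> B S \<delta> x" "coeff g (id_diag x) = 1"
  shows "flip g = f"
proof -
  have H: "f \<in> Hom S x x" "g \<in> Hom S x x" using f g by (auto simp: B_iff)
  have "vcomp \<delta> g (flip f) = g"
    using B_vcomp[OF g(1) flip_Hom[OF H(1)]] f(2) by simp
  then have "flip g = flip (vcomp \<delta> g (flip f))" by simp
  also have "\<dots> = vcomp \<delta> f (flip g)"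
    using flip_vcomp[OF Hom_wf[OF H(2)] Hom_wf[OF flip_Hom[OF H(1)]]] by simp
  also have "\<dots> = f"
    using B_vcomp[OF f(1) flip_Hom[OF H(2)]] g(2) by simp
  finally show ?thesis .
qed

lemma JW_eqI:
  assumes "f \<in> B S \<delta> x" "coeff f (id_diag x) = 1"
  shows "JW S \<delta> x = f" "JW_exists S \<delta> x"
proof -
  \<comment> \<open>\<open>B_eq\<close> also applies to the pair \<open>g\<close>, \<open>g\<close>
    and shows that \<open>g\<close> is invariant under reflection, which turns
    \<open>flip g = f\<close> into \<open>g = f\<close>.\<close>
  have "g = f" if "g \<in> B S \<delta> x \<and> coeff g (id_diag x) = 1" for g
    using B_eq[OF assms, of g] B_eq[of g S \<delta> x g] that by simp
  then show "JW S \<delta> x = f" unfolding JW_def using assms by (intro the_equality conjI)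
  show "JW_exists S \<delta> x" unfolding JW_exists_def using assms by (intro bexI[of _ f]) simp_all
qed

lemma
  assumes "JW_exists S \<delta> x"
  shows JW_B: "JW S \<delta> x \<in> B S \<delta> x" and lookup_JW: "coeff (JW S \<delta> x) (id_diag x) = 1"
proof -
  obtain f a where f: "f \<in> B S \<delta> x" "1 = coeff f (id_diag x) * a"
    using assms by (auto simp: JW_exists_def dvd_def)
  have 1: "scale a f \<in> B S \<delta> x" using f(1) by (simp add: B_iff Hom_scale vcomp_linear)
  have 2: "coeff (scale a f) (id_diag x) = 1" using f(2) by (simp add: mult.commute)
  show "JW S \<delta> x \<in> B S \<delta> x" "coeff (JW S \<delta> x) (id_diag x) = 1"
    unfolding JW_eqI(1)[OF 1 2] using 1 2 .
qed

lemma JW_Hom: "JW_exists S \<delta> x \<Longrightarrow> JW S \<delta> x \<in> Hom S x x"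
  using JW_B by (auto simp: B_iff)

lemma flip_JW: "JW_exists S \<delta> x \<Longrightarrow> flip (JW S \<delta> x) = JW S \<delta> x"
  by (rule B_eq[OF JW_B lookup_JW JW_B lookup_JW])

lemma JW_vcomp: "JW_exists S \<delta> x \<Longrightarrow> g \<in> Hom S x x \<Longrightarrow>
    vcomp \<delta> (JW S \<delta> x) g = scale (coeff g (id_diag x)) (JW S \<delta> x)"
  by (rule B_vcomp[OF JW_B])

lemma JW_idem: "JW_exists S \<delta> x \<Longrightarrow> vcomp \<delta> (JW S \<delta> x) (JW S \<delta> x) = JW S \<delta> x"
  by (simp add: JW_vcomp JW_Hom lookup_JW)

lemma JW_cup: "JW_exists S \<delta> (u @ b # r # b # v) \<Longrightarrow>
    vcomp \<delta> (JW S \<delta> (u @ b # r # b # v)) (of_diag (cup_at u b r v)) = 0"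
  using JW_B[of S \<delta> "u @ b # r # b # v"] by (simp add: B_iff)

lemma cap_JW:
  assumes "JW_exists S \<delta> (u @ b # r # b # v)" "one_mor S (u @ b # r # b # v)"
  shows "vcomp \<delta> (of_diag (cap_at u b r v)) (JW S \<delta> (u @ b # r # b # v)) = 0"
proof -
  let ?J = "JW S \<delta> (u @ b # r # b # v)"
  have "flip (vcomp \<delta> ?J (of_diag (cup_at u b r v))) = vcomp \<delta> (of_diag (cap_at u b r v)) ?J"
    using flip_vcomp[OF Hom_wf[OF JW_Hom[OF assms(1)]] Hom_wf[OF Hom_of_diag[OF cup_at_diagrams[OF assms(2)]]], of \<delta>]
    by (simp add: flip_JW[OF assms(1)])
  then show ?thesis using JW_cup[OF assms(1)] by simp
qed

text \<open>A cup needs a target of at least three colors, so the condition defining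
  \<open>B\<close> is vacuous here.\<close>

lemma JW_short:
  assumes "one_mor S x" "length x \<le> 2"
  shows "JW_exists S \<delta> x" "JW S \<delta> x = id_mor x"
proof -
  have "id_mor x \<in> B S \<delta> x" using assms by (auto simp: B_iff Hom_id)
  moreover have "coeff (id_mor x) (id_diag x) = (1::'b)" by (simp add: lookup_of_diag)
  ultimately show "JW_exists S \<delta> x" "JW S \<delta> x = id_mor x" using JW_eqI by blast+
qed

section \<open>Adding a strand on the right\<close>

lemma hcomp_strand_eq_id:
  assumes D: "D \<in> diagrams S x x" and b: "last x = b"
  shows "hcomp_diag D (id_diag [b, g]) = id_diag (x @ [g]) \<longleftrightarrow> D = id_diag x"
proof
  note D' = diagramsD[OF D]
  assume eq: "hcomp_diag D (id_diag [b, g]) = id_diag (x @ [g])"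
  show "D = id_diag x"
  proof (rule diagram_eqI)
    fix p q
    have "{p, q} \<in> arcs (id_diag (x @ [g])) \<longleftrightarrow> {p, q} \<in> arcs D \<or>
      (\<exists>p' q'. p = shift (length x - 1) (length x - 1) p' \<and> q = shift (length x - 1) (length x - 1) q' \<and>
         {p', q'} \<in> arcs (id_diag [b, g]))"
      unfolding eq[symmetric] arcs_hcomp by (simp add: D'(1,2))
    moreover have "p \<in> points x x" if "{p, q} \<in> arcs D"
      using that matchingD(1)[OF D'(5)] by blast
    ultimately show "{p, q} \<in> arcs D \<longleftrightarrow> {p, q} \<in> arcs (id_diag x)"
      unfolding arcs_id by auto
  qed (use D' in \<open>auto intro: diagrams_doubleton[OF D] simp: id_diag_def\<close>)
next
  assume "D = id_diag x"
  then show "hcomp_diag D (id_diag [b, g]) = id_diag (x @ [g])"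
    using hcomp_id_id[of x "[b, g]"] diagramsD(8)[OF D] by simp
qed

text \<open>A diagram with an added strand is the identity only if it was the identity before, so no
  other term of \<open>f\<close> contributes.\<close>

lemma lookup_strand:
  assumes f: "f \<in> Hom S x x" and b: "last x = b"
  shows "coeff (f \<otimes> id_mor [b, g]) (id_diag (x @ [g])) = coeff f (id_diag x)"
  using f unfolding Hom_span
proof (induction f rule: span_induct)
  case (diag a D)
  then show ?case using hcomp_strand_eq_id[OF diag b] diagramsD(1)[OF diag] b
    by (simp add: hcomp_linear hcomp_of_diag lookup_of_diag)
qed (simp_all add: hcomp_linear lookup_add)

lemma Hom_strand:
  assumes "f \<in> Hom S x y" "last x = b" "one_mor S [b, g]"
  shows "f \<otimes> id_mor [b, g] \<in> Hom S (x @ [g]) (y @ [g])"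
  using Hom_hcomp[OF assms(1) Hom_id[OF assms(3)]] assms(2) by simp

lemma vcomp_strand:
  assumes "f \<in> Hom S y w" "g \<in> Hom S x y" "last y = b" "one_mor S [b, c]"
  shows "vcomp \<delta> (f \<otimes> id_mor [b, c]) (g \<otimes> id_mor [b, c]) = vcomp \<delta> f g \<otimes> id_mor [b, c]"
  using interchange[OF assms(1,2) Hom_id[OF assms(4)] Hom_id[OF assms(4)], of \<delta>] assms(3)
    vcomp_id_mor[OF Hom_id[OF assms(4)], of \<delta>] by simp

lemma one_mor_cup: "one_mor S (u @ b # r # b # v) \<Longrightarrow> b \<in> S \<and> r \<in> S \<and> b \<noteq> r"
  by (auto simp: one_mor_def distinct_adj_append_iff)

lemma wf_cup_diag: "wf_diag (cup_diag b r)" "wf_diag (cap_diag b r)"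
  by (auto simp: wf_diag_def cup_diag_def cap_diag_def points_def numeral_2_eq_2)

text \<open>The added strand belongs to the identity on the right of the cup or cap, and
  associativity of concatenation splits it off.\<close>

lemma cup_at_strand:
  assumes "last (b # v) = c"
  shows "of_diag (cup_at u b r (v @ [g])) = of_diag (cup_at u b r v) \<otimes> id_mor [c, g]"
    and "of_diag (cap_at u b r (v @ [g])) = of_diag (cap_at u b r v) \<otimes> id_mor [c, g]"
proof -
  have id: "id_diag (b # v @ [g]) = hcomp_diag (id_diag (b # v)) (id_diag [c, g])"
    using hcomp_id_id[of "b # v" "[c, g]"] by simp
  have w: "wf_diag (hcomp_diag (id_diag (u @ [b])) (cup_diag b r))"
    "wf_diag (hcomp_diag (id_diag (u @ [b])) (cap_diag b r))" "wf_diag (id_diag (b # v))"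
    by (auto intro!: wf_hcomp wf_id_diag wf_cup_diag)
  have c: "last (src (cup_at u b r v)) = c" "last (src (cap_at u b r v)) = c"
    using assms by (auto split: if_splits)
  show "of_diag (cup_at u b r (v @ [g])) = of_diag (cup_at u b r v) \<otimes> id_mor [c, g]"
    using c(1) by (subst hcomp_of_diag) (simp_all add: cup_at_def id hcomp_diag_assoc[OF w(1,3)])
  show "of_diag (cap_at u b r (v @ [g])) = of_diag (cap_at u b r v) \<otimes> id_mor [c, g]"
    using c(2) by (subst hcomp_of_diag) (simp_all add: cap_at_def id hcomp_diag_assoc[OF w(2,3)])
qed

text \<open>A cup on the longer line either ends at the new last point, which forces
  \<open>g\<close> to repeat the last color but one of \<open>x\<close>, or is a cup of
  \<open>x\<close> with a strand added. Only the first kind is not already killed by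
  \<open>JW(x)\<close> with a strand.\<close>

lemma snoc_cup_cases:
  assumes "x @ [g] = u @ b # r # b # v"
  obtains "v = []" "x = u @ [b, r]" "g = b"
  | v' where "v = v' @ [g]" "x = u @ b # r # b # v'" "last (b # v') = last x"
proof (cases v rule: rev_cases)
  case Nil
  then have "x @ [g] = (u @ [b, r]) @ [b]" using assms by simp
  then show ?thesis using that(1) Nil by blast
next
  case (snoc v' h)
  then have "x @ [g] = (u @ b # r # b # v') @ [h]" using assms by simp
  then have "g = h" "x = u @ b # r # b # v'" by auto
  then show ?thesis using that(2) snoc by simp
qed

lemma JW_strand_cup:
  assumes J: "JW_exists S \<delta> x" and x: "x = u @ b # r # b # v" and one: "one_mor S x"
    and c: "one_mor S [last x, g]"
  shows "vcomp \<delta> (JW S \<delta> x \<otimes> id_mor [last x, g]) (of_diag (cup_at u b r (v @ [g]))) = 0"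
    and "vcomp \<delta> (of_diag (cap_at u b r (v @ [g]))) (JW S \<delta> x \<otimes> id_mor [last x, g]) = 0"
proof -
  have l: "last (b # v) = last x" "last (u @ b # v) = last x" using x by auto
  note H = JW_Hom[OF J] Hom_of_diag[OF cup_at_diagrams[OF one[unfolded x]], folded x]
    Hom_of_diag[OF cap_at_diagrams[OF one[unfolded x]], folded x]
  show "vcomp \<delta> (JW S \<delta> x \<otimes> id_mor [last x, g]) (of_diag (cup_at u b r (v @ [g]))) = 0"
    unfolding cup_at_strand(1)[OF l(1)] using vcomp_strand[OF H(1,2) refl c, of \<delta>] JW_cup[OF J[unfolded x]] x
    by (simp add: hcomp_linear)
  show "vcomp \<delta> (of_diag (cap_at u b r (v @ [g]))) (JW S \<delta> x \<otimes> id_mor [last x, g]) = 0"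
    unfolding cup_at_strand(2)[OF l(1)] using vcomp_strand[OF H(3,1) refl c, of \<delta>] cap_JW[OF J[unfolded x] one[unfolded x]] x
    by (simp add: hcomp_linear)
qed

text \<open>A cup at the far right would need \<open>g = r\<close>, and all other cups are killed by
  \<open>JW S \<delta> x\<close> itself, so no correction term arises.\<close>

lemma JW_new_color:
  assumes J: "JW_exists S \<delta> x" and x: "x = u @ [r, b]" and one: "one_mor S x"
    and g: "g \<in> S" "g \<noteq> r" "g \<noteq> b"
  shows "JW_exists S \<delta> (x @ [g])" "JW S \<delta> (x @ [g]) = JW S \<delta> x \<otimes> id_mor [b, g]"
proof -
  have b: "last x = b" using x by simp
  have c: "one_mor S [last x, g]" using one g x by (auto simp: one_mor_def)
  let ?f = "JW S \<delta> x \<otimes> id_mor [b, g]"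
  have "vcomp \<delta> ?f (of_diag (cup_at u' b' r' v)) = 0" if eq: "x @ [g] = u' @ b' # r' # b' # v" for u' b' r' v
    using eq
  proof (cases rule: snoc_cup_cases)
    case 1
    then show ?thesis using x g by auto
  next
    case (2 v')
    then show ?thesis using JW_strand_cup(1)[OF J 2(2) one c] b by simp
  qed
  then have "?f \<in> B S \<delta> (x @ [g])"
    using Hom_strand[OF JW_Hom[OF J] b] c b unfolding B_iff by auto
  moreover have "coeff ?f (id_diag (x @ [g])) = 1"
    using lookup_strand[OF JW_Hom[OF J] b] lookup_JW[OF J] by simp
  ultimately show "JW_exists S \<delta> (x @ [g])" "JW S \<delta> (x @ [g]) = ?f"
    using JW_eqI by blast+
qed

text \<open>Every diagram occurring in the composite contains the arc of the cup.\<close>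

lemma lookup_cup_vcomp:
  assumes f: "f \<in> Hom S w (u @ b # v)" and K: "{Top (length u), Top (Suc (length u))} \<notin> arcs K"
  shows "coeff (vcomp \<delta> (of_diag (cup_at u b r v)) f) K = 0"
  using f unfolding Hom_span
proof (induction f rule: span_induct)
  case (diag a D)
  have "vcomp_diag (cup_at u b r v) D \<noteq> K"
    using cup_at_vcomp(1)[OF diag, of r] K by (auto simp: add_cup_def)
  then show ?case using diagramsD(2)[OF diag] by (simp add: vcomp_linear vcomp_of_diag lookup_of_diag)
qed (simp_all add: vcomp_linear lookup_add)

text \<open>A diagram to a longer line splits off a cup at its top, and an identity has no arc
  between two top points. This shows that the correction term of the recursion does not change the
  coefficient of the identity.\<close>

lemma lookup_id_vcomp_shorter:
  assumes f: "f \<in> Hom S y x" and g: "g \<in> Hom S x y" and len: "length y < length x"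
  shows "coeff (vcomp \<delta> f g) (id_diag x) = 0"
  using f unfolding Hom_span
proof (induction f rule: span_induct)
  case (diag a D)
  have "D \<noteq> id_diag y" using diagramsD(2)[OF diag] len by auto
  from cup_factor_mor[OF diag less_imp_le[OF len] this, where \<delta> = \<delta>]
  obtain u b r v D' where x: "x = u @ b # r # b # v" and D': "D' \<in> diagrams S y (u @ b # v)"
    and D: "of_diag D = vcomp \<delta> (of_diag (cup_at u b r v)) (of_diag D')" .
  have one: "one_mor S (u @ b # r # b # v)" using diagramsD(4)[OF diag] x by simp
  have "vcomp \<delta> (of_diag D) g = vcomp \<delta> (of_diag (cup_at u b r v)) (vcomp \<delta> (of_diag D') g)"
    unfolding D by (rule vcomp_assoc)
      (intro Hom_wf[OF g] Hom_wf[OF Hom_of_diag[OF D']] Hom_wf[OF Hom_of_diag[OF cup_at_diagrams[OF one]]])+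
  moreover have "coeff \<dots> (id_diag x) = 0"
    using Hom_vcomp[OF Hom_of_diag[OF D'] g] by (intro lookup_cup_vcomp) (auto simp: arcs_id)
  ultimately show ?case by (simp add: vcomp_linear)
qed (simp_all add: vcomp_linear lookup_add)

lemma hcomp_id_mor:
  assumes "f \<in> Hom S x y" "last x = c"
  shows "f \<otimes> id_mor [c] = f"
  using assms(1) unfolding Hom_span
proof (induction f rule: span_induct)
  case (diag a D)
  then show ?case using hcomp_id_right[OF diagrams_wf[OF diag]] diagramsD(1)[OF diag] assms(2)
    by (simp add: hcomp_linear hcomp_of_diag)
qed (simp_all add: hcomp_linear)

lemma id_hcomp_id: "x \<noteq> [] \<Longrightarrow> y \<noteq> [] \<Longrightarrow> last x = hd y \<Longrightarrow> id_mor x \<otimes> id_mor y = id_mor (x @ tl y)"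
  by (simp add: hcomp_of_diag hcomp_id_id)

section \<open>The recursion\<close>

text \<open>Translates the cup and the cap of the theorem, written as concatenations, into the form
  whose arcs were computed.\<close>

lemma cup_last: "id_mor (u @ [r]) \<otimes> of_diag (cup_diag r b) = of_diag (cup_at u r b [])"
  and cap_last: "id_mor (u @ [r]) \<otimes> of_diag (cap_diag r b) = of_diag (cap_at u r b [])"
proof -
  have wf: "wf_diag (hcomp_diag (id_diag (u @ [r])) (cup_diag r b))"
    "wf_diag (hcomp_diag (id_diag (u @ [r])) (cap_diag r b))"
    by (auto intro!: wf_hcomp wf_id_diag wf_cup_diag)
  show "id_mor (u @ [r]) \<otimes> of_diag (cup_diag r b) = of_diag (cup_at u r b [])"
    unfolding cup_at_def hcomp_id_right[OF wf(1)] by (rule hcomp_of_diag) (simp add: cup_diag_def)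
  show "id_mor (u @ [r]) \<otimes> of_diag (cap_diag r b) = of_diag (cap_at u r b [])"
    unfolding cap_at_def hcomp_id_right[OF wf(2)] by (rule hcomp_of_diag) (simp add: cap_diag_def)
qed

lemma cap_diag_diagrams:
  assumes "b \<in> S" "r \<in> S" "b \<noteq> r"
  shows "cap_diag b r \<in> diagrams S [b, r, b] [b]"
  using flip_diagrams[OF cup_diag_diagrams[OF assms]] by (simp add: flip_cup_diag)

text \<open>\<open>Z\<close> acts only on strands to the left of the cup or cap, so either order
  gives \<open>Z\<close> placed beside it; when cup and cap meet, the circle contributes
  \<open>- \<delta>\<close>.\<close>

lemma slide:
  assumes one: "one_mor S (u @ [r, b, r])" and Z: "Z \<in> Hom S (u @ [r]) (u @ [r])"
  shows "vcomp \<delta> (of_diag (cup_at u r b [])) Z = vcomp \<delta> (Z \<otimes> id_mor [r, b, r]) (of_diag (cup_at u r b []))"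
    and "vcomp \<delta> Z (of_diag (cap_at u r b [])) = vcomp \<delta> (of_diag (cap_at u r b [])) (Z \<otimes> id_mor [r, b, r])"
    and "vcomp \<delta> (of_diag (cap_at u r b [])) (vcomp \<delta> (Z \<otimes> id_mor [r, b, r]) (of_diag (cup_at u r b []))) = scale (- \<delta>) Z"
proof -
  have S: "r \<in> S" "b \<in> S" "r \<noteq> b" using one_mor_cup[of S u r b "[]"] one by auto
  have o: "one_mor S [r]" "one_mor S [r, b, r]" "one_mor S (u @ [r])" "one_mor S [r, b]"
    using one by (auto simp: one_mor_def distinct_adj_append_iff)
  let ?c = "of_diag (cup_diag r b) :: ('a, 'b) two_mor" and ?a = "of_diag (cap_diag r b) :: ('a, 'b) two_mor"
  have c: "?c \<in> Hom S [r] [r, b, r]" and a: "?a \<in> Hom S [r, b, r] [r]"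
    using cup_diag_diagrams[OF S] cap_diag_diagrams[OF S] by (auto intro: Hom_of_diag)
  note id1 = Hom_id[OF o(1)] and id3 = Hom_id[OF o(2)] and idz = Hom_id[OF o(3)]
  have Z1: "Z \<otimes> id_mor [r] = Z" using hcomp_id_mor[OF Z] by simp
  have l: "last (u @ [r]) = hd [r]" "last (u @ [r]) = hd [r, b, r]" by simp_all
  have cup: "vcomp \<delta> (of_diag (cup_at u r b [])) Z = Z \<otimes> ?c"
    using interchange[OF idz Z c id1 l(1), of \<delta>]
    by (simp add: cup_last Z1 id_vcomp_mor[OF Z] vcomp_id_mor[OF c])
  have cap: "vcomp \<delta> Z (of_diag (cap_at u r b [])) = Z \<otimes> ?a"
    using interchange[OF Z idz id1 a l(1), of \<delta>]
    by (simp add: cap_last Z1 vcomp_id_mor[OF Z] id_vcomp_mor[OF a])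
  have cup': "vcomp \<delta> (Z \<otimes> id_mor [r, b, r]) (of_diag (cup_at u r b [])) = Z \<otimes> ?c"
    using interchange[OF Z idz id3 c l(2), of \<delta>]
    by (simp add: cup_last vcomp_id_mor[OF Z] id_vcomp_mor[OF c])
  have cap': "vcomp \<delta> (of_diag (cap_at u r b [])) (Z \<otimes> id_mor [r, b, r]) = Z \<otimes> ?a"
    using interchange[OF idz Z a id3 l(2), of \<delta>]
    by (simp add: cap_last id_vcomp_mor[OF Z] vcomp_id_mor[OF a])
  show "vcomp \<delta> (of_diag (cup_at u r b [])) Z = vcomp \<delta> (Z \<otimes> id_mor [r, b, r]) (of_diag (cup_at u r b []))"
    unfolding cup cup' ..
  show "vcomp \<delta> Z (of_diag (cap_at u r b [])) = vcomp \<delta> (of_diag (cap_at u r b [])) (Z \<otimes> id_mor [r, b, r])"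
    unfolding cap cap' ..
  have "vcomp \<delta> ?a ?c = scale (- \<delta>) (id_mor [r])"
    using circle[OF o(4)] by (simp add: vcomp_of_diag cap_diag_def cup_diag_def)
  then show "vcomp \<delta> (of_diag (cap_at u r b [])) (vcomp \<delta> (Z \<otimes> id_mor [r, b, r]) (of_diag (cup_at u r b []))) = scale (- \<delta>) Z"
    unfolding cup' using interchange[OF idz Z a c l(2), of \<delta>]
    by (simp add: cap_last id_vcomp_mor[OF Z] hcomp_linear Z1)
qed

text \<open>The local zigzag with strands added on the left; the second equation is the reflection
  of the first.\<close>

lemma zigzag_mor:
  assumes one: "one_mor S (w @ [b, r, b])"
  shows "vcomp \<delta> (of_diag (cap_at (w @ [b]) r b [])) (of_diag (cup_at w b r [r])) = id_mor (w @ [b, r])"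
    and "vcomp \<delta> (of_diag (cap_at w b r [r])) (of_diag (cup_at (w @ [b]) r b [])) = id_mor (w @ [b, r])"
proof -
  have o: "one_mor S [b, r]" "one_mor S (w @ [b])" "one_mor S (w @ [b, r])"
    "one_mor S (w @ b # r # b # [r])" "one_mor S ((w @ [b]) @ r # b # r # [])"
    "one_mor S ([] @ b # r # b # [r])" "one_mor S ([b] @ r # b # r # [])"
    using one by (auto simp: one_mor_def distinct_adj_append_iff)
  have wf: "wf_diag (id_diag (w @ [b]))" "wf_diag (id_diag [b, r])" "wf_diag (cap_diag r b)"
    "wf_diag (hcomp_diag (id_diag [b, r]) (cap_diag r b))" "wf_diag (id_diag [b])" "wf_diag (cup_diag b r)"
    "wf_diag (hcomp_diag (id_diag [b]) (cup_diag b r))"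
    by (auto intro!: wf_hcomp wf_id_diag wf_cup_diag)
  have id: "id_diag (w @ [b, r]) = hcomp_diag (id_diag (w @ [b])) (id_diag [b, r])"
    "id_diag (w @ [b]) = hcomp_diag (id_diag (w @ [b])) (id_diag [b])"
    using hcomp_id_id[of "w @ [b]" "[b, r]"] hcomp_id_id[of "w @ [b]" "[b]"] by simp_all
  have cap: "cap_at (w @ [b]) r b [] = hcomp_diag (id_diag (w @ [b])) (cap_at [b] r b [])"
    using hcomp_diag_assoc[OF wf(1,2), of "cap_diag r b"]
      hcomp_diag_assoc[OF wf(1,4), of "id_diag [r]"] id(1)
    by (simp add: cap_at_def)
  have cup: "cup_at w b r [r] = hcomp_diag (id_diag (w @ [b])) (cup_at [] b r [r])"
    using hcomp_diag_assoc[OF wf(1,5), of "cup_diag b r"]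
      hcomp_diag_assoc[OF wf(1,7), of "id_diag [b, r]"] id(2)
    by (simp add: cup_at_def)
  have H: "of_diag (cap_at [b] r b []) \<in> Hom S [b, r, b, r] [b, r]" "of_diag (cup_at [] b r [r]) \<in> Hom S [b, r] [b, r, b, r]"
    using cap_at_diagrams[OF o(7)] cup_at_diagrams[OF o(6)] by (auto intro: Hom_of_diag)
  have c: "(of_diag (cap_at (w @ [b]) r b []) :: ('a, 'b) two_mor) = id_mor (w @ [b]) \<otimes> of_diag (cap_at [b] r b [])"
    "(of_diag (cup_at w b r [r]) :: ('a, 'b) two_mor) = id_mor (w @ [b]) \<otimes> of_diag (cup_at [] b r [r])"
    unfolding cap cup by (simp_all add: hcomp_of_diag)
  have "vcomp \<delta> (of_diag (cap_at [b] r b [])) (of_diag (cup_at [] b r [r])) = id_mor [b, r]"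
    using zigzag[OF o(1)] by (simp add: vcomp_of_diag)
  then show 1: "vcomp \<delta> (of_diag (cap_at (w @ [b]) r b [])) (of_diag (cup_at w b r [r])) = id_mor (w @ [b, r])"
    unfolding c using interchange[OF Hom_id[OF o(2)] Hom_id[OF o(2)] H, of \<delta>]
    by (simp add: vcomp_id_mor[OF Hom_id[OF o(2)]] id_hcomp_id)
  have "flip (vcomp \<delta> (of_diag (cap_at (w @ [b]) r b [])) (of_diag (cup_at w b r [r]))) =
      vcomp \<delta> (of_diag (cap_at w b r [r])) (of_diag (cup_at (w @ [b]) r b []))"
    using flip_vcomp[OF Hom_wf[OF Hom_of_diag[OF cap_at_diagrams[OF o(5)]]] Hom_wf[OF Hom_of_diag[OF cup_at_diagrams[OF o(4)]]], of \<delta>]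
    by simp
  then show "vcomp \<delta> (of_diag (cap_at w b r [r])) (of_diag (cup_at (w @ [b]) r b [])) = id_mor (w @ [b, r])"
    unfolding 1 by simp
qed

section \<open>The projection \<open>P\<close>, the far-right cup \<open>U\<close> and cap
  \<open>A\<close>, and the correction \<open>Q\<close>\<close>

context
  fixes S :: "'c set" and \<delta> :: "'k::comm_ring_1" and u :: "'c list" and r b :: 'c
  assumes one: "one_mor S (u @ [r, b, r])"
    and Jz: "JW_exists S \<delta> (u @ [r])" and Jx: "JW_exists S \<delta> (u @ [r, b])"
begin

private abbreviation (input) vcomp_op :: "('c, 'k) two_mor \<Rightarrow> ('c, 'k) two_mor \<Rightarrow> ('c, 'k) two_mor" (infixr \<open>\<cdot>\<close> 75) where
  "f \<cdot> g \<equiv> vcomp \<delta> f g"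

private abbreviation (input) "Z \<equiv> JW S \<delta> (u @ [r])"
private abbreviation (input) "P \<equiv> JW S \<delta> (u @ [r, b]) \<otimes> id_mor [b, r]"
private abbreviation (input) U :: "('c, 'k) two_mor" where "U \<equiv> of_diag (cup_at u r b [])"
private abbreviation (input) A :: "('c, 'k) two_mor" where "A \<equiv> of_diag (cap_at u r b [])"
private abbreviation (input) "Q \<equiv> P \<cdot> U \<cdot> Z \<cdot> A \<cdot> P"

lemma one_mors: "one_mor S (u @ [r, b])" "one_mor S (u @ [r])" "one_mor S [b, r]" "one_mor S [r, b]" "one_mor S [r, b, r]"
  using one by (auto simp: one_mor_def distinct_adj_append_iff)

lemma Homs: "Z \<in> Hom S (u @ [r]) (u @ [r])" "P \<in> Hom S (u @ [r, b, r]) (u @ [r, b, r])"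
  "U \<in> Hom S (u @ [r]) (u @ [r, b, r])" "A \<in> Hom S (u @ [r, b, r]) (u @ [r])"
  "Q \<in> Hom S (u @ [r, b, r]) (u @ [r, b, r])"
proof -
  show H: "Z \<in> Hom S (u @ [r]) (u @ [r])" "P \<in> Hom S (u @ [r, b, r]) (u @ [r, b, r])"
    using JW_Hom[OF Jz] Hom_strand[OF JW_Hom[OF Jx] _ one_mors(3)] by simp_all
  show H': "U \<in> Hom S (u @ [r]) (u @ [r, b, r])" "A \<in> Hom S (u @ [r, b, r]) (u @ [r])"
    using Hom_of_diag[OF cup_at_diagrams[OF one]] Hom_of_diag[OF cap_at_diagrams[OF one]] by simp_all
  show "Q \<in> Hom S (u @ [r, b, r]) (u @ [r, b, r])"
    by (rule Hom_vcomp H H')+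
qed

lemmas wfs = Homs[THEN Hom_wf] wf_two_mor_vcomp

lemma PP: "P \<cdot> P = P"
  using vcomp_strand[OF JW_Hom[OF Jx] JW_Hom[OF Jx] _ one_mors(3), of \<delta>] by (simp add: JW_idem[OF Jx])

lemma PP': "wf_two_mor f \<Longrightarrow> P \<cdot> P \<cdot> f = P \<cdot> f"
  by (simp add: vcomp_assoc[symmetric] wfs PP)

lemma ZZ': "wf_two_mor f \<Longrightarrow> Z \<cdot> Z \<cdot> f = Z \<cdot> f"
  by (simp add: vcomp_assoc[symmetric] wfs JW_idem[OF Jz])

lemma strands_Z: "Z \<otimes> id_mor [r, b, r] = (Z \<otimes> id_mor [r, b]) \<otimes> id_mor [b, r]"
proof -
  have "id_mor [r, b, r] = (id_mor [r, b] \<otimes> id_mor [b, r] :: ('c, 'k) two_mor)"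
    by (simp add: id_hcomp_id)
  then show ?thesis
    using hcomp_assoc[OF wfs(1) Hom_wf[OF Hom_id[OF one_mors(4)]] Hom_wf[OF Hom_id[OF one_mors(3)]]] by simp
qed

lemma HZ1: "Z \<otimes> id_mor [r, b] \<in> Hom S (u @ [r, b]) (u @ [r, b])"
  using Hom_strand[OF Homs(1) _ one_mors(4)] by simp

lemma HZ2: "Z \<otimes> id_mor [r, b, r] \<in> Hom S (u @ [r, b, r]) (u @ [r, b, r])"
  using Hom_strand[OF HZ1 _ one_mors(3)] by (simp add: strands_Z)

text \<open>\<open>JW(x)\<close> absorbs \<open>Z\<close> with a strand because the latter has
  identity coefficient 1.\<close>

lemma PZ: "P \<cdot> (Z \<otimes> id_mor [r, b, r]) = P"
proof -
  have "coeff (Z \<otimes> id_mor [r, b]) (id_diag (u @ [r, b])) = 1"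
    using lookup_strand[OF Homs(1), of r b] lookup_JW[OF Jz] by simp
  then have "JW S \<delta> (u @ [r, b]) \<cdot> (Z \<otimes> id_mor [r, b]) = JW S \<delta> (u @ [r, b])"
    using JW_vcomp[OF Jx HZ1] by simp
  then show ?thesis
    unfolding strands_Z using vcomp_strand[OF JW_Hom[OF Jx] HZ1 _ one_mors(3), of \<delta>] by simp
qed

text \<open>\<open>Z\<close> slides from below the cup to the strands beside it, where
  \<open>P\<close> absorbs it.\<close>

lemma PUZ: "P \<cdot> U \<cdot> Z = P \<cdot> U"
  using slide(1)[OF one Homs(1), of \<delta>] vcomp_assoc[OF wfs(2) Hom_wf[OF HZ2] wfs(3), of \<delta>] by (simp add: PZ)

lemma P_cup:
  assumes "u @ [r, b] = u' @ b' # r' # b' # v"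
  shows "P \<cdot> of_diag (cup_at u' b' r' (v @ [r])) = 0" "of_diag (cap_at u' b' r' (v @ [r])) \<cdot> P = 0"
  using JW_strand_cup[OF Jx assms one_mors(1), of r] one_mors(3) by simp_all

text \<open>A non-identity diagram of \<open>JW(x)\<close> has a cup at its top, which starts
  further left than the far-right cup of \<open>U\<close>. Adding a strand and composing with
  \<open>U\<close> keeps that cup, so only the identity term yields \<open>U\<close> itself.\<close>

lemma lookup_PU: "coeff (P \<cdot> U) (cup_at u r b []) = 1"
proof -
  let ?x = "u @ [r, b]"
  have U: "U = id_mor (u @ [r, b, r]) \<cdot> U" using id_vcomp_mor[OF Homs(3)] by simp
  have "coeff ((f \<otimes> id_mor [b, r]) \<cdot> U) (cup_at u r b []) = coeff f (id_diag ?x)"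
    if "f \<in> Hom S ?x ?x" for f
    using that unfolding Hom_span
  proof (induction f rule: span_induct)
    case (diag a D)
    show ?case
    proof (cases "D = id_diag ?x")
      case True
      then have "of_diag D \<otimes> id_mor [b, r] = (id_mor (u @ [r, b, r]) :: ('c, 'k) two_mor)"
        by (simp add: id_hcomp_id)
      then show ?thesis using True U by (simp add: hcomp_linear vcomp_linear lookup_of_diag)
    next
      case False
      from cup_factor_mor[OF diag order_refl False, where \<delta> = \<delta>]
      obtain u' b' r' v' D' where x: "?x = u' @ b' # r' # b' # v'" and D': "D' \<in> diagrams S ?x (u' @ b' # v')"
        and D: "of_diag D = of_diag (cup_at u' b' r' v') \<cdot> of_diag D'" .
      have o: "one_mor S (u' @ b' # r' # b' # v')" using one_mors(1) x by simp
      have l: "last (b' # v') = b" "last (u' @ b' # v') = b" using arg_cong[OF x, of last] by simp_all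
      have "u @ [r, b, r] = u' @ b' # r' # b' # v' @ [r]" using arg_cong[OF x, of "\<lambda>l. l @ [r]"] by simp
      then have o': "one_mor S (u' @ b' # r' # b' # v' @ [r])" using one by metis
      have "(of_diag D \<otimes> id_mor [b, r]) = of_diag (cup_at u' b' r' (v' @ [r])) \<cdot> (of_diag D' \<otimes> id_mor [b, r])"
        unfolding D cup_at_strand(1)[OF l(1)]
        by (rule vcomp_strand[OF Hom_of_diag[OF cup_at_diagrams[OF o]] Hom_of_diag[OF D'] l(2) one_mors(3), symmetric])
      moreover have HD: "of_diag D' \<otimes> id_mor [b, r] \<in> Hom S (u @ [r, b, r]) (u' @ b' # v' @ [r])"
        using Hom_strand[OF Hom_of_diag[OF D'] _ one_mors(3)] by simp
      ultimately have "(of_diag D \<otimes> id_mor [b, r]) \<cdot> U =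
          of_diag (cup_at u' b' r' (v' @ [r])) \<cdot> (of_diag D' \<otimes> id_mor [b, r]) \<cdot> U"
        using vcomp_assoc[OF Hom_wf[OF Hom_of_diag[OF cup_at_diagrams[OF o']]] Hom_wf[OF HD] wfs(3)] by simp
      moreover have "coeff \<dots> (cup_at u r b []) = 0"
      proof (rule lookup_cup_vcomp)
        show "(of_diag D' \<otimes> id_mor [b, r]) \<cdot> U \<in> Hom S (u @ [r]) (u' @ b' # v' @ [r])"
          by (rule Hom_vcomp[OF HD Homs(3)])
        have "length u' < length u" using arg_cong[OF x, of length] by simp
        then show "{Top (length u'), Top (Suc (length u'))} \<notin> arcs (cup_at u r b [])"
          unfolding arcs_cup_at by (auto simp: doubleton_eq_iff)
      qed
      ultimately show ?thesis using False by (simp add: hcomp_linear vcomp_linear lookup_of_diag)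
    qed
  qed (simp_all add: hcomp_linear vcomp_linear lookup_add)
  from this[OF JW_Hom[OF Jx]] show ?thesis using lookup_JW[OF Jx] by simp
qed

text \<open>A non-identity diagram has a cap at its bottom, and every cap but the one at the far
  right annihilates \<open>P\<close>; \<open>h\<close> collects what stands above that last
  cap.\<close>

lemma vcomp_P:
  assumes "g \<in> Hom S (u @ [r, b, r]) (u @ [r, b, r])"
  shows "\<exists>h \<in> Hom S (u @ [r]) (u @ [r, b, r]).
    g \<cdot> P = scale (coeff g (id_diag (u @ [r, b, r]))) P + h \<cdot> A \<cdot> P"
  using assms unfolding Hom_span[of S "u @ [r, b, r]" "u @ [r, b, r]"]
proof (induction g rule: span_induct)
  case zero
  then show ?case by (intro bexI[of _ 0]) (simp_all add: vcomp_linear Hom_zero)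
next
  case (add f g)
  then obtain h h' where "h \<in> Hom S (u @ [r]) (u @ [r, b, r])" "h' \<in> Hom S (u @ [r]) (u @ [r, b, r])"
    "f \<cdot> P = scale (coeff f (id_diag (u @ [r, b, r]))) P + h \<cdot> A \<cdot> P"
    "g \<cdot> P = scale (coeff g (id_diag (u @ [r, b, r]))) P + h' \<cdot> A \<cdot> P" by blast
  then show ?case
    by (intro bexI[of _ "h + h'"]) (simp_all add: vcomp_linear Hom_add lookup_add scale_add_left)
next
  case (diag a D)
  show ?case
  proof (cases "D = id_diag (u @ [r, b, r])")
    case True
    then show ?thesis
      by (intro bexI[of _ 0]) (simp_all add: vcomp_linear Hom_zero lookup_of_diag id_vcomp_mor[OF Homs(2)])
  next
    case False
    from cap_factor_mor[OF diag order_refl False, where \<delta> = \<delta>]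
    obtain u' b' r' v D' where y: "u @ [r, b, r] = u' @ b' # r' # b' # v" and D': "D' \<in> diagrams S (u' @ b' # v) (u @ [r, b, r])"
      and D: "of_diag D = of_diag D' \<cdot> of_diag (cap_at u' b' r' v)" .
    have o: "one_mor S (u' @ b' # r' # b' # v)" using one y by simp
    have DP: "of_diag D \<cdot> P = of_diag D' \<cdot> of_diag (cap_at u' b' r' v) \<cdot> P"
      unfolding D by (rule vcomp_assoc) (intro wfs Hom_wf[OF Hom_of_diag[OF D']] Hom_wf[OF Hom_of_diag[OF cap_at_diagrams[OF o]]])+
    have y': "(u @ [r, b]) @ [r] = u' @ b' # r' # b' # v" using y by simp
    from y' show ?thesis
    proof (cases rule: snoc_cup_cases)
      case 1
      then have "u' = u" "b' = r" "r' = b" by auto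
      then show ?thesis using DP 1 D' False
        by (intro bexI[of _ "scale a (of_diag D')"]) (simp_all add: vcomp_linear lookup_of_diag Hom_scale Hom_of_diag)
    next
      case (2 v')
      then have "of_diag D \<cdot> P = 0" using DP P_cup(2) by (simp add: vcomp_linear)
      then show ?thesis using False
        by (intro bexI[of _ 0]) (simp_all add: vcomp_linear Hom_zero lookup_of_diag)
    qed
  qed
qed

section \<open>Consequences of a scalar partial trace \<open>A \<cdot> P \<cdot> U\<close>\<close>

context
  fixes l :: 'k
  assumes tr: "A \<cdot> P \<cdot> U = scale l Z"
begin

lemma tr': "wf_two_mor f \<Longrightarrow> A \<cdot> P \<cdot> U \<cdot> f = scale l (Z \<cdot> f)"
  using arg_cong[OF tr, of "\<lambda>h. h \<cdot> f"] by (simp add: vcomp_assoc wfs vcomp_linear)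

lemma QU: "Q \<cdot> U = scale l (P \<cdot> U)"
proof -
  have "Q \<cdot> U = P \<cdot> U \<cdot> Z \<cdot> A \<cdot> P \<cdot> U" by (simp add: vcomp_assoc wfs)
  also have "\<dots> = scale l (P \<cdot> U)" by (simp add: tr vcomp_linear JW_idem[OF Jz] PUZ)
  finally show ?thesis .
qed

text \<open>In \<open>Q \<cdot> Q\<close> the inner factors form a partial trace, which contributes
  \<open>l\<close>, and the copies of \<open>Z\<close> merge.\<close>

lemma QP: "Q \<cdot> P = Q" and PQ: "P \<cdot> Q = Q" and QQ: "Q \<cdot> Q = scale l Q"
  by (simp_all add: vcomp_assoc wfs PP PP' tr' ZZ' vcomp_linear)

lemma JW_recursion:
  assumes c: "c * l = - 1"
  shows "JW_exists S \<delta> (u @ [r, b, r])" "JW S \<delta> (u @ [r, b, r]) = P + scale c Q"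
proof -
  let ?f = "P + scale c Q" and ?y = "u @ [r, b, r]"
  have H: "?f \<in> Hom S ?y ?y" using Homs by (intro Hom_add Hom_scale)
  have "?f \<cdot> of_diag (cup_at u' b' r' v) = 0" if y: "?y = u' @ b' # r' # b' # v" for u' b' r' v
  proof -
    have y': "(u @ [r, b]) @ [r] = u' @ b' # r' # b' # v" using y by simp
    from y' show ?thesis
    proof (cases rule: snoc_cup_cases)
      case 1
      then have eq: "u' = u" "b' = r" "r' = b" "v = []" by auto
      \<comment> \<open>The total factor of \<open>P \<cdot> U\<close> is \<open>1 + c * l\<close>,
        which is 0 by the choice of \<open>c\<close>.\<close>
      have "?f \<cdot> U = P \<cdot> U + scale (c * l) (P \<cdot> U)" by (simp add: vcomp_linear QU)
      then show ?thesis unfolding eq c by (simp add: scale_minus_left)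
    next
      case (2 v')
      have o: "one_mor S (u' @ b' # r' # b' # v)" using one y by simp
      have "Q \<cdot> of_diag (cup_at u' b' r' v) = P \<cdot> U \<cdot> Z \<cdot> A \<cdot> P \<cdot> of_diag (cup_at u' b' r' v)"
        by (simp add: vcomp_assoc wfs Hom_wf[OF Hom_of_diag[OF cup_at_diagrams[OF o]]])
      then show ?thesis using 2 P_cup(1) by (simp add: vcomp_linear)
    qed
  qed
  then have B: "?f \<in> B S \<delta> ?y" using H by (simp add: B_iff)
  have "coeff P (id_diag ?y) = 1"
    using lookup_strand[OF JW_Hom[OF Jx], of b r] lookup_JW[OF Jx] by simp
  moreover have "coeff Q (id_diag ?y) = 0"
  proof -
    \<comment> \<open>Bracketed in this way the composite visibly passes through the shorter line
      \<open>u @ [r]\<close>.\<close>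
    have "coeff ((P \<cdot> U) \<cdot> Z \<cdot> A \<cdot> P) (id_diag ?y) = 0"
      by (rule lookup_id_vcomp_shorter) (rule Hom_vcomp Homs | simp)+
    then show ?thesis by (simp add: vcomp_assoc wfs)
  qed
  ultimately have "coeff ?f (id_diag ?y) = 1" by (simp add: lookup_add)
  then show "JW_exists S \<delta> ?y" "JW S \<delta> ?y = ?f" by (rule JW_eqI[OF B])+
qed

lemma JW_recursion_idempotent:
  assumes c: "c * l = - 1"
  defines "e \<equiv> scale (- c) Q"
  shows "e \<cdot> e = e" "e \<cdot> JW S \<delta> (u @ [r, b, r]) = 0" "JW S \<delta> (u @ [r, b, r]) \<cdot> e = 0"
proof -
  \<comment> \<open>This is the coefficient of \<open>Q\<close> in the square of \<open>e\<close>,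
    since \<open>Q \<cdot> Q\<close> is \<open>l\<close> times \<open>Q\<close>.\<close>
  have "c * (c * l) = - c" using c by simp
  then show "e \<cdot> e = e" unfolding e_def by (simp add: vcomp_linear QQ mult.assoc)
  show "e \<cdot> JW S \<delta> (u @ [r, b, r]) = 0" "JW S \<delta> (u @ [r, b, r]) \<cdot> e = 0"
    unfolding JW_recursion(2)[OF c] e_def by (simp_all only: vcomp_linear QP PQ QQ scale_scale scale_add_left[symmetric])
      (simp_all add: c scale_minus_left \<open>c * (c * l) = - c\<close> mult.assoc)
qed

lemma JW_exists_imp_unit:
  assumes J: "JW_exists S \<delta> (u @ [r, b, r])"
  shows "l dvd 1"
proof -
  let ?y = "u @ [r, b, r]" and ?K = "cup_at u r b []"
  let ?f = "JW S \<delta> ?y"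
  have "coeff P (id_diag ?y) = 1"
    using lookup_strand[OF JW_Hom[OF Jx], of b r] lookup_JW[OF Jx] by simp
  \<comment> \<open>\<open>P\<close> has identity coefficient 1, so \<open>?f\<close> absorbs it;
    expanding the left factor by \<open>vcomp_P\<close> then writes \<open>?f\<close> in terms of
    \<open>P\<close> and the last cap only.\<close>
  then have "?f \<cdot> P = ?f" using JW_vcomp[OF J Homs(2)] by simp
  then obtain h where h: "h \<in> Hom S (u @ [r]) ?y" "?f = P + h \<cdot> A \<cdot> P"
    using vcomp_P[OF JW_Hom[OF J]] lookup_JW[OF J] by auto
  have "0 = ?f \<cdot> U" using JW_cup[of S \<delta> u r b "[]"] J by simp
  also have "\<dots> = P \<cdot> U + h \<cdot> A \<cdot> P \<cdot> U"
    unfolding h(2) using Hom_wf[OF h(1)] by (simp add: vcomp_linear vcomp_assoc wfs)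
  also have "\<dots> = P \<cdot> U + scale l (h \<cdot> Z)" by (simp add: tr vcomp_linear)
  finally have "coeff (P \<cdot> U + scale l (h \<cdot> Z)) ?K = 0" by simp
  \<comment> \<open>The coefficient of the cup in \<open>P \<cdot> U\<close> is 1, so the negative
    of its coefficient in \<open>h \<cdot> Z\<close> is an inverse of \<open>l\<close>.\<close>
  then have "1 + l * coeff (h \<cdot> Z) ?K = 0" by (simp add: lookup_add lookup_PU)
  then have "1 = l * - coeff (h \<cdot> Z) ?K" by (simp add: eq_neg_iff_add_eq_0)
  then show ?thesis by (rule dvdI)
qed

end

end

section \<open>Tails and the partial trace\<close>

abbreviation alternating_suffixes :: "'c list \<Rightarrow> 'c list set" where
  "alternating_suffixes x \<equiv> {y. y \<noteq> [] \<and> suffix y x \<and> alternating y}"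

lemma finite_alternating_suffixes: "finite (length ` alternating_suffixes x)"
proof (rule finite_subset)
  show "length ` alternating_suffixes x \<subseteq> {..length x}" using suffix_length_le by fastforce
qed simp

lemma alternating_two: "r \<noteq> b \<Longrightarrow> alternating [r, b]"
  unfolding alternating_def by (intro exI[of _ r] exI[of _ b]) (auto simp: less_Suc_eq numeral_2_eq_2)

lemma tail_length_ge2:
  assumes "r \<noteq> b"
  shows "2 \<le> tail_length (u @ [r, b])"
proof -
  have "[r, b] \<in> alternating_suffixes (u @ [r, b])"
    using alternating_two[OF assms] by (auto simp: suffix_def)
  then have "length [r, b] \<in> length ` alternating_suffixes (u @ [r, b])" by blast
  then show ?thesis
    unfolding tail_length_def using Max_ge[OF finite_alternating_suffixes] by fastforce
qed

lemma suffix_long: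
  assumes "suffix y (w @ v)" "length v \<le> length y"
  obtains y' where "y = y' @ v"
  using assms by (metis suffix_def suffix_length_suffix)

text \<open>An alternating sequence repeats its colors at distance two, so a third color in the tail
  would have to be \<open>b\<close>.\<close>

lemma tail_length_eq2:
  assumes "r \<noteq> b" "u = [] \<or> last u \<noteq> b"
  shows "tail_length (u @ [r, b]) = 2"
proof (rule antisym)
  have "length y \<le> 2" if y: "y \<in> alternating_suffixes (u @ [r, b])" for y
  proof (rule ccontr)
    assume len: "\<not> length y \<le> 2"
    have "suffix y (u @ [r, b])" using y by simp
    then have "u \<noteq> []" using len suffix_length_le[of y "u @ [r, b]"] by auto
    then obtain w a where u: "u = w @ [a]" "a \<noteq> b" using assms(2) by (cases u rule: rev_cases) auto
    have "suffix y (w @ [a, r, b])" using y u by simp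
    then obtain y' where y': "y = y' @ [a, r, b]" using len suffix_long[of y w "[a, r, b]"] by auto
    obtain c d where cd: "\<forall>i<length y. y ! i = (if even i then c else d)"
      using y by (auto simp: alternating_def)
    have "y ! length y' = y ! (length y' + 2)"
      using cd[rule_format, of "length y'"] cd[rule_format, of "length y' + 2"] y' by simp
    then show False using y' u(2) by (simp add: nth_append)
  qed
  moreover have "alternating_suffixes (u @ [r, b]) \<noteq> {}"
    using alternating_two[OF assms(1)] by (auto simp: suffix_def)
  ultimately show "tail_length (u @ [r, b]) \<le> 2"
    unfolding tail_length_def by (subst Max_le_iff) (auto simp: finite_alternating_suffixes)
  show "2 \<le> tail_length (u @ [r, b])" by (rule tail_length_ge2[OF assms(1)])
qed

text \<open>Removing the last color of an alternating suffix leaves an alternating one, and a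
  longest alternating suffix of \<open>w @ [b, r]\<close> can be prolonged by
  \<open>b\<close>.\<close>

lemma tail_length_Suc:
  assumes "r \<noteq> b"
  shows "tail_length (w @ [b, r, b]) = Suc (tail_length (w @ [b, r]))"
proof (rule antisym)
  let ?T = "\<lambda>x. length ` alternating_suffixes x"
  have ne: "?T (w @ [b, r]) \<noteq> {}" "?T (w @ [b, r, b]) \<noteq> {}"
    using alternating_two[OF assms] alternating_two[OF assms[symmetric]]
    by (auto simp: suffix_def) (metis append.assoc append_Cons append_Nil list.distinct(1))+
  have "length y \<le> Suc (tail_length (w @ [b, r]))" if y: "y \<in> alternating_suffixes (w @ [b, r, b])" for y
  proof -
    have "suffix y ((w @ [b, r]) @ [b])" "y \<noteq> []" using y by simp_all
    then obtain y' where y': "y = y' @ [b]" "suffix y' (w @ [b, r])"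
      by (metis suffix_snoc)
    show ?thesis
    proof (cases "y' = []")
      case False
      obtain c d where cd: "c \<noteq> d" "\<forall>i<length y. y ! i = (if even i then c else d)"
        using y by (auto simp: alternating_def)
      have "\<forall>i<length y'. y' ! i = (if even i then c else d)"
      proof (intro allI impI)
        fix i assume "i < length y'"
        then show "y' ! i = (if even i then c else d)"
          using cd(2)[rule_format, of i] y'(1) by (simp add: nth_append)
      qed
      then have "alternating y'" using cd(1) unfolding alternating_def by blast
      then have "length y' \<in> ?T (w @ [b, r])" using False y'(2) by blast
      then show ?thesis
        unfolding tail_length_def using Max_ge[OF finite_alternating_suffixes] y'(1) by fastforce
    qed (use y' in simp)
  qed
  then show "tail_length (w @ [b, r, b]) \<le> Suc (tail_length (w @ [b, r]))"
    unfolding tail_length_def[of "w @ [b, r, b]"]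
    by (subst Max_le_iff) (use ne in \<open>auto simp: finite_alternating_suffixes\<close>)
  have "tail_length (w @ [b, r]) \<in> ?T (w @ [b, r])"
    unfolding tail_length_def by (rule Max_in[OF finite_alternating_suffixes ne(1)])
  then obtain y where y: "y \<in> alternating_suffixes (w @ [b, r])" "length y = tail_length (w @ [b, r])" by auto
  \<comment> \<open>A longest suffix has length at least 2, hence ends in \<open>b, r\<close>; so
    the appended \<open>b\<close> agrees with the color two places before it.\<close>
  then have "length [b, r] \<le> length y" using tail_length_ge2[OF assms[symmetric], of w] by simp
  then obtain y' where y': "y = y' @ [b, r]" using suffix_long[of y w "[b, r]"] y(1) by auto
  obtain c d where cd: "c \<noteq> d" "\<forall>i<length y. y ! i = (if even i then c else d)"
    using y by (auto simp: alternating_def)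
  have "\<forall>i<length (y @ [b]). (y @ [b]) ! i = (if even i then c else d)"
  proof (intro allI impI)
    fix i assume i: "i < length (y @ [b])"
    show "(y @ [b]) ! i = (if even i then c else d)"
    proof (cases "i < length y")
      case True
      then show ?thesis using cd(2) by (simp add: nth_append)
    next
      case False
      then have "i = length y' + 2" using i y' by simp
      then show ?thesis using cd(2)[rule_format, of "length y'"] y' by (simp add: nth_append)
    qed
  qed
  then have "alternating (y @ [b])" using cd(1) unfolding alternating_def by blast
  moreover have "suffix (y @ [b]) (w @ [b, r, b])"
  proof -
    have "suffix (y @ [b]) ((w @ [b, r]) @ [b])" using y(1) by (simp add: suffix_def)
    then show ?thesis by simp
  qed
  ultimately have "length (y @ [b]) \<in> ?T (w @ [b, r, b])" by blast
  then show "Suc (tail_length (w @ [b, r])) \<le> tail_length (w @ [b, r, b])"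
    unfolding tail_length_def[of "w @ [b, r, b]"] using Max_ge[OF finite_alternating_suffixes] y(2) by fastforce
qed

lemma one_mor_alternate: "one_mor S (u @ [r, b]) \<Longrightarrow> one_mor S (u @ [r, b, r])"
  by (auto simp: one_mor_def distinct_adj_append_iff)

text \<open>The factor \<open>l\<close> is \<open>- [k] / [k - 1]\<close>, where \<open>k\<close> is the length of the tail.\<close>

lemma partial_trace:
  assumes "one_mor S (u @ [r, b])"
    and "\<And>y. y \<noteq> [] \<Longrightarrow> prefix y (u @ [r, b]) \<Longrightarrow> JW_exists S \<delta> y"
  shows "\<exists>l. qnum \<delta> (tail_length (u @ [r, b]) - 1) dvd 1 \<and>
    qnum \<delta> (tail_length (u @ [r, b]) - 1) * l = - qnum \<delta> (tail_length (u @ [r, b])) \<and>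
    vcomp \<delta> (of_diag (cap_at u r b [])) (vcomp \<delta> (JW S \<delta> (u @ [r, b]) \<otimes> id_mor [b, r]) (of_diag (cup_at u r b [])))
      = scale l (JW S \<delta> (u @ [r]))"
  using assms
proof (induction "length u" arbitrary: u r b rule: less_induct)
  case less
  note one = one_mor_alternate[OF less.prems(1)]
  let ?Z = "JW S \<delta> (u @ [r])" and ?J = "JW S \<delta> (u @ [r, b])"
  let ?U = "of_diag (cup_at u r b []) :: ('a, 'b) two_mor" and ?A = "of_diag (cap_at u r b []) :: ('a, 'b) two_mor"
  have o: "one_mor S (u @ [r])" "one_mor S [r, b]" "one_mor S [b, r]" "r \<noteq> b" "b \<in> S"
    using one by (auto simp: one_mor_def distinct_adj_append_iff)
  have Jz: "JW_exists S \<delta> (u @ [r])" and Jx: "JW_exists S \<delta> (u @ [r, b])"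
    using less.prems(2)[of "u @ [r]"] less.prems(2)[of "u @ [r, b]"] by (auto simp: prefix_def)
  note HH = Homs[OF one Jz Jx] and HR = HZ2[OF one Jz Jx] and strands = strands_Z[OF one Jz Jx]
  note sl = slide[OF one HH(1), of \<delta>]
  show ?case
  proof (cases "u = [] \<or> last u \<noteq> b")
    \<comment> \<open>The tail has length 2. Either \<open>u\<close> is empty or \<open>b\<close> is
      a new color after \<open>u @ [r]\<close>, so \<open>?J\<close> is \<open>?Z\<close> with a
      strand; the trace is then a circle, and \<open>- \<delta>\<close> is
      \<open>- [2] / [1]\<close>.\<close>
    case True
    have "?J = ?Z \<otimes> id_mor [r, b]"
    proof (cases u rule: rev_cases)
      case Nil
      have "JW S \<delta> [r, b] = id_mor [r, b]" "JW S \<delta> [r] = id_mor [r]"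
        using JW_short(2)[of S "[r, b]"] JW_short(2)[of S "[r]"] o Nil by auto
      then show ?thesis using Nil by (simp add: id_hcomp_id)
    next
      case (snoc u' a)
      have "JW_exists S \<delta> (u' @ [a, r])" "one_mor S (u' @ [a, r])" using Jz o(1) snoc by simp_all
      then show ?thesis using JW_new_color(2)[of S \<delta> "u' @ [a, r]" u' a r b] snoc True o by simp
    qed
    then have "vcomp \<delta> ?A (vcomp \<delta> (?J \<otimes> id_mor [b, r]) ?U) = scale (- \<delta>) ?Z"
      using sl(3) strands by simp
    then show ?thesis
      by (intro exI[of _ "- \<delta>"]) (simp add: tail_length_eq2[OF o(4) True] numeral_2_eq_2)
  next
    case False
    then obtain w where u: "u = w @ [b]" by (cases u rule: rev_cases) auto
    let ?k = "tail_length (w @ [b, r])"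
    let ?W = "JW S \<delta> (w @ [b])" and ?U' = "of_diag (cup_at w b r []) :: ('a, 'b) two_mor"
      and ?A' = "of_diag (cap_at w b r []) :: ('a, 'b) two_mor"
    let ?P' = "JW S \<delta> (w @ [b, r]) \<otimes> id_mor [r, b]"
    have one': "one_mor S (w @ [b, r])" "one_mor S (w @ [b, r, b])" using o(1) less.prems(1) u by simp_all
    have ex': "JW_exists S \<delta> y" if "y \<noteq> []" "prefix y (w @ [b, r])" for y
    proof -
      have "prefix y ((w @ [b, r]) @ [b])" using that(2) by (rule prefix_prefix)
      then show ?thesis using less.prems(2) that(1) u by simp
    qed
    have Jw: "JW_exists S \<delta> (w @ [b])" and Jz': "JW_exists S \<delta> (w @ [b, r])"
      using ex'[of "w @ [b]"] ex'[of "w @ [b, r]"] by (auto simp: prefix_def)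
    have Jx': "JW_exists S \<delta> (w @ [b, r, b])" using Jx u by simp
    note Homs' = Homs[OF one'(2) Jw Jz']
    obtain l' where l': "qnum \<delta> (?k - 1) * l' = - qnum \<delta> ?k"
      "qnum \<delta> (?k - 1) dvd 1"
      and tr: "vcomp \<delta> ?A' (vcomp \<delta> ?P' ?U') = scale l' ?W"
      using less.hyps[OF _ one'(1) ex'] u by auto
    \<comment> \<open>The induction hypothesis makes only \<open>[?k - 1]\<close> invertible.
      Existence of \<open>?J\<close>, which is the next step for the shorter sequence, forces
      \<open>l'\<close> to be a unit as well, and thereby \<open>[?k]\<close>.\<close>
    have "l' dvd 1" using JW_exists_imp_unit[OF one'(2) Jw Jz' tr Jx'] .
    then have "qnum \<delta> (?k - 1) * l' dvd 1" using l'(2) mult_dvd_mono[of _ 1 l' 1] by fastforce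
    then have unit: "qnum \<delta> ?k dvd 1" unfolding l'(1) by simp
    then obtain i where i: "1 = qnum \<delta> ?k * i" by (rule dvdE)
    \<comment> \<open>The quotient \<open>[?k - 1] / [?k]\<close>, which solves
      \<open>c * l' = - 1\<close> as the recursion demands.\<close>
    define c where "c = qnum \<delta> (?k - 1) * i"
    have c: "c * l' = - 1"
    proof -
      have "c * l' = qnum \<delta> (?k - 1) * l' * i" by (simp add: c_def ac_simps)
      then show ?thesis unfolding l'(1) using i by simp
    qed
    let ?Q' = "vcomp \<delta> ?P' (vcomp \<delta> ?U' (vcomp \<delta> ?W (vcomp \<delta> ?A' ?P')))"
    have J: "?J = ?P' + scale c ?Q'"
      using JW_recursion(2)[OF one'(2) Jw Jz' tr c] u by simp
    let ?R = "?Z \<otimes> id_mor [r, b, r]"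
    have R: "?P' \<otimes> id_mor [b, r] = ?R" using strands u by simp
    let ?I = "id_mor [b, r] :: ('a, 'b) two_mor"
    \<comment> \<open>Adding a strand respects composition, so the factors of \<open>?Q'\<close> can
      be moved one by one.\<close>
    have Q: "?Q' \<otimes> ?I = vcomp \<delta> ?R (vcomp \<delta> (?U' \<otimes> ?I) (vcomp \<delta> (?W \<otimes> ?I) (vcomp \<delta> (?A' \<otimes> ?I) ?R)))"
    proof -
      have l: "last (w @ [b]) = b" "last (w @ [b, r, b]) = b" by simp_all
      note H4 = Hom_vcomp[OF Homs'(4,2), of \<delta>]
      note H3 = Hom_vcomp[OF Homs'(1) H4, of \<delta>]
      note H2 = Hom_vcomp[OF Homs'(3) H3, of \<delta>]
      show ?thesis
        unfolding vcomp_strand[OF Homs'(2) H2 l(2) o(3), symmetric]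
          vcomp_strand[OF Homs'(3) H3 l(1) o(3), symmetric]
          vcomp_strand[OF Homs'(1) H4 l(1) o(3), symmetric]
          vcomp_strand[OF Homs'(4,2) l(2) o(3), symmetric] R ..
    qed
    have HW: "?W \<otimes> ?I \<in> Hom S (u @ [r]) (u @ [r])"
      using Hom_strand[OF Homs'(1) _ o(3)] u by simp
    have HU: "?U' \<otimes> ?I \<in> Hom S (u @ [r]) (u @ [r, b, r])"
      using Hom_strand[OF Homs'(3) _ o(3)] u by simp
    have HA: "?A' \<otimes> ?I \<in> Hom S (u @ [r, b, r]) (u @ [r])"
      using Hom_strand[OF Homs'(4) _ o(3)] u by simp
    note wf = HH(1,3,4)[THEN Hom_wf] HR[THEN Hom_wf] HW[THEN Hom_wf] HU[THEN Hom_wf] HA[THEN Hom_wf]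
      wf_two_mor_vcomp
    have AU: "vcomp \<delta> ?A (?U' \<otimes> ?I) = id_mor (u @ [r])" and UA: "vcomp \<delta> (?A' \<otimes> ?I) ?U = id_mor (u @ [r])"
    proof -
      have "of_diag (cup_at w b r [r]) = ?U' \<otimes> ?I" "of_diag (cap_at w b r [r]) = ?A' \<otimes> ?I"
        using cup_at_strand[of b "[]" b w r r] by simp_all
      then show "vcomp \<delta> ?A (?U' \<otimes> ?I) = id_mor (u @ [r])" "vcomp \<delta> (?A' \<otimes> ?I) ?U = id_mor (u @ [r])"
        using zigzag_mor[OF one'(2), of \<delta>] u by simp_all
    qed
    have AU': "vcomp \<delta> ?A (vcomp \<delta> (?U' \<otimes> ?I) f) = f" if "f \<in> Hom S (u @ [r]) (u @ [r])" for f
      using vcomp_assoc[OF wf(3,6) Hom_wf[OF that], of \<delta>] by (simp add: AU id_vcomp_mor[OF that])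
    have UA': "vcomp \<delta> (?A' \<otimes> ?I) (vcomp \<delta> ?U ?Z) = ?Z"
      using vcomp_assoc[OF wf(7,2,1), of \<delta>] by (simp add: UA id_vcomp_mor[OF HH(1)])
    \<comment> \<open>The two copies of \<open>?R\<close> pass the outer cap and cup and become
      \<open>?Z\<close>; the two zigzags then straighten, and \<open>?W\<close> with a strand is
      absorbed by \<open>?Z\<close>.\<close>
    have "vcomp \<delta> ?A (vcomp \<delta> (?Q' \<otimes> ?I) ?U) =
        vcomp \<delta> (vcomp \<delta> ?A ?R) (vcomp \<delta> (?U' \<otimes> ?I) (vcomp \<delta> (?W \<otimes> ?I) (vcomp \<delta> (?A' \<otimes> ?I) (vcomp \<delta> ?R ?U))))"
      unfolding Q by (simp add: vcomp_assoc wf)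
    also have "\<dots> = vcomp \<delta> ?Z (vcomp \<delta> ?A (vcomp \<delta> (?U' \<otimes> ?I) (vcomp \<delta> (?W \<otimes> ?I) (vcomp \<delta> (?A' \<otimes> ?I) (vcomp \<delta> ?U ?Z)))))"
      unfolding sl(1,2)[symmetric] by (simp add: vcomp_assoc wf)
    also have "\<dots> = vcomp \<delta> ?Z (vcomp \<delta> (?W \<otimes> ?I) ?Z)"
      by (simp add: UA' AU'[OF Hom_vcomp[OF HW HH(1)]])
    also have "\<dots> = ?Z"
    proof -
      have "coeff (?W \<otimes> ?I) (id_diag (u @ [r])) = 1"
        using lookup_strand[OF Homs'(1), of b r] lookup_JW[OF Jw] u by simp
      then have "vcomp \<delta> ?Z (?W \<otimes> ?I) = ?Z" using JW_vcomp[OF Jz HW] by simp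
      then show ?thesis using vcomp_assoc[OF wf(1,5,1), of \<delta>] JW_idem[OF Jz] by simp
    qed
    finally have AQU: "vcomp \<delta> ?A (vcomp \<delta> (?Q' \<otimes> ?I) ?U) = ?Z" .
    \<comment> \<open>\<open>- \<delta>\<close> is the circle closed on the main term
      \<open>?P'\<close>, and \<open>c\<close> comes from the correction \<open>?Q'\<close>.\<close>
    have "vcomp \<delta> ?A (vcomp \<delta> (?J \<otimes> ?I) ?U) = scale (- \<delta> + c) ?Z"
      unfolding J by (simp add: hcomp_linear vcomp_linear R AQU sl(3) flip: scale_add_left)
    moreover have "tail_length (u @ [r, b]) = Suc ?k" using tail_length_Suc[OF o(4), of w] u by simp
    \<comment> \<open>The recursion of quantum numbers: \<open>[?k]\<close> times \<open>c\<close>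
      is \<open>[?k - 1]\<close>, and \<open>[?k - 1] - \<delta> [?k] = - [?k + 1]\<close>.\<close>
    moreover have "qnum \<delta> ?k * (- \<delta> + c) = - qnum \<delta> (Suc ?k)"
    proof -
      have "2 \<le> ?k" using tail_length_ge2 o(4) by metis
      then obtain m where m: "?k = Suc m" by (cases ?k) auto
      have "qnum \<delta> ?k * c = qnum \<delta> (?k - 1) * (qnum \<delta> ?k * i)" by (simp add: c_def ac_simps)
      also have "\<dots> = qnum \<delta> (?k - 1)" using i by simp
      finally show ?thesis using m by (simp add: algebra_simps)
    qed
    ultimately show ?thesis using unit by (intro exI[of _ "- \<delta> + c"]) simp
  qed
qed

theorem proposition2p15:
  fixes S :: "'c set" and \<delta> :: "'k::comm_ring_1"
  assumes "finite S"
  shows "(\<forall>x. one_mor S x \<and> length x \<le> 2 \<longrightarrow> JW_exists S \<delta> x \<and> JW S \<delta> x = id_mor x) \<and>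
    (\<forall>x u r b.
      one_mor S x \<and> x = u @ [r, b] \<and> (\<forall>y. y \<noteq> [] \<and> prefix y x \<longrightarrow> JW_exists S \<delta> y) \<longrightarrow>
      (\<forall>g\<in>S. g \<noteq> r \<and> g \<noteq> b \<longrightarrow>
        JW_exists S \<delta> (x @ [g]) \<and> JW S \<delta> (x @ [g]) = JW S \<delta> x \<otimes> id_mor [b, g]) \<and>
      (let k = tail_length x;
           z = u @ [r];
           cap = id_mor z \<otimes> of_diag (cap_diag r b);
           cup = id_mor z \<otimes> of_diag (cup_diag r b);
           P = JW S \<delta> x \<otimes> id_mor [b, r];
           Q = vcomp \<delta> P (vcomp \<delta> cup (vcomp \<delta> (JW S \<delta> z) (vcomp \<delta> cap P)));
           c = qnum \<delta> (k - 1) * unit_inv (qnum \<delta> k);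
           e = scale (- c) Q
       in (qnum \<delta> k dvd 1 \<longrightarrow>
             JW_exists S \<delta> (x @ [r]) \<and>
             JW S \<delta> (x @ [r]) = P + scale c Q \<and>
             e \<in> Hom S (x @ [r]) (x @ [r]) \<and>
             vcomp \<delta> e e = e \<and>
             vcomp \<delta> e (JW S \<delta> (x @ [r])) = 0 \<and>
             vcomp \<delta> (JW S \<delta> (x @ [r])) e = 0) \<and>
          (\<not> qnum \<delta> k dvd 1 \<longrightarrow> \<not> JW_exists S \<delta> (x @ [r]))))"
proof (intro conjI allI impI, goal_cases)
  case (1 x)
  then show ?case by (simp add: JW_short)
next
  case (2 x)
  then show ?case by (simp add: JW_short)
next
  case (3 x u r b)
  then show ?case using JW_new_color[of S \<delta> x u r b] by (metis append_is_Nil_conv list.distinct(1) prefix_order.refl)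
next
  case (4 x u r b)
  then have o: "one_mor S (u @ [r, b])" and x: "x = u @ [r, b]"
    and ex: "\<And>y. y \<noteq> [] \<Longrightarrow> prefix y (u @ [r, b]) \<Longrightarrow> JW_exists S \<delta> y" by auto
  have Jz: "JW_exists S \<delta> (u @ [r])" and Jx: "JW_exists S \<delta> (u @ [r, b])"
    using ex[of "u @ [r]"] ex[of "u @ [r, b]"] by (auto simp: prefix_def)
  note one = one_mor_alternate[OF o]
  let ?k = "tail_length (u @ [r, b])"
  let ?i = "unit_inv (qnum \<delta> ?k)"
  let ?c = "qnum \<delta> (?k - 1) * ?i"
  obtain l where l: "qnum \<delta> (?k - 1) dvd 1" "qnum \<delta> (?k - 1) * l = - qnum \<delta> ?k"
    and tr: "vcomp \<delta> (of_diag (cap_at u r b [])) (vcomp \<delta> (JW S \<delta> (u @ [r, b]) \<otimes> id_mor [b, r])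
      (of_diag (cup_at u r b []))) = scale l (JW S \<delta> (u @ [r]))"
    using partial_trace[OF o ex] by auto
  have xr: "(u @ [r, b]) @ [r] = u @ [r, b, r]" by simp
  \<comment> \<open>As \<open>[k - 1] * l = - [k]\<close>, the coefficient in the theorem is the
    negative inverse of the trace scalar.\<close>
  have c: "?c * l = - 1" if unit: "qnum \<delta> ?k dvd 1"
  proof -
    obtain a where a: "1 = qnum \<delta> ?k * a" using unit by (rule dvdE)
    have "qnum \<delta> ?k * ?i = 1"
      unfolding unit_inv_def
    \<comment> \<open>Inverses in a commutative ring are unique, so the description defining
      \<open>unit_inv\<close> denotes the inverse.\<close>
    proof (rule theI)
      show "qnum \<delta> ?k * a = 1" using a by simp
      show "a' = a" if "qnum \<delta> ?k * a' = 1" for a'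
        using that a by (metis mult.commute mult.left_commute mult_1_right)
    qed
    moreover have "?c * l = qnum \<delta> (?k - 1) * l * ?i" by (simp add: ac_simps)
    ultimately show ?thesis unfolding l(2) by simp
  qed
  \<comment> \<open>The final claim by contraposition: \<open>- [k]\<close> is the product of the
    units \<open>[k - 1]\<close> and \<open>l\<close>.\<close>
  have unit: "qnum \<delta> ?k dvd 1" if "JW_exists S \<delta> (u @ [r, b, r])"
  proof -
    have "l dvd 1" using JW_exists_imp_unit[OF one Jz Jx tr that] .
    then have "qnum \<delta> (?k - 1) * l dvd 1" using l(1) mult_dvd_mono[of _ 1 l 1] by fastforce
    then show ?thesis unfolding l(2) by simp
  qed
  show ?case
    unfolding Let_def x xr cup_last cap_last
    using JW_recursion[OF one Jz Jx tr c] JW_recursion_idempotent[OF one Jz Jx tr c]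
      Hom_scale[OF Homs(5)[OF one Jz Jx]] unit by blast
qed

end
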